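(* Suppose there exist $m$ unique processes $Y^{1},\ldots,Y^{m}$ in $\mathcal{Q}\cap\mathcal{S}^{2}$ such that for every $i\in\mathbb{I}$ and every $t\in[0,T]$, $$Y^{i}_{t}=\operatorname*{ess\,sup}_{\tau\in\mathcal{T}_{t}}\mathsf{E}\Big[\int_{t}^{\tau}\psi_{i}(s)\,ds+\Gamma_{i}\mathbf{1}_{\{\tau=T\}}+\max_{j\neq i}\{Y^{j}_{\tau}-\gamma_{i,j}(\tau)\}\mathbf{1}_{\{\tau<T\}}\Big|\mathcal{F}_{t}\Big],\qquad Y^{i}_{T}=\Gamma_{i}.$$ Let $t\in[0,T]$ and $i\in\mathbb{I}$. Define $\tau^{*}_{0}=t$, $\iota^{*}_{0}=i$ and, for $n\ge 1$, $$\tau^{*}_{n}=\inf\Big\{s\ge\tau^{*}_{n-1}:\ Y^{\iota^{*}_{n-1}}_{s}=\max_{j\neq\iota^{*}_{n-1}}\big(Y^{j}_{s}-\gamma_{\iota^{*}_{n-1},j}(s)\big)\Big\}\wedge T,$$ and let $\iota^{*}_{n}$ be the (smallest) $j\in\mathbb{I}$, $j\neq\iota^{*}_{n-1}$, for which $$Y^{j}_{\tau^{*}_{n}}-\gamma_{\iota^{*}_{n-1},j}(\tau^{*}_{n})=\max_{k\neq\iota^{*}_{n-1}}\big(Y^{k}_{\tau^{*}_{n}}-\gamma_{\iota^{*}_{n-1},k}(\tau^{*}_{n})\big).$$ Then $\alpha^{*}=(\tau^{*}_{n},\iota^{*}_{n})_{n\ge 0}\in\mathcal{A}_{t,i}$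 and $$Y^{i}_{t}=J(\alpha^{*};t,i)=\operatorname*{ess\,sup}_{\alpha\in\mathcal{A}_{t,i}}J(\alpha;t,i)\qquad\mathsf{P}\text{-a.s.}$$
   Context: Setting. Let $0<T<\infty$ and let $(\Omega,\mathcal{F},\mathbb{F},\mathsf{P})$ be a complete filtered probability space, $\mathbb{F}=(\mathcal{F}_{t})_{0\le t\le T}$, satisfying the usual conditions (right-continuity and $\mathsf P$-completeness) and quasi-left-continuous, i.e. $\mathcal{F}_{S}=\mathcal{F}_{S^{-}}$ for every predictable time $S>0$. $\mathcal{T}$ is the set of $\mathbb{F}$-stopping times $\nu$ with $0\le\nu\le T$ a.s.; for $S\in\mathcal{T}$, $\mathcal{T}_{S}=\{\nu\in\mathcal{T}:\nu\ge S\ \mathsf{P}\text{-a.s.}\}$. Spaces. $L^{2}$: square-integrable random variables. $\mathcal{Q}$: adapted c\`adl\`ag processes $X$ that are quasi-left-continuous, i.e. $X_{S}=X_{S^-}$ a.s. for every predictable time $S$. $\mathcal{M}^{2}$: progressively measurable $X$ with $\mathsf{E}[\int_{0}^{T}|X_{t}|^{2}dt]<\infty$. $\mathcal{S}^{2}$: adapted c\`adl\`ag $X$ with $\mathsf{E}[(\sup_{0\le t\le T}|X_{t}|)^{2}]<\infty$. Data. $\mathbb{I}=\{1,\ldots,m\}$, $m\ge2$. For all $i,j\in\mathbb{I}$: $\psi_{i}\in\mathcal{M}^{2}$ (running profit), $\gamma_{i,j}\in\mathcal{Q}\cap\mathcal{S}^{2}$ (real-valued switching cost from $i$ to $j$),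 $\Gamma_{i}\in L^{2}$ is $\mathcal{F}_{T}$-measurable (terminal reward). For every $i,j,k\in\mathbb{I}$ and every $t\in[0,T]$, a.s.: $\gamma_{i,i}(t)=0$; $\gamma_{i,k}(t)<\gamma_{i,j}(t)+\gamma_{j,k}(t)$ if $i\neq j$ and $j\neq k$; $\Gamma_{i}\ge\max_{j\neq i}\{\Gamma_{j}-\gamma_{i,j}(T)\}$. Random indices. For an $\mathbb{I}$-valued random variable $\iota$, $Y^{\iota}=\sum_{j}\mathbf{1}_{\{\iota=j\}}Y^{j}$, and similarly for $\gamma_{\iota,\iota'}$, $\psi_\iota$, $\Gamma_\iota$. Strategies. For $(t,i)\in[0,T]\times\mathbb{I}$, $\mathcal{A}_{t,i}$ is the set of $\alpha=(\tau_{n},\iota_{n})_{n\ge0}$ such that: (1) $\tau_{n}\in\mathcal{T}_{t}$, $\tau_{0}=t$, $(\tau_{n})$ non-decreasing; (2) $\iota_{n}:\Omega\to\mathbb{I}$ is $\mathcal{F}_{\tau_{n}}$-measurable, $\iota_{0}=i$, $\iota_{n}\neq\iota_{n+1}$; (3) $\mathsf{P}(\tau_{n}<T\ \forall n\ge0)=0$; (4) with $C^{\alpha}_{n}=\sum_{k=1}^{n}\gamma_{\iota_{k-1},\iota_{k}}(\tau_{k})\mathbf{1}_{\{\tau_{k}<T\}}$, $\mathsf{E}[\sup_{n}|C^{\alpha}_{n}|]<\infty$. The mode indicator of $\alpha$ is $\mathbf{u}_{s}=\iota_{0}\mathbf{1}_{[\tau_{0},\tau_{1}]}(s)+\sum_{n\ge1}\iota_{n}\mathbf{1}_{(\tau_{n},\tau_{n+1}]}(s)$,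 and the performance index is $$J(\alpha;t,i)=\mathsf{E}\Big[\int_{t}^{T}\psi_{\mathbf{u}_{s}}(s)ds+\Gamma_{\mathbf{u}_{T}}-\sum_{n\ge1}\gamma_{\iota_{n-1},\iota_{n}}(\tau_{n})\mathbf{1}_{\{\tau_{n}<T\}}\Big|\mathcal{F}_{t}\Big].$$
   Formalization: The switching-cost relations "for every t, a.s." are assumed to hold a.s. for all t simultaneously; with null sets depending on t the strict triangle inequality can fail at a random time, where the candidate strategy may switch infinitely often, and the claim is false. *)

theory Defs
  imports "HOL-Probability.Probability"
begin

section \<open>Stopping times and standing assumptions on the filtration\<close>

definition stopping_times :: "'a measure \<Rightarrow> (real \<Rightarrow> 'a measure) \<Rightarrow> real \<Rightarrow> ('a \<Rightarrow> real) set" where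
  "stopping_times M F T = {\<nu>. stopping_time F \<nu> \<and> (AE \<omega> in M. 0 \<le> \<nu> \<omega> \<and> \<nu> \<omega> \<le> T)}"

definition stopping_times_from ::
  "'a measure \<Rightarrow> (real \<Rightarrow> 'a measure) \<Rightarrow> real \<Rightarrow> ('a \<Rightarrow> real) \<Rightarrow> ('a \<Rightarrow> real) set" where
  "stopping_times_from M F T S = {\<nu> \<in> stopping_times M F T. AE \<omega> in M. S \<omega> \<le> \<nu> \<omega>}"

text \<open>Predictability by an almost surely announcing sequence; under the usual conditions this is
  the same as having a graph in the predictable \<open>\<sigma>\<close>-algebra.  The constant \<open>0\<close> is predictable.\<close>

definition predictable_time ::
  "'a measure \<Rightarrow> (real \<Rightarrow> 'a measure) \<Rightarrow> real \<Rightarrow> ('a \<Rightarrow> real) \<Rightarrow> bool" where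
  "predictable_time M F T S \<longleftrightarrow>
     S \<in> stopping_times M F T \<and>
     (\<exists>\<sigma>. (\<forall>n. \<sigma> n \<in> stopping_times M F T) \<and>
          (AE \<omega> in M. incseq (\<lambda>n. \<sigma> n \<omega>) \<and> (\<lambda>n. \<sigma> n \<omega>) \<longlonglongrightarrow> S \<omega> \<and>
                      (0 < S \<omega> \<longrightarrow> (\<forall>n. \<sigma> n \<omega> < S \<omega>))))"

text \<open>The \<open>\<sigma>\<close>-algebra of events strictly before \<open>S\<close>, generated by \<open>F 0\<close> and the
  sets \<open>A \<inter> {t < S}\<close> with \<open>A\<close> in \<open>F t\<close>.\<close>

definition strict_past ::
  "'a measure \<Rightarrow> (real \<Rightarrow> 'a measure) \<Rightarrow> real \<Rightarrow> ('a \<Rightarrow> real) \<Rightarrow> 'a measure" where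
  "strict_past M F T S =
     sigma (space M) (sets (F 0) \<union> {{\<omega> \<in> A. t < S \<omega>} | A t. t \<in> {0..T} \<and> A \<in> sets (F t)})"

text \<open>The library's notions of filtration and stopping time use the whole type of time points as
  index set.  A filtration indexed by \<open>[0,T]\<close> is encoded as a family indexed by the reals that
  is constant to the left of \<open>0\<close> and to the right of \<open>T\<close>.\<close>

locale filtered_prob_space =
  prob_space M + complete_measure M + filtration "space M" F
  for M :: "'a measure" and F :: "real \<Rightarrow> 'a measure" +
  fixes T :: real
  assumes T_pos: "0 < T"
    and F_before: "\<And>t. t < 0 \<Longrightarrow> sets (F t) = sets (F 0)"
    and F_after: "\<And>t. T < t \<Longrightarrow> sets (F t) = sets (F T)"
    and F_subset: "\<And>t. sets (F t) \<subseteq> sets M"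
    and F_complete: "null_sets M \<subseteq> sets (F 0)"
    and F_right_cont: "\<And>t. 0 \<le> t \<Longrightarrow> t < T \<Longrightarrow> sets (F t) = (\<Inter>s\<in>{t<..T}. sets (F s))"
    and F_quasi_left_cont: "\<And>S. predictable_time M F T S \<Longrightarrow> (AE \<omega> in M. 0 < S \<omega>) \<Longrightarrow>
           sets (filtration.pre_sigma (space M) F S) = sets (strict_past M F T S)"

section \<open>Spaces of processes\<close>

definition cadlag_on :: "real \<Rightarrow> (real \<Rightarrow> real) \<Rightarrow> bool" where
  "cadlag_on T x \<longleftrightarrow>
     (\<forall>s. 0 \<le> s \<and> s < T \<longrightarrow> (x \<longlongrightarrow> x s) (at_right s)) \<and>
     (\<forall>s. 0 < s \<and> s \<le> T \<longrightarrow> (\<exists>l. (x \<longlongrightarrow> l) (at_left s)))"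

definition adapted_cadlag :: "'a measure \<Rightarrow> (real \<Rightarrow> 'a measure) \<Rightarrow> real \<Rightarrow> (real \<Rightarrow> 'a \<Rightarrow> real) set" where
  "adapted_cadlag M F T =
     {X. (\<forall>t\<in>{0..T}. X t \<in> borel_measurable (F t)) \<and> (AE \<omega> in M. cadlag_on T (\<lambda>t. X t \<omega>))}"

text \<open>The usual convention for the left limit at time zero is that it is the value at time zero.\<close>

definition left_limit :: "(real \<Rightarrow> real) \<Rightarrow> real \<Rightarrow> real" where
  "left_limit x s = (if s \<le> 0 then x s else Lim (at_left s) x)"

definition space_Q :: "'a measure \<Rightarrow> (real \<Rightarrow> 'a measure) \<Rightarrow> real \<Rightarrow> (real \<Rightarrow> 'a \<Rightarrow> real) set" where
  "space_Q M F T =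
     {X \<in> adapted_cadlag M F T.
        \<forall>S. predictable_time M F T S \<longrightarrow>
            (AE \<omega> in M. X (S \<omega>) \<omega> = left_limit (\<lambda>t. X t \<omega>) (S \<omega>))}"

definition space_S2 :: "'a measure \<Rightarrow> (real \<Rightarrow> 'a measure) \<Rightarrow> real \<Rightarrow> (real \<Rightarrow> 'a \<Rightarrow> real) set" where
  "space_S2 M F T =
     {X \<in> adapted_cadlag M F T. (\<integral>\<^sup>+\<omega>. (SUP t\<in>{0..T}. ennreal \<bar>X t \<omega>\<bar>)\<^sup>2 \<partial>M) < \<infinity>}"

definition progressively_measurable :: "(real \<Rightarrow> 'a measure) \<Rightarrow> real \<Rightarrow> (real \<Rightarrow> 'a \<Rightarrow> real) \<Rightarrow> bool" where
  "progressively_measurable F T X \<longleftrightarrow>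
     (\<forall>t\<in>{0..T}. (\<lambda>(s, \<omega>). X s \<omega>) \<in> borel_measurable (restrict_space borel {0..t} \<Otimes>\<^sub>M F t))"

definition space_M2 :: "'a measure \<Rightarrow> (real \<Rightarrow> 'a measure) \<Rightarrow> real \<Rightarrow> (real \<Rightarrow> 'a \<Rightarrow> real) set" where
  "space_M2 M F T =
     {X. progressively_measurable F T X \<and>
         (\<integral>\<^sup>+\<omega>. (\<integral>\<^sup>+s\<in>{0..T}. ennreal (\<bar>X s \<omega>\<bar>\<^sup>2) \<partial>lborel) \<partial>M) < \<infinity>}"

text \<open>The essential supremum of a family of random variables (in contrast to the library's
  \<open>esssup\<close> of a single function) is the least upper bound with respect to the almost sure order;
  it is determined only up to almost sure equality, hence a predicate.  All families considered
  below are nonempty, so that quantifying over real-valued rather than extended real-valued upper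
  bounds makes no difference.\<close>

definition is_ess_sup :: "'a measure \<Rightarrow> ('a \<Rightarrow> real) set \<Rightarrow> ('a \<Rightarrow> real) \<Rightarrow> bool" where
  "is_ess_sup M \<Phi> Z \<longleftrightarrow>
     Z \<in> borel_measurable M \<and>
     (\<forall>X\<in>\<Phi>. AE \<omega> in M. X \<omega> \<le> Z \<omega>) \<and>
     (\<forall>W\<in>borel_measurable M. (\<forall>X\<in>\<Phi>. AE \<omega> in M. X \<omega> \<le> W \<omega>) \<longrightarrow> (AE \<omega> in M. Z \<omega> \<le> W \<omega>))"

section \<open>The optimal switching problem\<close>

text \<open>The modes are \<open>1, \<dots>, m\<close>.  The relations between the costs at time \<open>t\<close> are required to hold
  outside one null set for all \<open>t\<close> simultaneously: for the strict triangle inequality this is more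
  than having it almost surely at each fixed \<open>t\<close>, and it is what makes the inequality available
  at stopping times.\<close>

locale switching_problem =
  filtered_prob_space M F T
  for M :: "'a measure" and F :: "real \<Rightarrow> 'a measure" and T :: real +
  fixes m :: nat
    and \<psi> :: "nat \<Rightarrow> real \<Rightarrow> 'a \<Rightarrow> real"
    and \<gamma> :: "nat \<Rightarrow> nat \<Rightarrow> real \<Rightarrow> 'a \<Rightarrow> real"
    and \<Gamma> :: "nat \<Rightarrow> 'a \<Rightarrow> real"
  assumes m_ge_2: "2 \<le> m"
    and psi_M2: "\<And>i. i \<in> {1..m} \<Longrightarrow> \<psi> i \<in> space_M2 M F T"
    and gamma_Q_S2: "\<And>i j. i \<in> {1..m} \<Longrightarrow> j \<in> {1..m} \<Longrightarrow>
           \<gamma> i j \<in> space_Q M F T \<inter> space_S2 M F T"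
    and Gamma_measurable: "\<And>i. i \<in> {1..m} \<Longrightarrow> \<Gamma> i \<in> borel_measurable (F T)"
    and Gamma_L2: "\<And>i. i \<in> {1..m} \<Longrightarrow> integrable M (\<lambda>\<omega>. (\<Gamma> i \<omega>)\<^sup>2)"
    and gamma_diag: "\<And>i. i \<in> {1..m} \<Longrightarrow> AE \<omega> in M. \<forall>t\<in>{0..T}. \<gamma> i i t \<omega> = 0"
    and gamma_triangle: "\<And>i j k. i \<in> {1..m} \<Longrightarrow> j \<in> {1..m} \<Longrightarrow> k \<in> {1..m} \<Longrightarrow> i \<noteq> j \<Longrightarrow> j \<noteq> k \<Longrightarrow>
           AE \<omega> in M. \<forall>t\<in>{0..T}. \<gamma> i k t \<omega> < \<gamma> i j t \<omega> + \<gamma> j k t \<omega>"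
    and Gamma_terminal: "\<And>i. i \<in> {1..m} \<Longrightarrow>
           AE \<omega> in M. \<Gamma> i \<omega> \<ge> Max ((\<lambda>j. \<Gamma> j \<omega> - \<gamma> i j T \<omega>) ` ({1..m} - {i}))"

text \<open>A strategy is a pair of sequences \<open>\<tau>\<close> (switching times) and \<open>\<iota>\<close> (modes).\<close>

definition cumulative_cost ::
  "real \<Rightarrow> (nat \<Rightarrow> nat \<Rightarrow> real \<Rightarrow> 'a \<Rightarrow> real) \<Rightarrow> (nat \<Rightarrow> 'a \<Rightarrow> real) \<Rightarrow> (nat \<Rightarrow> 'a \<Rightarrow> nat) \<Rightarrow>
   nat \<Rightarrow> 'a \<Rightarrow> real" where
  "cumulative_cost T \<gamma> \<tau> \<iota> n \<omega> =
     (\<Sum>k=1..n. \<gamma> (\<iota> (k - 1) \<omega>) (\<iota> k \<omega>) (\<tau> k \<omega>) \<omega> * of_bool (\<tau> k \<omega> < T))"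

definition strategies ::
  "'a measure \<Rightarrow> (real \<Rightarrow> 'a measure) \<Rightarrow> real \<Rightarrow> nat \<Rightarrow> (nat \<Rightarrow> nat \<Rightarrow> real \<Rightarrow> 'a \<Rightarrow> real) \<Rightarrow>
   real \<Rightarrow> nat \<Rightarrow> ((nat \<Rightarrow> 'a \<Rightarrow> real) \<times> (nat \<Rightarrow> 'a \<Rightarrow> nat)) set" where
  "strategies M F T m \<gamma> t i = {(\<tau>, \<iota>).
     (\<forall>n. \<tau> n \<in> stopping_times_from M F T (\<lambda>_. t)) \<and>
     (\<forall>\<omega>\<in>space M. \<tau> 0 \<omega> = t \<and> (\<forall>n. \<tau> n \<omega> \<le> \<tau> (Suc n) \<omega>)) \<and>
     (\<forall>n. \<iota> n \<in> measurable (filtration.pre_sigma (space M) F (\<tau> n)) (count_space {1..m})) \<and>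
     (\<forall>\<omega>\<in>space M. \<iota> 0 \<omega> = i \<and> (\<forall>n. \<iota> n \<omega> \<noteq> \<iota> (Suc n) \<omega>)) \<and>
     measure M {\<omega> \<in> space M. \<forall>n. \<tau> n \<omega> < T} = 0 \<and>
     (\<integral>\<^sup>+\<omega>. (SUP n. ennreal \<bar>cumulative_cost T \<gamma> \<tau> \<iota> n \<omega>\<bar>) \<partial>M) < \<infinity>}"

text \<open>For nondecreasing \<open>\<tau>\<close> at most one summand is nonzero, so the series of naturals converges.\<close>

definition mode_indicator ::
  "(nat \<Rightarrow> 'a \<Rightarrow> real) \<Rightarrow> (nat \<Rightarrow> 'a \<Rightarrow> nat) \<Rightarrow> real \<Rightarrow> 'a \<Rightarrow> nat" where
  "mode_indicator \<tau> \<iota> s \<omega> =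
     \<iota> 0 \<omega> * indicator {\<tau> 0 \<omega>..\<tau> 1 \<omega>} s +
     (\<Sum>n. \<iota> (Suc n) \<omega> * indicator {\<tau> (Suc n) \<omega><..\<tau> (Suc (Suc n)) \<omega>} s)"

text \<open>The initial mode is not an argument of the performance index, being \<open>\<iota> 0\<close>.\<close>

definition performance ::
  "'a measure \<Rightarrow> (real \<Rightarrow> 'a measure) \<Rightarrow> real \<Rightarrow> (nat \<Rightarrow> real \<Rightarrow> 'a \<Rightarrow> real) \<Rightarrow>
   (nat \<Rightarrow> nat \<Rightarrow> real \<Rightarrow> 'a \<Rightarrow> real) \<Rightarrow> (nat \<Rightarrow> 'a \<Rightarrow> real) \<Rightarrow> real \<Rightarrow>
   (nat \<Rightarrow> 'a \<Rightarrow> real) \<Rightarrow> (nat \<Rightarrow> 'a \<Rightarrow> nat) \<Rightarrow> 'a \<Rightarrow> real" where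
  "performance M F T \<psi> \<gamma> \<Gamma> t \<tau> \<iota> =
     real_cond_exp M (F t) (\<lambda>\<omega>.
       (LINT s:{t..T}|lborel. \<psi> (mode_indicator \<tau> \<iota> s \<omega>) s \<omega>)
       + \<Gamma> (mode_indicator \<tau> \<iota> T \<omega>) \<omega>
       - (\<Sum>n. \<gamma> (\<iota> n \<omega>) (\<iota> (Suc n) \<omega>) (\<tau> (Suc n) \<omega>) \<omega> * of_bool (\<tau> (Suc n) \<omega> < T)))"

section \<open>The system of optimal stopping problems and the candidate strategy\<close>

definition switching_value ::
  "nat \<Rightarrow> (nat \<Rightarrow> nat \<Rightarrow> real \<Rightarrow> 'a \<Rightarrow> real) \<Rightarrow> (nat \<Rightarrow> real \<Rightarrow> 'a \<Rightarrow> real) \<Rightarrow>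
   nat \<Rightarrow> real \<Rightarrow> 'a \<Rightarrow> real" where
  "switching_value m \<gamma> Y i s \<omega> = Max ((\<lambda>j. Y j s \<omega> - \<gamma> i j s \<omega>) ` ({1..m} - {i}))"

definition stopping_reward ::
  "real \<Rightarrow> nat \<Rightarrow> (nat \<Rightarrow> real \<Rightarrow> 'a \<Rightarrow> real) \<Rightarrow> (nat \<Rightarrow> nat \<Rightarrow> real \<Rightarrow> 'a \<Rightarrow> real) \<Rightarrow> (nat \<Rightarrow> 'a \<Rightarrow> real) \<Rightarrow>
   (nat \<Rightarrow> real \<Rightarrow> 'a \<Rightarrow> real) \<Rightarrow> nat \<Rightarrow> real \<Rightarrow> ('a \<Rightarrow> real) \<Rightarrow> 'a \<Rightarrow> real" where
  "stopping_reward T m \<psi> \<gamma> \<Gamma> Y i t \<tau> \<omega> =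
     (LINT s:{t..\<tau> \<omega>}|lborel. \<psi> i s \<omega>)
     + \<Gamma> i \<omega> * of_bool (\<tau> \<omega> = T)
     + switching_value m \<gamma> Y i (\<tau> \<omega>) \<omega> * of_bool (\<tau> \<omega> < T)"

definition optimal_stopping_system ::
  "'a measure \<Rightarrow> (real \<Rightarrow> 'a measure) \<Rightarrow> real \<Rightarrow> nat \<Rightarrow> (nat \<Rightarrow> real \<Rightarrow> 'a \<Rightarrow> real) \<Rightarrow>
   (nat \<Rightarrow> nat \<Rightarrow> real \<Rightarrow> 'a \<Rightarrow> real) \<Rightarrow> (nat \<Rightarrow> 'a \<Rightarrow> real) \<Rightarrow> (nat \<Rightarrow> real \<Rightarrow> 'a \<Rightarrow> real) \<Rightarrow> bool" where
  "optimal_stopping_system M F T m \<psi> \<gamma> \<Gamma> Y \<longleftrightarrow>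
     (\<forall>i\<in>{1..m}.
        Y i \<in> space_Q M F T \<inter> space_S2 M F T \<and>
        (\<forall>t\<in>{0..T}.
           is_ess_sup M
             {real_cond_exp M (F t) (stopping_reward T m \<psi> \<gamma> \<Gamma> Y i t \<tau>) | \<tau>.
                \<tau> \<in> stopping_times_from M F T (\<lambda>_. t)}
             (Y i t)) \<and>
        (AE \<omega> in M. Y i T \<omega> = \<Gamma> i \<omega>))"

definition indistinguishable ::
  "'a measure \<Rightarrow> real \<Rightarrow> (real \<Rightarrow> 'a \<Rightarrow> real) \<Rightarrow> (real \<Rightarrow> 'a \<Rightarrow> real) \<Rightarrow> bool" where
  "indistinguishable M T X X' \<longleftrightarrow> (AE \<omega> in M. \<forall>t\<in>{0..T}. X t \<omega> = X' t \<omega>)"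

text \<open>\<open>inf A \<and> T\<close> with the convention \<open>inf {} = \<infinity>\<close>; processes live on \<open>[0,T]\<close> only.\<close>

definition next_switching_time ::
  "real \<Rightarrow> nat \<Rightarrow> (nat \<Rightarrow> nat \<Rightarrow> real \<Rightarrow> 'a \<Rightarrow> real) \<Rightarrow> (nat \<Rightarrow> real \<Rightarrow> 'a \<Rightarrow> real) \<Rightarrow>
   real \<Rightarrow> nat \<Rightarrow> 'a \<Rightarrow> real" where
  "next_switching_time T m \<gamma> Y r i \<omega> =
     (let A = {s \<in> {r..T}. Y i s \<omega> = switching_value m \<gamma> Y i s \<omega>}
      in if A = {} then T else Inf A)"

definition next_mode ::
  "nat \<Rightarrow> (nat \<Rightarrow> nat \<Rightarrow> real \<Rightarrow> 'a \<Rightarrow> real) \<Rightarrow> (nat \<Rightarrow> real \<Rightarrow> 'a \<Rightarrow> real) \<Rightarrow>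
   real \<Rightarrow> nat \<Rightarrow> 'a \<Rightarrow> nat" where
  "next_mode m \<gamma> Y s i \<omega> =
     (LEAST j. j \<in> {1..m} \<and> j \<noteq> i \<and> Y j s \<omega> - \<gamma> i j s \<omega> = switching_value m \<gamma> Y i s \<omega>)"

primrec candidate ::
  "real \<Rightarrow> nat \<Rightarrow> (nat \<Rightarrow> nat \<Rightarrow> real \<Rightarrow> 'a \<Rightarrow> real) \<Rightarrow> (nat \<Rightarrow> real \<Rightarrow> 'a \<Rightarrow> real) \<Rightarrow>
   real \<Rightarrow> nat \<Rightarrow> nat \<Rightarrow> 'a \<Rightarrow> real \<times> nat" where
  "candidate T m \<gamma> Y t i 0 = (\<lambda>\<omega>. (t, i))"
| "candidate T m \<gamma> Y t i (Suc n) = (\<lambda>\<omega>.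
     let (r, k) = candidate T m \<gamma> Y t i n \<omega>;
         s = next_switching_time T m \<gamma> Y r k \<omega>
     in (s, next_mode m \<gamma> Y s k \<omega>))"

definition candidate_time ::
  "real \<Rightarrow> nat \<Rightarrow> (nat \<Rightarrow> nat \<Rightarrow> real \<Rightarrow> 'a \<Rightarrow> real) \<Rightarrow> (nat \<Rightarrow> real \<Rightarrow> 'a \<Rightarrow> real) \<Rightarrow>
   real \<Rightarrow> nat \<Rightarrow> nat \<Rightarrow> 'a \<Rightarrow> real" where
  "candidate_time T m \<gamma> Y t i n \<omega> = fst (candidate T m \<gamma> Y t i n \<omega>)"

definition candidate_mode ::
  "real \<Rightarrow> nat \<Rightarrow> (nat \<Rightarrow> nat \<Rightarrow> real \<Rightarrow> 'a \<Rightarrow> real) \<Rightarrow> (nat \<Rightarrow> real \<Rightarrow> 'a \<Rightarrow> real) \<Rightarrow>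
   real \<Rightarrow> nat \<Rightarrow> nat \<Rightarrow> 'a \<Rightarrow> nat" where
  "candidate_mode T m \<gamma> Y t i n \<omega> = snd (candidate T m \<gamma> Y t i n \<omega>)"

end

theory Submission
  imports Defs
begin

text \<open>Let \<open>X i = Y i + \<integral> \<psi> i\<close>.  The defining property of \<open>Y i\<close> makes \<open>X i\<close> a supermartingale, and a
  martingale between a stopping time and the next time at which \<open>Y i\<close> meets the switching value: an
  almost optimal stopping time must be close to that hitting time, and quasi-left-continuity makes the
  hitting time of \<open>{Z = 0}\<close> the limit of those of \<open>{Z < \<epsilon>}\<close>, where \<open>Z\<close> is \<open>Y i\<close> minus the switching value.
  For a strategy, let \<open>N n\<close> be the sum over \<open>k < n\<close> of the increments of \<open>X (\<iota> k)\<close> from \<open>\<tau> k\<close> to \<open>\<tau> (k + 1)\<close>.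
  The profit up to \<open>\<tau> n\<close> minus the costs plus the value at \<open>\<tau> n\<close> is at most \<open>Y i t + N n\<close>, with
  equality for the candidate, for which \<open>N\<close> is a martingale; conditional expectations and \<open>n \<rightarrow> \<infinity>\<close>
  give both halves of the verification.

  The costs are signed, so the integrability of the cumulative costs of the candidate has to come
  from \<open>N\<close>.  Its quadratic variation is bounded by those of the \<open>X j\<close> sampled along the switching times,
  which are controlled in mean by the discrete Doob decomposition of a supermartingale dominated by a
  square-integrable variable; Doob's maximal inequality then bounds the supremum.\<close>

section \<open>Stopping times and quasi-left-continuity\<close>

text \<open>The equations for \<open>Y i\<close> speak about deterministic times only, whereas a
  strategy switches at stopping times and in random modes. Statements are therefore proved at fixed
  times, in the weak form "expectation of an increment over an event of the past", then carried to
  stopping times by rounding up to a grid and using right-continuity, and to random modes by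
  splitting along the events on which the mode is constant. The essential supremum is handled in
  mean as well: pasting makes the family of conditional rewards directed, so its supremum is
  approximated by expectations of single members. Limits of increasing stopping times are approached
  from the left, where right-continuity gives nothing; this is where quasi-left-continuity of the
  processes enters, for the hitting times and again for the exclusion of infinitely many switches.
  For the candidate, both the finite number of switches and the integrability of the costs are
  conclusions, so the pathwise decomposition is set up for plans that are not yet known to be
  admissible.\<close>

lemma (in complete_measure) measurable_AE_cong:
  assumes f: "f \<in> measurable G N" and G: "null_sets M \<subseteq> sets G" "space G = space M"
    and ae: "AE \<omega> in M. f \<omega> = g \<omega>" and g: "\<And>\<omega>. \<omega> \<in> space M \<Longrightarrow> g \<omega> \<in> space N"
  shows "g \<in> measurable G N"
proof -
  obtain Z where Z: "Z \<in> null_sets M" "\<And>\<omega>. \<omega> \<in> space M - Z \<Longrightarrow> f \<omega> = g \<omega>"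
    using AE_E3[OF ae] by metis
  show ?thesis
  proof (rule measurableI)
    fix \<omega> assume "\<omega> \<in> space G" then show "g \<omega> \<in> space N" using g G by auto
  next
    fix A assume A: "A \<in> sets N"
    have sub: "g -` A \<inter> space M \<inter> Z \<subseteq> Z" by auto
    have "g -` A \<inter> space M \<inter> Z \<in> null_sets M"
      using null_sets_subset[OF Z(1) complete[OF sub Z(1)] sub] .
    moreover have "f -` A \<inter> space G - Z \<in> sets G"
      using measurable_sets[OF f A] Z(1) G by auto
    moreover have "g -` A \<inter> space G = (f -` A \<inter> space G - Z) \<union> (g -` A \<inter> space M \<inter> Z)"
      using Z(2) G by auto
    ultimately show "g -` A \<inter> space G \<in> sets G" using G(1) by (metis sets.Un subsetD)
  qed
qed

lemma (in complete_measure) borel_measurable_AE_cong: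
  assumes "f \<in> borel_measurable M" "AE \<omega> in M. f \<omega> = g \<omega>"
  shows "g \<in> borel_measurable M"
  by (rule measurable_AE_cong[OF assms(1) _ _ assms(2)]) auto

text \<open>Convergence is known only outside a null set. The total function \<open>lim\<close>
  gives a measurable version of the limit, and since \<open>G\<close> contains all null sets, every
  function that agrees with it almost everywhere is measurable too.\<close>

lemma (in complete_measure) borel_measurable_AE_LIMSEQ:
  fixes f :: "nat \<Rightarrow> 'a \<Rightarrow> real"
  assumes f: "\<And>n. f n \<in> borel_measurable G" and G: "null_sets M \<subseteq> sets G" "space G = space M"
    and lim: "AE \<omega> in M. (\<lambda>n. f n \<omega>) \<longlonglongrightarrow> g \<omega>"
  shows "g \<in> borel_measurable G"
proof (rule measurable_AE_cong[OF _ G])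
  show "(\<lambda>\<omega>. lim (\<lambda>n. f n \<omega>)) \<in> borel_measurable G"
    using f by (rule borel_measurable_lim_metric)
  show "AE \<omega> in M. lim (\<lambda>n. f n \<omega>) = g \<omega>"
    using lim by eventually_elim (rule limI)
qed auto

text \<open>The sequence may touch \<open>s\<close>, hence continuity within the closed half-line
  and not just a right limit. At \<open>s = T\<close> no right limit is provided by
  \<open>cadlag_on\<close>, but there the bounds force the sequence to be constant.\<close>

lemma cadlag_on_tendsto_right:
  assumes x: "cadlag_on T x" and s: "s \<in> {0..T}"
    and u: "u \<longlonglongrightarrow> s" "\<And>n. s \<le> u n" "\<And>n. u n \<le> T"
  shows "(\<lambda>n. x (u n)) \<longlonglongrightarrow> x s"
proof (cases "s = T")
  case True
  then have "u n = s" for n using u(2,3)[of n] by auto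
  then show ?thesis by simp
next
  case False
  then have "continuous (at s within {s..}) x"
    using x s by (auto simp: cadlag_on_def continuous_within at_within_Ici_at_right)
  then show ?thesis
    by (rule continuous_within_tendsto_compose'[OF _ _ u(1)]) (use u(2) in auto)
qed

section \<open>Events, stopping times and stopped sigma-algebras under changes on null sets\<close>

context filtered_prob_space
begin

lemma subalgebra_F: "subalgebra M (F t)"
  by (simp add: subalgebra_def space_F F_subset)

lemma borel_measurable_F_M: "f \<in> borel_measurable (F t) \<Longrightarrow> f \<in> borel_measurable M"
  using measurable_from_subalg[OF subalgebra_F] by blast

lemma null_sets_F: "null_sets M \<subseteq> sets (F t)"
  using F_complete F_before[of t] sets_F_mono[of 0 t] by (cases "t < 0") auto

lemma sets_F_AE_cong:
  assumes "A \<in> sets (F t)" "B \<subseteq> space M" "AE \<omega> in M. \<omega> \<in> A \<longleftrightarrow> \<omega> \<in> B"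
  shows "B \<in> sets (F t)"
proof -
  have "(\<lambda>\<omega>. \<omega> \<in> A) \<in> measurable (F t) (count_space UNIV)"
    using assms(1) by measurable
  then have "(\<lambda>\<omega>. \<omega> \<in> B) \<in> measurable (F t) (count_space UNIV)"
    by (rule measurable_AE_cong[OF _ null_sets_F _ assms(3)]) (auto simp: space_F)
  then have "{\<omega> \<in> space (F t). \<omega> \<in> B} \<in> sets (F t)" by (simp add: pred_def)
  also have "{\<omega> \<in> space (F t). \<omega> \<in> B} = B" using assms(2) by (auto simp: space_F)
  finally show ?thesis .
qed

lemma stopping_time_iff: "stopping_time F \<sigma> \<longleftrightarrow> (\<forall>s. {\<omega> \<in> space M. \<sigma> \<omega> \<le> s} \<in> sets (F s))"
  by (simp add: stopping_time_def pred_def space_F)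

lemma stopping_time_AE_cong:
  assumes "stopping_time F \<sigma>" "AE \<omega> in M. \<sigma> \<omega> = \<sigma>' \<omega>"
  shows "stopping_time F \<sigma>'"
  unfolding stopping_time_iff
proof
  fix s
  show "{\<omega> \<in> space M. \<sigma>' \<omega> \<le> s} \<in> sets (F s)"
  proof (rule sets_F_AE_cong)
    show "{\<omega> \<in> space M. \<sigma> \<omega> \<le> s} \<in> sets (F s)" using assms(1) by (simp add: stopping_time_iff)
    show "AE \<omega> in M. (\<omega> \<in> {\<omega> \<in> space M. \<sigma> \<omega> \<le> s}) = (\<omega> \<in> {\<omega> \<in> space M. \<sigma>' \<omega> \<le> s})"
      using assms(2) by eventually_elim auto
  qed auto
qed

text \<open>Serves to keep the modes of a given strategy measurable after its switching times have
  been modified on a null set.\<close>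

lemma sets_pre_sigma_AE_cong:
  assumes "stopping_time F \<sigma>" "stopping_time F \<sigma>'" "AE \<omega> in M. \<sigma> \<omega> = \<sigma>' \<omega>"
  shows "sets (pre_sigma \<sigma>) = sets (pre_sigma \<sigma>')"
proof -
  have *: "A \<in> sets (pre_sigma \<sigma>')"
    if "stopping_time F \<sigma>" "stopping_time F \<sigma>'" "AE \<omega> in M. \<sigma> \<omega> = \<sigma>' \<omega>" "A \<in> sets (pre_sigma \<sigma>)"
    for \<sigma> \<sigma>' A
  proof (rule sets_pre_sigmaI[OF that(2)])
    fix s
    have A: "A \<subseteq> space M" using sets.sets_into_space[OF that(4)] by (simp add: space_pre_sigma)
    show "{\<omega> \<in> A. \<sigma>' \<omega> \<le> s} \<in> sets (F s)"
    proof (rule sets_F_AE_cong)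
      show "{\<omega> \<in> A. \<sigma> \<omega> \<le> s} \<in> sets (F s)" using that by (auto intro: sets_pre_sigmaD)
      show "AE \<omega> in M. (\<omega> \<in> {\<omega> \<in> A. \<sigma> \<omega> \<le> s}) = (\<omega> \<in> {\<omega> \<in> A. \<sigma>' \<omega> \<le> s})"
        using that(3) by eventually_elim auto
    qed (use A in auto)
  qed
  have "AE \<omega> in M. \<sigma>' \<omega> = \<sigma> \<omega>" using assms(3) by eventually_elim auto
  then show ?thesis using *[OF assms] *[OF assms(2,1)] by blast
qed

text \<open>In contrast to \<open>stopping_times\<close>, the bounds hold at every point of the
  type, so that pathwise arguments at a stopped time need no exceptional set. Clipping leads from
  the almost sure notion to this one.\<close>

definition bounded_times :: "('a \<Rightarrow> real) set" where
  "bounded_times = {\<sigma>. stopping_time F \<sigma> \<and> (\<forall>\<omega>. \<sigma> \<omega> \<in> {0..T})}"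

lemma bounded_timesD:
  assumes "\<sigma> \<in> bounded_times"
  shows "stopping_time F \<sigma>" "0 \<le> \<sigma> \<omega>" "\<sigma> \<omega> \<le> T"
  using assms by (auto simp: bounded_times_def)

lemma bounded_timesI:
  assumes "stopping_time F \<sigma>" "\<And>\<omega>. 0 \<le> \<sigma> \<omega>" "\<And>\<omega>. \<sigma> \<omega> \<le> T"
  shows "\<sigma> \<in> bounded_times"
  using assms by (auto simp: bounded_times_def)

lemma bounded_times_const: "c \<in> {0..T} \<Longrightarrow> (\<lambda>_. c) \<in> bounded_times"
  by (auto intro!: bounded_timesI stopping_time_const)

lemma bounded_times_min:
  "\<sigma> \<in> bounded_times \<Longrightarrow> \<tau> \<in> bounded_times \<Longrightarrow> (\<lambda>\<omega>. min (\<sigma> \<omega>) (\<tau> \<omega>)) \<in> bounded_times"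
  by (auto simp: bounded_times_def intro!: stopping_time_min simp: min_le_iff_disj)

lemma bounded_times_stopping_times: "\<sigma> \<in> bounded_times \<Longrightarrow> \<sigma> \<in> stopping_times M F T"
  by (auto simp: bounded_times_def stopping_times_def)

text \<open>Right-continuity of the filtration turns events \<open>\<sigma> < s\<close> into events
  \<open>\<sigma> \<le> s\<close>. The strict form is what hitting times of open sets deliver
  directly.\<close>

lemma bounded_time_of_less:
  assumes range: "\<And>\<omega>. 0 \<le> \<sigma> \<omega>" "\<And>\<omega>. \<sigma> \<omega> \<le> T"
    and less: "\<And>s. 0 < s \<Longrightarrow> s \<le> T \<Longrightarrow> {\<omega> \<in> space M. \<sigma> \<omega> < s} \<in> sets (F s)"
  shows "\<sigma> \<in> bounded_times"
proof (rule bounded_timesI[OF _ range])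
  show "stopping_time F \<sigma>"
    unfolding stopping_time_iff
  proof
    fix s
    consider "s < 0" | "0 \<le> s" "s < T" | "T \<le> s" by linarith
    then show "{\<omega> \<in> space M. \<sigma> \<omega> \<le> s} \<in> sets (F s)"
    proof cases
      case 1
      then have "{\<omega> \<in> space M. \<sigma> \<omega> \<le> s} = {}" using range(1) by (auto simp: not_le intro: less_le_trans)
      then show ?thesis by (rule ssubst) (rule sets.empty_sets)
    next
      case 3
      then have "{\<omega> \<in> space M. \<sigma> \<omega> \<le> s} = space (F s)"
        using range(2) by (auto simp: space_F intro: order_trans)
      then show ?thesis by (simp del: Collect_mem_eq)
    next
      case 2
      have "{\<omega> \<in> space M. \<sigma> \<omega> \<le> s} \<in> sets (F u)" if u: "u \<in> {s<..T}" for u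
      proof -
        \<comment> \<open>The increments are scaled by \<open>u - s\<close>, so that all times
          occurring here, including the one for \<open>n = 0\<close>, are at most \<open>u\<close>
          and all the events belong to \<open>F u\<close>.\<close>
        have "{\<omega> \<in> space M. \<sigma> \<omega> \<le> s} = (\<Inter>n. {\<omega> \<in> space M. \<sigma> \<omega> < s + (u - s) / Suc n})"
        proof (intro equalityI subsetI INT_I; clarsimp)
          show "\<sigma> \<omega> < s + (u - s) / (1 + real n)" if "\<sigma> \<omega> \<le> s" for \<omega> n
          proof -
            have "0 < (u - s) / (1 + real n)" using u by simp
            with that show ?thesis by linarith
          qed
          show "\<sigma> \<omega> \<le> s" if *: "\<forall>n. \<sigma> \<omega> < s + (u - s) / (1 + real n)" for \<omega>
          proof (rule LIMSEQ_le_const)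
            have "(\<lambda>n. (u - s) * (1 / real (Suc n))) \<longlonglongrightarrow> (u - s) * 0"
              by (intro tendsto_intros LIMSEQ_Suc[OF lim_1_over_n])
            from tendsto_add[OF tendsto_const[of s] this] show "(\<lambda>n. s + (u - s) / (1 + real n)) \<longlonglongrightarrow> s" by simp
            show "\<exists>N. \<forall>n\<ge>N. \<sigma> \<omega> \<le> s + (u - s) / (1 + real n)" using * less_imp_le by blast
          qed
        qed
        also have "\<dots> \<in> sets (F u)"
        proof (intro sets.countable_INT' image_subsetI UNIV_not_empty countableI_type)
          fix n
          have "(u - s) / Suc n \<le> (u - s) / 1" using u by (intro divide_left_mono) auto
          then have *: "s + (u - s) / Suc n \<le> u" unfolding div_by_1 by argo
          have "0 < (u - s) / Suc n" using u by simp
          then have **: "0 < s + (u - s) / Suc n" using 2 by argo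
          have "{\<omega> \<in> space M. \<sigma> \<omega> < s + (u - s) / Suc n} \<in> sets (F (s + (u - s) / Suc n))"
            using * ** u by (intro less) auto
          then show "{\<omega> \<in> space M. \<sigma> \<omega> < s + (u - s) / Suc n} \<in> sets (F u)"
            using sets_F_mono[OF *] by blast
        qed
        finally show ?thesis .
      qed
      then show ?thesis using F_right_cont[OF 2] by blast
    qed
  qed
qed

lemma sets_pre_sigma_le_F: "\<sigma> \<in> bounded_times \<Longrightarrow> A \<in> sets (pre_sigma \<sigma>) \<Longrightarrow> A \<in> sets (F T)"
  using sets_pre_sigmaD[of \<sigma> A T] by (auto simp: bounded_times_def)

lemma subalgebra_pre_sigma: "\<sigma> \<in> bounded_times \<Longrightarrow> subalgebra M (pre_sigma \<sigma>)"
  using sets_pre_sigma_le_F F_subset by (fastforce simp: subalgebra_def space_pre_sigma)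

lemma sets_F_pre_sigma:
  assumes "stopping_time F \<sigma>" "\<And>\<omega>. \<omega> \<in> space M \<Longrightarrow> s \<le> \<sigma> \<omega>" "A \<in> sets (F s)"
  shows "A \<in> sets (pre_sigma \<sigma>)"
proof (rule sets_pre_sigmaI[OF assms(1)])
  fix u
  have A: "A \<subseteq> space M" using sets.sets_into_space[OF assms(3)] by (simp add: space_F)
  show "{\<omega> \<in> A. \<sigma> \<omega> \<le> u} \<in> sets (F u)"
  proof (cases "s \<le> u")
    case True
    have "{\<omega> \<in> space M. \<sigma> \<omega> \<le> u} \<in> sets (F u)" using assms by (simp add: stopping_time_iff)
    then have "A \<inter> {\<omega> \<in> space M. \<sigma> \<omega> \<le> u} \<in> sets (F u)"
      using sets_F_mono[OF True] assms(3) by blast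
    also have "A \<inter> {\<omega> \<in> space M. \<sigma> \<omega> \<le> u} = {\<omega> \<in> A. \<sigma> \<omega> \<le> u}" using A by auto
    finally show ?thesis .
  next
    case False
    then have "{\<omega> \<in> A. \<sigma> \<omega> \<le> u} = {}" using assms(2) A by force
    then show ?thesis by (rule ssubst) (rule sets.empty_sets)
  qed
qed

text \<open>The classical restriction of a stopping time to an event of its past, with
  \<open>T\<close> in the role of infinity. Before \<open>T\<close> only the part on
  \<open>B\<close> can have occurred, and at \<open>T\<close> everything has.\<close>

lemma bounded_time_restrict:
  assumes \<sigma>: "\<sigma> \<in> bounded_times" and B: "B \<in> sets (pre_sigma \<sigma>)"
  shows "(\<lambda>\<omega>. if \<omega> \<in> B then \<sigma> \<omega> else T) \<in> bounded_times"
proof (rule bounded_timesI)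
  show "stopping_time F (\<lambda>\<omega>. if \<omega> \<in> B then \<sigma> \<omega> else T)"
    unfolding stopping_time_iff
  proof
    fix s
    show "{\<omega> \<in> space M. (if \<omega> \<in> B then \<sigma> \<omega> else T) \<le> s} \<in> sets (F s)"
    proof (cases "T \<le> s")
      case True
      then have "{\<omega> \<in> space M. (if \<omega> \<in> B then \<sigma> \<omega> else T) \<le> s} = space (F s)"
        using bounded_timesD(3)[OF \<sigma>] by (auto simp: space_F intro: order_trans)
      then show ?thesis by (simp del: Collect_mem_eq)
    next
      case False
      have "B \<subseteq> space M" using sets.sets_into_space[OF B] by (simp add: space_pre_sigma)
      then have "{\<omega> \<in> space M. (if \<omega> \<in> B then \<sigma> \<omega> else T) \<le> s} = {\<omega> \<in> B. \<sigma> \<omega> \<le> s}"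
        using False by auto
      then show ?thesis using sets_pre_sigmaD[OF bounded_timesD(1)[OF \<sigma>] B] by simp
    qed
  qed
qed (use bounded_timesD[OF \<sigma>] T_pos in auto)

text \<open>Rounding up to the next multiple of \<open>T / Suc n\<close>. The mesh divides
  \<open>T\<close> exactly, so rounding does not leave \<open>[0,T]\<close>, and grid points are
  fixed. The values are not monotone in \<open>n\<close>; only their convergence from the right is
  used.\<close>

definition grid_time :: "nat \<Rightarrow> real \<Rightarrow> real" where
  "grid_time n s = T / Suc n * \<lceil>s / (T / Suc n)\<rceil>"

lemma grid_time_bounds:
  shows "s \<le> grid_time n s" "grid_time n s \<le> s + T / Suc n"
    "s \<le> T \<Longrightarrow> grid_time n s \<le> T" "0 \<le> s \<Longrightarrow> 0 \<le> grid_time n s"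
    "s \<le> u \<Longrightarrow> grid_time n s \<le> grid_time n u"
proof -
  define h where "h = T / Suc n"
  have h: "0 < h" using T_pos by (simp add: h_def)
  have eq: "grid_time n s = h * \<lceil>s / h\<rceil>" for s by (simp add: grid_time_def h_def)
  have "s = h * (s / h)" using h by simp
  also have "\<dots> \<le> h * \<lceil>s / h\<rceil>" using h by (intro mult_left_mono) auto
  finally show "s \<le> grid_time n s" by (simp add: eq)
  have "h * \<lceil>s / h\<rceil> \<le> h * (s / h + 1)" using h by (intro mult_left_mono) linarith+
  also have "\<dots> = s + h" using h by (simp add: field_simps)
  finally show "grid_time n s \<le> s + T / Suc n" by (simp add: eq h_def)
  show "grid_time n s \<le> T" if "s \<le> T"
  proof -
    have "s / h \<le> T / h" using that h by (intro divide_right_mono) auto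
    also have "\<dots> = real (Suc n)" using T_pos by (simp add: h_def)
    finally have "\<lceil>s / h\<rceil> \<le> int (Suc n)" by (simp add: ceiling_le_iff)
    then have "h * \<lceil>s / h\<rceil> \<le> h * real (Suc n)" using h
      by (intro mult_left_mono) linarith+
    then show ?thesis by (simp add: eq h_def del: of_nat_Suc)
  qed
  show "0 \<le> grid_time n s" if "0 \<le> s"
  proof -
    have "0 \<le> s / h" using that h by simp
    then have "0 \<le> \<lceil>s / h\<rceil>" by linarith
    then show ?thesis using h by (simp add: eq)
  qed
  show "grid_time n s \<le> grid_time n u" if "s \<le> u"
    using that h by (auto simp: eq intro!: mult_left_mono ceiling_mono divide_right_mono)
qed

lemma grid_time_tendsto: "(\<lambda>n. grid_time n s) \<longlonglongrightarrow> s"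
proof (rule tendsto_sandwich)
  show "\<forall>\<^sub>F n in sequentially. s \<le> grid_time n s" "\<forall>\<^sub>F n in sequentially. grid_time n s \<le> s + T * (1 / Suc n)"
    using grid_time_bounds(1,2) by auto
  have "(\<lambda>n. s + T * (1 / real (Suc n))) \<longlonglongrightarrow> s + T * 0"
    by (intro tendsto_intros LIMSEQ_Suc[OF lim_1_over_n])
  then show "(\<lambda>n. s + T * (1 / real (Suc n))) \<longlonglongrightarrow> s" by simp
qed simp

text \<open>At a grid point the rounded time and the original one define the same event. This is
  what identifies the pieces of a sum over the grid with events of the filtration at the grid
  points.\<close>

lemma grid_time_le_iff: "grid_time n s \<le> T / Suc n * real k \<longleftrightarrow> s \<le> T / Suc n * real k"
proof -
  define h where "h = T / Suc n"
  have h: "0 < h" using T_pos by (simp add: h_def)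
  have "h * \<lceil>s / h\<rceil> \<le> h * real k \<longleftrightarrow> real_of_int \<lceil>s / h\<rceil> \<le> real k" using h by simp
  also have "\<dots> \<longleftrightarrow> \<lceil>s / h\<rceil> \<le> int k" by linarith
  also have "\<dots> \<longleftrightarrow> s \<le> h * real k" using h by (simp add: ceiling_le_iff field_simps)
  finally show ?thesis by (simp add: grid_time_def h_def)
qed

lemma grid_time_bounded_times:
  assumes \<sigma>: "\<sigma> \<in> bounded_times"
  shows "(\<lambda>\<omega>. grid_time n (\<sigma> \<omega>)) \<in> bounded_times"
proof (rule bounded_timesI)
  define h where "h = T / Suc n"
  have h: "0 < h" using T_pos by (simp add: h_def)
  show "stopping_time F (\<lambda>\<omega>. grid_time n (\<sigma> \<omega>))"
    unfolding stopping_time_iff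
  proof
    fix s
    \<comment> \<open>The rounded time is at most \<open>s\<close> exactly if the original time is
      at most the last grid point not after \<open>s\<close>, so the event is decided by
      then.\<close>
    have *: "grid_time n x \<le> s \<longleftrightarrow> x \<le> h * \<lfloor>s / h\<rfloor>" for x
    proof -
      have "h * \<lceil>x / h\<rceil> \<le> s \<longleftrightarrow> \<lceil>x / h\<rceil> \<le> \<lfloor>s / h\<rfloor>"
        using h by (simp add: le_floor_iff field_simps)
      also have "\<dots> \<longleftrightarrow> x \<le> h * \<lfloor>s / h\<rfloor>" using h by (simp add: ceiling_le_iff field_simps)
      finally show ?thesis by (simp add: grid_time_def h_def)
    qed
    have le: "h * \<lfloor>s / h\<rfloor> \<le> s"
    proof -
      have "h * \<lfloor>s / h\<rfloor> \<le> h * (s / h)" using h by (intro mult_left_mono) auto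
      then show ?thesis using h by simp
    qed
    have "{\<omega> \<in> space M. \<sigma> \<omega> \<le> h * \<lfloor>s / h\<rfloor>} \<in> sets (F (h * \<lfloor>s / h\<rfloor>))"
      using bounded_timesD(1)[OF \<sigma>] by (simp add: stopping_time_iff)
    then show "{\<omega> \<in> space M. grid_time n (\<sigma> \<omega>) \<le> s} \<in> sets (F s)"
      unfolding * using sets_F_mono[OF le] by blast
  qed
qed (use bounded_timesD[OF \<sigma>] grid_time_bounds in auto)

section \<open>Right-continuous processes sampled at stopping times\<close>

lemma adapted_cadlagD:
  assumes "X \<in> adapted_cadlag M F T"
  shows "s \<in> {0..T} \<Longrightarrow> X s \<in> borel_measurable (F s)" "AE \<omega> in M. cadlag_on T (\<lambda>s. X s \<omega>)"
    "0 \<le> s \<Longrightarrow> s \<le> u \<Longrightarrow> u \<le> T \<Longrightarrow> X s \<in> borel_measurable (F u)"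
proof -
  show 1: "s \<in> {0..T} \<Longrightarrow> X s \<in> borel_measurable (F s)" for s
    using assms by (auto simp: adapted_cadlag_def)
  show "AE \<omega> in M. cadlag_on T (\<lambda>s. X s \<omega>)" using assms by (auto simp: adapted_cadlag_def)
  show "X s \<in> borel_measurable (F u)" if "0 \<le> s" "s \<le> u" "u \<le> T"
  proof (rule measurable_from_subalg[OF _ 1])
    show "subalgebra (F u) (F s)" using that sets_F_mono by (auto simp: subalgebra_def space_F)
  qed (use that in auto)
qed

lemma borel_measurable_pre_sigmaI:
  fixes f :: "'a \<Rightarrow> real"
  assumes "stopping_time F \<sigma>" "\<And>s. (\<lambda>\<omega>. f \<omega> * of_bool (\<sigma> \<omega> \<le> s)) \<in> borel_measurable (F s)"
  shows "f \<in> borel_measurable (pre_sigma \<sigma>)"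
proof (rule measurableI)
  fix A :: "real set" assume A: "A \<in> sets borel"
  show "f -` A \<inter> space (pre_sigma \<sigma>) \<in> sets (pre_sigma \<sigma>)"
  proof (rule sets_pre_sigmaI[OF assms(1)])
    fix s
    have "(\<lambda>\<omega>. f \<omega> * of_bool (\<sigma> \<omega> \<le> s)) -` A \<inter> space (F s) \<in> sets (F s)"
      using assms(2) A by (rule measurable_sets)
    moreover have "{\<omega> \<in> space M. \<sigma> \<omega> \<le> s} \<in> sets (F s)" using assms(1) by (simp add: stopping_time_iff)
    ultimately have "((\<lambda>\<omega>. f \<omega> * of_bool (\<sigma> \<omega> \<le> s)) -` A \<inter> space (F s)) \<inter> {\<omega> \<in> space M. \<sigma> \<omega> \<le> s} \<in> sets (F s)"
      by blast
    also have "((\<lambda>\<omega>. f \<omega> * of_bool (\<sigma> \<omega> \<le> s)) -` A \<inter> space (F s)) \<inter> {\<omega> \<in> space M. \<sigma> \<omega> \<le> s}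
       = {\<omega> \<in> f -` A \<inter> space (pre_sigma \<sigma>). \<sigma> \<omega> \<le> s}"
      by (auto simp: space_F space_pre_sigma)
    finally show "{\<omega> \<in> f -` A \<inter> space (pre_sigma \<sigma>). \<sigma> \<omega> \<le> s} \<in> sets (F s)" .
  qed
qed auto

lemma sets_F_of_stopping_time:
  assumes "stopping_time F \<sigma>" "u \<le> s"
  shows "{\<omega> \<in> space M. \<sigma> \<omega> \<le> u} \<in> sets (F s)"
  using assms sets_F_mono by (auto simp: stopping_time_iff)

text \<open>On \<open>\<sigma> \<le> s\<close> the process is sampled at the grid time capped at
  \<open>s\<close>. The cap keeps the approximation adapted to \<open>F s\<close>, and it still
  tends to \<open>\<sigma>\<close> from the right; each approximation involves finitely many fixed
  sampling times only.\<close>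

lemma borel_measurable_stopped:
  assumes X: "X \<in> adapted_cadlag M F T" and \<sigma>: "\<sigma> \<in> bounded_times"
  shows "(\<lambda>\<omega>. X (\<sigma> \<omega>) \<omega>) \<in> borel_measurable (pre_sigma \<sigma>)"
proof (rule borel_measurable_pre_sigmaI[OF bounded_timesD(1)[OF \<sigma>]])
  fix s
  have main: "(\<lambda>\<omega>. X (\<sigma> \<omega>) \<omega> * of_bool (\<sigma> \<omega> \<le> s)) \<in> borel_measurable (F s)" if s: "s \<in> {0..T}" for s
  proof (rule borel_measurable_AE_LIMSEQ[OF _ null_sets_F])
    fix n
    define h where "h = T / Suc n"
    have h: "0 < h" using T_pos by (simp add: h_def)
    \<comment> \<open>The event says that the rounded time is \<open>h * real k\<close>. For
      \<open>k = 0\<close> its lower condition compares \<open>\<sigma> \<omega>\<close> with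
      \<open>- h\<close> and holds because \<open>\<sigma>\<close> is nonnegative.\<close>
    define f where "f k \<omega> = X (min s (h * real k)) \<omega> * of_bool (\<sigma> \<omega> \<le> h * real k \<and> \<not> \<sigma> \<omega> \<le> h * (real k - 1) \<and> \<sigma> \<omega> \<le> s)" for k \<omega>
    have "X (min s (grid_time n (\<sigma> \<omega>))) \<omega> * of_bool (\<sigma> \<omega> \<le> s) = (\<Sum>k\<le>Suc n. f k \<omega>)" for \<omega>
    proof -
      define k where "k = nat \<lceil>\<sigma> \<omega> / h\<rceil>"
      have \<sigma>0: "0 \<le> \<sigma> \<omega>" "\<sigma> \<omega> \<le> T" using bounded_timesD[OF \<sigma>] by auto
      then have g: "grid_time n (\<sigma> \<omega>) = h * real k"
        using h by (simp add: grid_time_def h_def k_def)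
      have "h * real k \<le> T" using grid_time_bounds(3)[OF \<sigma>0(2), of n] g by simp
      also have "T = h * real (Suc n)" by (simp add: h_def)
      finally have k: "k \<le> Suc n" using h by (simp del: of_nat_Suc)
      have iff: "(\<sigma> \<omega> \<le> h * real j \<and> \<not> \<sigma> \<omega> \<le> h * (real j - 1)) \<longleftrightarrow> j = k" for j
      proof -
        have "\<sigma> \<omega> \<le> h * real j \<longleftrightarrow> k \<le> j"
          using grid_time_le_iff[of n "\<sigma> \<omega>" j] g h unfolding h_def[symmetric] by simp
        moreover have "\<sigma> \<omega> \<le> h * (real j - 1) \<longleftrightarrow> k < j \<or> (\<sigma> \<omega> \<le> - h \<and> j = 0)"
        proof (cases j)
          case 0
          then show ?thesis using h \<sigma>0 by auto
        next
          case (Suc l)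
          then show ?thesis using grid_time_le_iff[of n "\<sigma> \<omega>" l] g h unfolding h_def[symmetric] by auto
        qed
        ultimately show ?thesis using h \<sigma>0 by auto
      qed
      have "(\<Sum>j\<le>Suc n. f j \<omega>) = (\<Sum>j\<le>Suc n. if j = k then X (min s (h * real j)) \<omega> * of_bool (\<sigma> \<omega> \<le> s) else 0)"
        by (intro sum.cong refl) (use iff in \<open>auto simp: f_def\<close>)
      also have "\<dots> = X (min s (h * real k)) \<omega> * of_bool (\<sigma> \<omega> \<le> s)"
        using k by (subst sum.delta) auto
      finally show ?thesis using g by simp
    qed
    moreover have "f k \<in> borel_measurable (F s)" for k
    proof -
      have "X (min s (h * real k)) \<in> borel_measurable (F s)"
        using s h by (intro adapted_cadlagD(3)[OF X]) auto
      moreover have "Measurable.pred (F s) (\<lambda>\<omega>. \<sigma> \<omega> \<le> h * real k \<and> \<not> \<sigma> \<omega> \<le> h * (real k - 1) \<and> \<sigma> \<omega> \<le> s)"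
      proof -
        let ?A = "\<lambda>u. {\<omega> \<in> space M. \<sigma> \<omega> \<le> min u s}"
        have "?A u \<in> sets (F s)" for u
          by (intro sets_F_of_stopping_time[OF bounded_timesD(1)[OF \<sigma>]]) simp
        then have "?A (h * real k) - ?A (h * (real k - 1)) \<in> sets (F s)" by blast
        also have "?A (h * real k) - ?A (h * (real k - 1))
            = {\<omega> \<in> space M. \<sigma> \<omega> \<le> h * real k \<and> \<not> \<sigma> \<omega> \<le> h * (real k - 1) \<and> \<sigma> \<omega> \<le> s}"
          by auto
        finally show ?thesis by (simp add: pred_def space_F)
      qed
      ultimately show ?thesis unfolding f_def by measurable
    qed
    ultimately show "(\<lambda>\<omega>. X (min s (grid_time n (\<sigma> \<omega>))) \<omega> * of_bool (\<sigma> \<omega> \<le> s)) \<in> borel_measurable (F s)"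
      by (simp del: sum.atMost_Suc)
  next
    show "AE \<omega> in M. (\<lambda>n. X (min s (grid_time n (\<sigma> \<omega>))) \<omega> * of_bool (\<sigma> \<omega> \<le> s)) \<longlonglongrightarrow> X (\<sigma> \<omega>) \<omega> * of_bool (\<sigma> \<omega> \<le> s)"
      using adapted_cadlagD(2)[OF X]
    proof eventually_elim
      case (elim \<omega>)
      show ?case
      proof (cases "\<sigma> \<omega> \<le> s")
        case True
        have "(\<lambda>n. min s (grid_time n (\<sigma> \<omega>))) \<longlonglongrightarrow> min s (\<sigma> \<omega>)"
          by (intro tendsto_intros grid_time_tendsto)
        then have "(\<lambda>n. X (min s (grid_time n (\<sigma> \<omega>))) \<omega>) \<longlonglongrightarrow> X (\<sigma> \<omega>) \<omega>"
          using True s bounded_timesD[OF \<sigma>] grid_time_bounds(1)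
          by (intro cadlag_on_tendsto_right[OF elim]) (auto simp: min_absorb2 min.coboundedI1)
        then show ?thesis using True by simp
      qed simp
    qed
  qed (simp add: space_F)
  consider "s < 0" | "s \<in> {0..T}" | "T < s" by fastforce
  then show "(\<lambda>\<omega>. X (\<sigma> \<omega>) \<omega> * of_bool (\<sigma> \<omega> \<le> s)) \<in> borel_measurable (F s)"
  proof cases
    case 1
    then have "\<not> \<sigma> \<omega> \<le> s" for \<omega> using bounded_timesD(2)[OF \<sigma>, of \<omega>] by linarith
    then show ?thesis by simp
  next
    case 3
    then have "\<sigma> \<omega> \<le> s" "\<sigma> \<omega> \<le> T" for \<omega> using bounded_timesD(3)[OF \<sigma>, of \<omega>] by linarith+
    moreover have "sets (F s) = sets (F T)" using F_after[OF 3] .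
    ultimately show ?thesis using main[of T] T_pos measurable_cong_sets[of "F s" "F T" borel borel] by simp
  qed (rule main)
qed

lemma borel_measurable_stopped_M:
  assumes "X \<in> adapted_cadlag M F T" "\<sigma> \<in> bounded_times"
  shows "(\<lambda>\<omega>. X (\<sigma> \<omega>) \<omega>) \<in> borel_measurable M"
  using measurable_from_subalg[OF subalgebra_pre_sigma borel_measurable_stopped] assms by blast

lemma bounded_times_limit:
  assumes \<sigma>: "\<And>n. \<sigma> n \<in> bounded_times" "\<And>n \<omega>. \<sigma> n \<omega> \<le> \<sigma> (Suc n) \<omega>"
    and D: "\<And>\<omega>. (\<lambda>n. \<sigma> n \<omega>) \<longlonglongrightarrow> D \<omega>"
  shows "D \<in> bounded_times" "\<sigma> n \<omega> \<le> D \<omega>"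
proof -
  show le: "\<sigma> n \<omega> \<le> D \<omega>" for n \<omega>
    using incseq_le[OF incseq_SucI D] \<sigma>(2) by auto
  show "D \<in> bounded_times"
  proof (rule bounded_timesI)
    show "0 \<le> D \<omega>" for \<omega> using le[of 0 \<omega>] bounded_timesD(2)[OF \<sigma>(1), of 0 \<omega>] by linarith
    show *: "D \<omega> \<le> T" for \<omega>
      using bounded_timesD(3)[OF \<sigma>(1)] by (intro LIMSEQ_le_const2[OF D]) auto
    show "stopping_time F D"
      unfolding stopping_time_iff
    proof
      fix s
      have "{\<omega> \<in> space M. D \<omega> \<le> s} = (\<Inter>n. {\<omega> \<in> space M. \<sigma> n \<omega> \<le> s})"
        using le by (auto intro: order_trans LIMSEQ_le_const2[OF D])
      also have "\<dots> \<in> sets (F s)"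
        using bounded_timesD(1)[OF \<sigma>(1)] by (intro sets.countable_INT) (auto simp: stopping_time_iff)
      finally show "{\<omega> \<in> space M. D \<omega> \<le> s} \<in> sets (F s)" .
    qed
  qed
qed

text \<open>A limit of stopping times need not be predictable; restricting it to the event that the
  approximation is strict, and replacing it by the terminal time elsewhere, makes it so.\<close>

lemma space_Q_tendsto:
  assumes X: "X \<in> space_Q M F T"
    and \<sigma>: "\<And>n. \<sigma> n \<in> bounded_times" "\<And>n \<omega>. \<sigma> n \<omega> \<le> \<sigma> (Suc n) \<omega>"
    and D: "\<And>\<omega>. (\<lambda>n. \<sigma> n \<omega>) \<longlonglongrightarrow> D \<omega>"
  shows "AE \<omega> in M. (\<lambda>n. X (\<sigma> n \<omega>) \<omega>) \<longlonglongrightarrow> X (D \<omega>) \<omega>"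
proof -
  note D' = bounded_times_limit[of \<sigma>, OF \<sigma> D]
  define B where "B n = {\<omega> \<in> space M. \<sigma> n \<omega> < D \<omega>}" for n
  have mono: "\<sigma> n \<omega> \<le> \<sigma> k \<omega>" if "n \<le> k" for n k \<omega>
    using that \<sigma>(2) by (rule lift_Suc_mono_le[of "\<lambda>n. \<sigma> n \<omega>", rotated])
  have B: "B n \<in> sets (pre_sigma (\<sigma> n))" for n
    using stopping_time_less[OF bounded_timesD(1)[OF \<sigma>(1)] bounded_timesD(1)[OF D'(1)], of n]
    by (simp add: pred_def B_def space_pre_sigma)
  have BD: "B n \<in> sets (pre_sigma D)" for n
    using mono_pre_sigma[OF bounded_timesD(1)[OF \<sigma>(1)] bounded_timesD(1)[OF D'(1)], of n] B[of n] D'(2)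
    by auto
  define S where "S = (\<lambda>\<omega>. if \<omega> \<in> (\<Inter>n. B n) then D \<omega> else T)"
  \<comment> \<open>Candidate for the announcing sequence. The cap stays strictly below
    \<open>T\<close>, which gives strictness where the restricted time has been sent to
    \<open>T\<close>; since the cap tends to \<open>T\<close>, it does not change the limit on the
    good event.\<close>
  define \<rho> where "\<rho> n = (\<lambda>\<omega>. min (if \<omega> \<in> B n then \<sigma> n \<omega> else T) (T - T / (real n + 2)))" for n
  have S: "S \<in> bounded_times"
    unfolding S_def using BD by (intro bounded_time_restrict[OF D'(1)] sets.countable_INT) auto
  have c: "0 \<le> T - T / (real n + 2)" "T - T / (real n + 2) < T" for n
    using T_pos by (simp_all add: field_simps)
  have \<rho>: "\<rho> n \<in> bounded_times" for n
    unfolding \<rho>_def using c[of n]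
    by (intro bounded_times_min bounded_time_restrict \<sigma> B bounded_times_const) auto
  have clim: "(\<lambda>n. T - T / (real n + 2)) \<longlonglongrightarrow> T"
  proof -
    have "(\<lambda>n. T - T * (1 / real (n + 2))) \<longlonglongrightarrow> T - T * 0"
      by (intro tendsto_intros LIMSEQ_ignore_initial_segment[OF lim_1_over_n])
    then show ?thesis by (simp add: add.commute)
  qed
  have "predictable_time M F T S"
    unfolding predictable_time_def
  proof (intro conjI exI[of _ \<rho>] allI)
    show "AE \<omega> in M. incseq (\<lambda>n. \<rho> n \<omega>) \<and> (\<lambda>n. \<rho> n \<omega>) \<longlonglongrightarrow> S \<omega> \<and> (0 < S \<omega> \<longrightarrow> (\<forall>n. \<rho> n \<omega> < S \<omega>))"
    proof (rule AE_I2, intro conjI impI allI)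
      fix \<omega> assume \<omega>: "\<omega> \<in> space M"
      have Bdec: "\<omega> \<in> B n" if "\<omega> \<in> B (Suc n)" for n
        using that \<sigma>(2)[of n \<omega>] by (auto simp: B_def)
      show "incseq (\<lambda>n. \<rho> n \<omega>)"
      proof (rule incseq_SucI)
        fix n
        have "T - T / (real n + 2) \<le> T - T / (real (Suc n) + 2)"
          using T_pos by (auto intro!: divide_left_mono)
        moreover have "(if \<omega> \<in> B n then \<sigma> n \<omega> else T) \<le> (if \<omega> \<in> B (Suc n) then \<sigma> (Suc n) \<omega> else T)"
          using \<sigma>(2)[of n \<omega>] Bdec[of n] bounded_timesD(3)[OF \<sigma>(1), of n \<omega>] by auto
        ultimately show "\<rho> n \<omega> \<le> \<rho> (Suc n) \<omega>" unfolding \<rho>_def by (rule min.mono[rotated])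
      qed
      show "(\<lambda>n. \<rho> n \<omega>) \<longlonglongrightarrow> S \<omega>"
      proof (cases "\<omega> \<in> (\<Inter>n. B n)")
        case True
        have "(\<lambda>n. min (\<sigma> n \<omega>) (T - T / (real n + 2))) \<longlonglongrightarrow> min (D \<omega>) T"
          by (intro tendsto_intros D clim)
        then show ?thesis using True bounded_timesD(3)[OF D'(1), of \<omega>] by (simp add: \<rho>_def S_def)
      next
        case False
        then obtain N where N: "\<omega> \<notin> B N" by auto
        have notB: "\<omega> \<notin> B n" if "N \<le> n" for n
          using N mono[OF that, of \<omega>] \<omega> by (auto simp: B_def)
        have "\<rho> n \<omega> = T - T / (real n + 2)" if "N \<le> n" for n
          using notB[OF that] c[of n] by (auto simp: \<rho>_def)
        then have "\<forall>\<^sub>F n in sequentially. T - T / (real n + 2) = \<rho> n \<omega>"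
          by (intro eventually_sequentiallyI[of N]) simp
        moreover have "S \<omega> = T" using False by (auto simp: S_def)
        ultimately show ?thesis using Lim_transform_eventually[OF clim] by simp
      qed
      show "\<rho> n \<omega> < S \<omega>" for n
        using c[of n] by (auto simp: \<rho>_def S_def B_def min_less_iff_disj)
    qed
  qed (use S \<rho> bounded_times_stopping_times in auto)
  then have "AE \<omega> in M. X (S \<omega>) \<omega> = left_limit (\<lambda>t. X t \<omega>) (S \<omega>)"
    using X by (auto simp: space_Q_def)
  moreover have "AE \<omega> in M. cadlag_on T (\<lambda>t. X t \<omega>)"
    using X by (auto simp: space_Q_def adapted_cadlag_def)
  ultimately show ?thesis
    using AE_space
  proof eventually_elim
    case (elim \<omega>)
    show ?case
    proof (cases "\<omega> \<in> (\<Inter>n. B n)")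
      case True
      then have S: "S \<omega> = D \<omega>" and less: "\<sigma> n \<omega> < D \<omega>" for n by (auto simp: S_def B_def)
      have pos: "0 < D \<omega>" "D \<omega> \<le> T"
        using less[of 0] bounded_timesD(2)[OF \<sigma>(1), of 0 \<omega>] bounded_timesD(3)[OF D'(1), of \<omega>] by linarith+
      then obtain l where l: "((\<lambda>t. X t \<omega>) \<longlongrightarrow> l) (at_left (D \<omega>))"
        using elim(2) by (auto simp: cadlag_on_def)
      then have "left_limit (\<lambda>t. X t \<omega>) (D \<omega>) = l"
        using pos by (simp add: left_limit_def tendsto_Lim[OF trivial_limit_at_left_real])
      then have "X (D \<omega>) \<omega> = l" using elim(1) S by simp
      moreover have "filterlim (\<lambda>n. \<sigma> n \<omega>) (at_left (D \<omega>)) sequentially"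
        using D[of \<omega>] less less_imp_neq[OF less] by (auto simp: filterlim_at intro!: always_eventually)
      then have "(\<lambda>n. X (\<sigma> n \<omega>) \<omega>) \<longlonglongrightarrow> l"
        using l filterlim_compose by blast
      ultimately show ?thesis by simp
    next
      case False
      \<comment> \<open>Off the good event the sequence reaches its limit after finitely many steps,
        and the sampled values become constant.\<close>
      then obtain N where N: "D \<omega> \<le> \<sigma> N \<omega>" using elim(3) by (auto simp: B_def not_less)
      have "\<sigma> n \<omega> = D \<omega>" if "N \<le> n" for n
        using mono[OF that, of \<omega>] N D'(2)[of n \<omega>] by linarith
      then have "\<forall>\<^sub>F n in sequentially. X (D \<omega>) \<omega> = X (\<sigma> n \<omega>) \<omega>"
        by (intro eventually_sequentiallyI[of N]) simp
      then show ?thesis by (rule Lim_transform_eventually[OF tendsto_const])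
    qed
  qed
qed

end

section \<open>Optional sampling and dominated processes\<close>

lemma integrable_indicator_times:
  fixes f :: "'a \<Rightarrow> real"
  shows "A \<in> sets M \<Longrightarrow> integrable M f \<Longrightarrow> integrable M (\<lambda>x. indicator A x * f x)"
  using integrable_mult_indicator[of A M f] by simp

lemma rational_approx_right:
  fixes s T :: real
  assumes "s < T"
  obtains u where "\<And>n. u n \<in> \<rat>" "\<And>n. s < u n" "\<And>n. u n \<le> T" "u \<longlonglongrightarrow> s"
proof -
  have "\<exists>u. u \<in> \<rat> \<and> s < u \<and> u < s + (T - s) / real (Suc n)" for n
    using Rats_dense_in_real[of s "s + (T - s) / real (Suc n)"] assms by auto
  then obtain u where u: "\<And>n. u n \<in> \<rat>" "\<And>n. s < u n" "\<And>n. u n < s + (T - s) / real (Suc n)"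
    by metis
  show thesis
  proof
    show "u n \<in> \<rat>" "s < u n" for n using u by auto
    show "u n \<le> T" for n
    proof -
      have "(T - s) / real (Suc n) \<le> (T - s) / 1" using assms by (intro divide_left_mono) auto
      then show ?thesis using u(3)[of n] unfolding div_by_1 by argo
    qed
    show "u \<longlonglongrightarrow> s"
    proof (rule tendsto_sandwich[of "\<lambda>_. s" u _ "\<lambda>n. s + (T - s) / real (Suc n)"])
      have "(\<lambda>n. s + (T - s) * (1 / real (Suc n))) \<longlonglongrightarrow> s + (T - s) * 0"
        by (intro tendsto_intros LIMSEQ_Suc[OF lim_1_over_n])
      then show "(\<lambda>n. s + (T - s) / real (Suc n)) \<longlonglongrightarrow> s" by simp
    qed (use u(2,3) in \<open>auto intro!: always_eventually less_imp_le\<close>)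
  qed
qed

text \<open>Rewards are defined by integrals over closed intervals, while additivity over
  consecutive switching intervals wants half-open ones.\<close>

lemma set_integral_Icc_Ioc:
  fixes f :: "real \<Rightarrow> real"
  assumes "a \<le> b" "set_integrable lborel {a<..b} f"
  shows "set_integrable lborel {a..b} f" "(LINT u:{a..b}|lborel. f u) = (LINT u:{a<..b}|lborel. f u)"
proof -
  have single: "set_integrable lborel {a} f" "(LINT u:{a}|lborel. f u) = 0"
  proof -
    have ae: "AE u in lborel. indicator {a} u *\<^sub>R f u = 0"
      using AE_lborel_singleton[of a] by eventually_elim auto
    \<comment> \<open>Measurability of \<open>f\<close> is not known at \<open>a\<close>; on the
      singleton \<open>f\<close> may be replaced by the constant \<open>f a\<close>.\<close>
    have "(\<lambda>u. indicator {a} u *\<^sub>R f u) = (\<lambda>u. indicator {a} u *\<^sub>R f a)" by (auto simp: indicator_def)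
    then show "set_integrable lborel {a} f" by (simp add: set_integrable_def)
    show "(LINT u:{a}|lborel. f u) = 0"
      using integral_eq_zero_AE[OF ae] by (simp add: set_lebesgue_integral_def)
  qed
  have eq: "{a..b} = {a} \<union> {a<..b}" using assms(1) by auto
  show "set_integrable lborel {a..b} f"
    unfolding eq by (rule set_integrable_Un[OF single(1) assms(2)]) auto
  have "(LINT u:{a} \<union> {a<..b}|lborel. f u) = (LINT u:{a}|lborel. f u) + (LINT u:{a<..b}|lborel. f u)"
    by (rule set_integral_Un) (use single assms in auto)
  then show "(LINT u:{a..b}|lborel. f u) = (LINT u:{a<..b}|lborel. f u)" unfolding eq single(2) by simp
qed

text \<open>A discrete stochastic integral whose integrand is the indicator of
  \<open>a \<le> k < b\<close>. It is written with \<open>a \<le> k\<close> and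
  \<open>\<not> b \<le> k\<close> because these become the events that the earlier and the later
  stopping time have occurred by grid point \<open>k\<close>.\<close>

lemma telescope_of_bool:
  fixes f :: "nat \<Rightarrow> real"
  assumes "a \<le> b" "b \<le> N"
  shows "f b - f a = (\<Sum>k<N. of_bool (a \<le> k \<and> \<not> b \<le> k) * (f (Suc k) - f k))"
proof -
  have "f b - f a = (\<Sum>k = a..<b. f (Suc k) - f k)" using assms(1) by (simp add: sum_Suc_diff')
  also have "\<dots> = (\<Sum>k<N. of_bool (a \<le> k \<and> \<not> b \<le> k) * (f (Suc k) - f k))"
    using assms(2) by (intro sum.mono_neutral_cong_left) auto
  finally show ?thesis .
qed

lemma cadlag_on_compose:
  fixes f :: "real \<Rightarrow> real \<Rightarrow> real"
  assumes x: "cadlag_on T x" and y: "cadlag_on T y" and f: "continuous_on UNIV (\<lambda>p. f (fst p) (snd p))"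
  shows "cadlag_on T (\<lambda>s. f (x s) (y s))"
    and "s \<le> T \<Longrightarrow> left_limit (\<lambda>s. f (x s) (y s)) s = f (left_limit x s) (left_limit y s)"
proof -
  have tend: "((\<lambda>s. f (x s) (y s)) \<longlongrightarrow> f a b) G" if "(x \<longlongrightarrow> a) G" "(y \<longlongrightarrow> b) G" for a b G
    using continuous_on_tendsto_compose[OF f tendsto_Pair[OF that]] by simp
  show "cadlag_on T (\<lambda>s. f (x s) (y s))"
    unfolding cadlag_on_def
  proof (intro conjI allI impI)
    fix s assume "0 \<le> s \<and> s < T"
    then show "((\<lambda>s. f (x s) (y s)) \<longlongrightarrow> f (x s) (y s)) (at_right s)"
      using x y by (intro tend) (auto simp: cadlag_on_def)
  next
    fix s assume "0 < s \<and> s \<le> T"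
    then have "\<exists>a. (x \<longlongrightarrow> a) (at_left s)" "\<exists>b. (y \<longlongrightarrow> b) (at_left s)"
      using x y by (simp_all add: cadlag_on_def)
    then show "\<exists>l. ((\<lambda>s. f (x s) (y s)) \<longlongrightarrow> l) (at_left s)" using tend by blast
  qed
  assume "s \<le> T"
  show "left_limit (\<lambda>s. f (x s) (y s)) s = f (left_limit x s) (left_limit y s)"
  proof (cases "s \<le> 0")
    case False
    then have "\<exists>a. (x \<longlongrightarrow> a) (at_left s)" "\<exists>b. (y \<longlongrightarrow> b) (at_left s)"
      using x y \<open>s \<le> T\<close> by (simp_all add: cadlag_on_def)
    then obtain a b where ab: "(x \<longlongrightarrow> a) (at_left s)" "(y \<longlongrightarrow> b) (at_left s)" by blast
    then show ?thesis
      using False tend[OF ab] by (simp add: left_limit_def tendsto_Lim[OF trivial_limit_at_left_real])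
  qed (simp add: left_limit_def)
qed

context filtered_prob_space
begin

text \<open>One null set serves all times, so the bound remains valid at random times.\<close>

definition dominated :: "(real \<Rightarrow> 'a \<Rightarrow> real) \<Rightarrow> ('a \<Rightarrow> real) \<Rightarrow> bool" where
  "dominated X \<xi> \<longleftrightarrow> (AE \<omega> in M. \<forall>s\<in>{0..T}. \<bar>X s \<omega>\<bar> \<le> \<xi> \<omega>)"

lemma dominated_stopped: "dominated X \<xi> \<Longrightarrow> \<sigma> \<in> bounded_times \<Longrightarrow> AE \<omega> in M. \<bar>X (\<sigma> \<omega>) \<omega>\<bar> \<le> \<xi> \<omega>"
  unfolding dominated_def by (erule eventually_mono) (simp add: bounded_timesD)

lemma integrable_stopped:
  assumes X: "X \<in> adapted_cadlag M F T" and \<sigma>: "\<sigma> \<in> bounded_times"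
    and dom: "dominated X \<xi>" "integrable M \<xi>"
  shows "integrable M (\<lambda>\<omega>. X (\<sigma> \<omega>) \<omega>)"
proof (rule Bochner_Integration.integrable_bound[OF dom(2) borel_measurable_stopped_M[OF X \<sigma>]])
  show "AE \<omega> in M. norm (X (\<sigma> \<omega>) \<omega>) \<le> norm (\<xi> \<omega>)"
    using dominated_stopped[OF dom(1) \<sigma>] by eventually_elim auto
qed

lemma grid_time_stopped_tendsto:
  assumes X: "X \<in> adapted_cadlag M F T" and \<sigma>: "\<sigma> \<in> bounded_times"
  shows "AE \<omega> in M. (\<lambda>n. X (grid_time n (\<sigma> \<omega>)) \<omega>) \<longlonglongrightarrow> X (\<sigma> \<omega>) \<omega>"
  using adapted_cadlagD(2)[OF X]
proof eventually_elim
  case (elim \<omega>)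
  show ?case
    by (rule cadlag_on_tendsto_right[OF elim _ grid_time_tendsto])
       (use bounded_timesD[OF \<sigma>] grid_time_bounds in auto)
qed

text \<open>After rounding both times up to the same grid, the increment telescopes into increments
  over deterministic intervals, each weighted by an event known at the left endpoint, and every
  summand is nonpositive by hypothesis. Right-continuity and domination by \<open>\<xi>\<close>
  remove the grid.\<close>

lemma optional_sampling:
  assumes X: "X \<in> adapted_cadlag M F T" and dom: "dominated X \<xi>" "integrable M \<xi>"
    and super: "\<And>s u A. 0 \<le> s \<Longrightarrow> s \<le> u \<Longrightarrow> u \<le> T \<Longrightarrow> A \<in> sets (F s) \<Longrightarrow>
      (\<integral>\<omega>. indicator A \<omega> * (X u \<omega> - X s \<omega>) \<partial>M) \<le> 0"
    and \<sigma>: "\<sigma> \<in> bounded_times" and \<tau>: "\<tau> \<in> bounded_times" and le: "\<And>\<omega>. \<sigma> \<omega> \<le> \<tau> \<omega>"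
    and A: "A \<in> sets (pre_sigma \<sigma>)"
  shows "(\<integral>\<omega>. indicator A \<omega> * (X (\<tau> \<omega>) \<omega> - X (\<sigma> \<omega>) \<omega>) \<partial>M) \<le> 0"
proof -
  have AM: "A \<in> sets M" using A subalgebra_pre_sigma[OF \<sigma>] by (auto simp: subalgebra_def)
  define f where "f n \<omega> = indicator A \<omega> * (X (grid_time n (\<tau> \<omega>)) \<omega> - X (grid_time n (\<sigma> \<omega>)) \<omega>)" for n \<omega>
  have fle: "(\<integral>\<omega>. f n \<omega> \<partial>M) \<le> 0" for n
  proof -
    define h where "h = T / Suc n"
    have h: "0 < h" "h * real (Suc n) = T" using T_pos by (simp_all add: h_def)
    \<comment> \<open>The event that the step from \<open>h * real k\<close> lies between the two
      rounded times. It is known at \<open>h * real k\<close> because \<open>A\<close> belongs to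
      the past of \<open>\<sigma>\<close>.\<close>
    define B where "B k = {\<omega> \<in> A. \<sigma> \<omega> \<le> h * real k \<and> \<not> \<tau> \<omega> \<le> h * real k}" for k
    have BF: "B k \<in> sets (F (h * real k))" for k
    proof -
      have "{\<omega> \<in> A. \<sigma> \<omega> \<le> h * real k} - {\<omega> \<in> space M. \<tau> \<omega> \<le> h * real k} \<in> sets (F (h * real k))"
        using sets_pre_sigmaD[OF bounded_timesD(1)[OF \<sigma>] A] bounded_timesD(1)[OF \<tau>]
        by (auto simp: stopping_time_iff)
      also have "{\<omega> \<in> A. \<sigma> \<omega> \<le> h * real k} - {\<omega> \<in> space M. \<tau> \<omega> \<le> h * real k} = B k"
        using sets.sets_into_space[OF AM] by (auto simp: B_def)
      finally show ?thesis .
    qed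
    have kT: "h * real k \<in> {0..T}" if "k \<le> Suc n" for k
    proof -
      have "h * real k \<le> h * real (Suc n)" using that h by (intro mult_left_mono) auto
      then show ?thesis using h(1) unfolding h(2) by simp
    qed
    have X_int: "integrable M (X s)" if "s \<in> {0..T}" for s
      using integrable_stopped[OF X bounded_times_const[OF that] dom] by simp
    have "f n \<omega> = (\<Sum>k<Suc n. indicator (B k) \<omega> * (X (h * real (Suc k)) \<omega> - X (h * real k) \<omega>))" for \<omega>
    proof -
      define a where "a = nat \<lceil>\<sigma> \<omega> / h\<rceil>"
      define b where "b = nat \<lceil>\<tau> \<omega> / h\<rceil>"
      have b0: "0 \<le> \<sigma> \<omega>" "\<sigma> \<omega> \<le> T" "0 \<le> \<tau> \<omega>" "\<tau> \<omega> \<le> T" using bounded_timesD[OF \<sigma>] bounded_timesD[OF \<tau>] by auto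
      have g: "grid_time n (\<sigma> \<omega>) = h * real a" "grid_time n (\<tau> \<omega>) = h * real b"
        using h b0 by (simp_all add: grid_time_def h_def a_def b_def)
      have "h * real b \<le> h * real (Suc n)" using grid_time_bounds(3)[OF b0(4), of n] unfolding g h(2) .
      then have bN: "b \<le> Suc n" using h(1) by (simp del: of_nat_Suc)
      have "h * real a \<le> h * real b" using grid_time_bounds(5)[OF le] unfolding g(1)[symmetric] g(2)[symmetric] .
      then have ab: "a \<le> b" using h by simp
      have iff: "\<sigma> \<omega> \<le> h * real k \<longleftrightarrow> a \<le> k" "\<tau> \<omega> \<le> h * real k \<longleftrightarrow> b \<le> k" for k
        using grid_time_le_iff[of n "\<sigma> \<omega>" k, folded h_def] grid_time_le_iff[of n "\<tau> \<omega>" k, folded h_def] h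
        unfolding g by auto
      show ?thesis
        unfolding f_def g telescope_of_bool[OF ab bN, of "\<lambda>k. X (h * real k) \<omega>"] sum_distrib_left
        by (intro sum.cong refl) (auto simp: B_def iff indicator_def)
    qed
    then have "(\<integral>\<omega>. f n \<omega> \<partial>M) = (\<integral>\<omega>. (\<Sum>k<Suc n. indicator (B k) \<omega> * (X (h * real (Suc k)) \<omega> - X (h * real k) \<omega>)) \<partial>M)"
      by simp
    also have "\<dots> = (\<Sum>k<Suc n. \<integral>\<omega>. indicator (B k) \<omega> * (X (h * real (Suc k)) \<omega> - X (h * real k) \<omega>) \<partial>M)"
    proof (rule Bochner_Integration.integral_sum)
      fix k assume "k \<in> {..<Suc n}"
      then show "integrable M (\<lambda>\<omega>. indicator (B k) \<omega> * (X (h * real (Suc k)) \<omega> - X (h * real k) \<omega>))"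
        using BF[of k] F_subset X_int[OF kT[of k]] X_int[OF kT[of "Suc k"]]
        by (intro integrable_indicator_times Bochner_Integration.integrable_diff) auto
    qed
    also have "\<dots> \<le> 0"
    proof (intro sum_nonpos super BF)
      fix k assume "k \<in> {..<Suc n}"
      then show "0 \<le> h * real k" "h * real k \<le> h * real (Suc k)" "h * real (Suc k) \<le> T"
        using kT[of k] kT[of "Suc k"] h by auto
    qed
    finally show ?thesis .
  qed
  have "(\<lambda>n. \<integral>\<omega>. f n \<omega> \<partial>M) \<longlonglongrightarrow> (\<integral>\<omega>. indicator A \<omega> * (X (\<tau> \<omega>) \<omega> - X (\<sigma> \<omega>) \<omega>) \<partial>M)"
  proof (rule integral_dominated_convergence)
    show "integrable M (\<lambda>\<omega>. 2 * \<xi> \<omega>)" using dom by simp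
    show "(\<lambda>\<omega>. indicator A \<omega> * (X (\<tau> \<omega>) \<omega> - X (\<sigma> \<omega>) \<omega>)) \<in> borel_measurable M"
      using AM borel_measurable_stopped_M[OF X \<sigma>] borel_measurable_stopped_M[OF X \<tau>] by measurable
    show "f n \<in> borel_measurable M" for n
      unfolding f_def using AM borel_measurable_stopped_M[OF X grid_time_bounded_times[OF \<sigma>]]
        borel_measurable_stopped_M[OF X grid_time_bounded_times[OF \<tau>]] by measurable
    show "AE \<omega> in M. (\<lambda>n. f n \<omega>) \<longlonglongrightarrow> indicator A \<omega> * (X (\<tau> \<omega>) \<omega> - X (\<sigma> \<omega>) \<omega>)"
      using grid_time_stopped_tendsto[OF X \<sigma>] grid_time_stopped_tendsto[OF X \<tau>]
      unfolding f_def by eventually_elim (intro tendsto_intros)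
    show "AE \<omega> in M. norm (f n \<omega>) \<le> 2 * \<xi> \<omega>" for n
      using dominated_stopped[OF dom(1) grid_time_bounded_times[OF \<sigma>], of n] dominated_stopped[OF dom(1) grid_time_bounded_times[OF \<tau>], of n]
      by eventually_elim (auto simp: f_def indicator_def)
  qed
  then show ?thesis using fle by (intro LIMSEQ_le_const2) auto
qed

section \<open>Closure properties of quasi-left-continuous processes and domination\<close>

lemma space_Q_adapted: "X \<in> space_Q M F T \<Longrightarrow> X \<in> adapted_cadlag M F T"
  by (simp add: space_Q_def)

lemma predictable_time_range: "predictable_time M F T S \<Longrightarrow> AE \<omega> in M. S \<omega> \<in> {0..T}"
  by (auto simp: predictable_time_def stopping_times_def)

lemma space_Q_compose:
  assumes X: "X \<in> space_Q M F T" and Y: "Y \<in> space_Q M F T"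
    and f: "continuous_on UNIV (\<lambda>p. f (fst p) (snd p))"
  shows "(\<lambda>s \<omega>. f (X s \<omega>) (Y s \<omega>)) \<in> space_Q M F T"
  unfolding space_Q_def adapted_cadlag_def
proof (intro CollectI conjI allI impI ballI)
  show "(\<lambda>\<omega>. f (X s \<omega>) (Y s \<omega>)) \<in> borel_measurable (F s)" if "s \<in> {0..T}" for s
    using adapted_cadlagD(1)[OF space_Q_adapted[OF X] that] adapted_cadlagD(1)[OF space_Q_adapted[OF Y] that] f
    by (rule borel_measurable_continuous_Pair)
  show "AE \<omega> in M. cadlag_on T (\<lambda>s. f (X s \<omega>) (Y s \<omega>))"
    using adapted_cadlagD(2)[OF space_Q_adapted[OF X]] adapted_cadlagD(2)[OF space_Q_adapted[OF Y]]
    by eventually_elim (rule cadlag_on_compose(1)[OF _ _ f])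
  fix S assume S: "predictable_time M F T S"
  then have "AE \<omega> in M. X (S \<omega>) \<omega> = left_limit (\<lambda>t. X t \<omega>) (S \<omega>)"
    "AE \<omega> in M. Y (S \<omega>) \<omega> = left_limit (\<lambda>t. Y t \<omega>) (S \<omega>)"
    using X Y by (auto simp: space_Q_def)
  then show "AE \<omega> in M. f (X (S \<omega>) \<omega>) (Y (S \<omega>) \<omega>) = left_limit (\<lambda>s. f (X s \<omega>) (Y s \<omega>)) (S \<omega>)"
    using adapted_cadlagD(2)[OF space_Q_adapted[OF X]] adapted_cadlagD(2)[OF space_Q_adapted[OF Y]]
      predictable_time_range[OF S]
  proof eventually_elim
    case (elim \<omega>)
    then show ?case using cadlag_on_compose(2)[OF elim(3,4) f, of "S \<omega>"] by simp
  qed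
qed

lemma space_Q_add: "X \<in> space_Q M F T \<Longrightarrow> Y \<in> space_Q M F T \<Longrightarrow> (\<lambda>s \<omega>. X s \<omega> + Y s \<omega>) \<in> space_Q M F T"
  by (rule space_Q_compose[where f="(+)", OF _ _ continuous_on_add[OF continuous_on_fst[OF continuous_on_id] continuous_on_snd[OF continuous_on_id]]])

lemma space_Q_diff: "X \<in> space_Q M F T \<Longrightarrow> Y \<in> space_Q M F T \<Longrightarrow> (\<lambda>s \<omega>. X s \<omega> - Y s \<omega>) \<in> space_Q M F T"
  by (rule space_Q_compose[where f="(-)", OF _ _ continuous_on_diff[OF continuous_on_fst[OF continuous_on_id] continuous_on_snd[OF continuous_on_id]]])

lemma space_Q_Max:
  assumes "finite I" "I \<noteq> {}" "\<And>i. i \<in> I \<Longrightarrow> X i \<in> space_Q M F T"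
  shows "(\<lambda>s \<omega>. Max ((\<lambda>i. X i s \<omega>) ` I)) \<in> space_Q M F T"
  using assms
proof (induction I rule: finite_ne_induct)
  case (singleton i)
  then show ?case by simp
next
  case (insert i I)
  have "(\<lambda>s \<omega>. max (X i s \<omega>) (Max ((\<lambda>i. X i s \<omega>) ` I))) \<in> space_Q M F T"
    using insert by (intro space_Q_compose[where f=max, OF _ _ continuous_on_max[OF continuous_on_fst[OF continuous_on_id] continuous_on_snd[OF continuous_on_id]]]) auto
  then show ?case using insert.hyps by simp
qed

text \<open>The supremum over all times comes without measurability. The supremum over the rationals
  is countable and controls all other times by right-continuity; \<open>T\<close> is added since it
  cannot be approached from the right.\<close>

lemma space_S2_dominated:
  assumes X: "X \<in> space_S2 M F T"
  obtains \<xi> where "\<xi> \<in> borel_measurable M" "\<And>\<omega>. 0 \<le> \<xi> \<omega>" "integrable M (\<lambda>\<omega>. (\<xi> \<omega>)\<^sup>2)" "dominated X \<xi>"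
proof -
  have ad: "X \<in> adapted_cadlag M F T" using X by (simp add: space_S2_def)
  define Q where "Q = insert T (\<rat> \<inter> {0..T})"
  have Q: "countable Q" "Q \<noteq> {}" "Q \<subseteq> {0..T}" using T_pos by (auto simp: Q_def countable_rat)
  define r where "r \<omega> = (SUP s\<in>Q. ennreal \<bar>X s \<omega>\<bar>)" for \<omega>
  have [measurable]: "r \<in> borel_measurable M"
    unfolding r_def using Q borel_measurable_F_M[OF adapted_cadlagD(1)[OF ad]]
    by (intro borel_measurable_SUP) auto
  have "(\<integral>\<^sup>+\<omega>. (r \<omega>)\<^sup>2 \<partial>M) \<le> (\<integral>\<^sup>+\<omega>. (SUP t\<in>{0..T}. ennreal \<bar>X t \<omega>\<bar>)\<^sup>2 \<partial>M)"
    unfolding r_def using Q(3) by (intro nn_integral_mono power_mono SUP_subset_mono) auto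
  also have "\<dots> < \<infinity>" using X by (simp add: space_S2_def)
  finally have fin: "(\<integral>\<^sup>+\<omega>. (r \<omega>)\<^sup>2 \<partial>M) < \<infinity>" .
  then have "AE \<omega> in M. (r \<omega>)\<^sup>2 \<noteq> \<infinity>" by (intro nn_integral_PInf_AE) auto
  then have rfin: "AE \<omega> in M. r \<omega> \<noteq> \<infinity>" by eventually_elim (auto simp: power2_eq_square ennreal_top_mult)
  show thesis
  proof
    show "(\<lambda>\<omega>. enn2real (r \<omega>)) \<in> borel_measurable M" by measurable
    show "0 \<le> enn2real (r \<omega>)" for \<omega> by simp
    have "(\<integral>\<^sup>+\<omega>. ennreal ((enn2real (r \<omega>))\<^sup>2) \<partial>M) = (\<integral>\<^sup>+\<omega>. (r \<omega>)\<^sup>2 \<partial>M)"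
    proof (rule nn_integral_cong_AE)
      show "AE \<omega> in M. ennreal ((enn2real (r \<omega>))\<^sup>2) = (r \<omega>)\<^sup>2"
        using rfin by eventually_elim (simp add: ennreal_power[symmetric] ennreal_enn2real less_top)
    qed
    then show "integrable M (\<lambda>\<omega>. (enn2real (r \<omega>))\<^sup>2)"
      using fin by (intro integrableI_nonneg) auto
    show "dominated X (\<lambda>\<omega>. enn2real (r \<omega>))"
      unfolding dominated_def using adapted_cadlagD(2)[OF ad] rfin
    proof eventually_elim
      case (elim \<omega>)
      have q: "\<bar>X s \<omega>\<bar> \<le> enn2real (r \<omega>)" if "s \<in> Q" for s
      proof -
        have "ennreal \<bar>X s \<omega>\<bar> \<le> r \<omega>" unfolding r_def using that by (rule SUP_upper)
        then show ?thesis using enn2real_mono[of "ennreal \<bar>X s \<omega>\<bar>" "r \<omega>"] elim(2) by (simp add: less_top)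
      qed
      show ?case
      proof
        fix s assume s: "s \<in> {0..T}"
        show "\<bar>X s \<omega>\<bar> \<le> enn2real (r \<omega>)"
        proof (cases "s = T")
          case False
          then have "s < T" using s by simp
          then obtain u where u: "\<And>n. u n \<in> \<rat>" "\<And>n. s < u n" and uT: "\<And>n. u n \<le> T" and lim: "u \<longlonglongrightarrow> s"
            using rational_approx_right by blast
          from lim have "(\<lambda>n. X (u n) \<omega>) \<longlonglongrightarrow> X s \<omega>"
            by (rule cadlag_on_tendsto_right[OF elim(1) s]) (use u uT in \<open>auto intro: less_imp_le\<close>)
          then have "(\<lambda>n. \<bar>X (u n) \<omega>\<bar>) \<longlonglongrightarrow> \<bar>X s \<omega>\<bar>" by (intro tendsto_intros)
          moreover have "\<bar>X (u n) \<omega>\<bar> \<le> enn2real (r \<omega>)" for n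
            using u(1)[of n] u(2)[of n] uT[of n] s by (intro q) (auto simp: Q_def)
          ultimately show ?thesis by (intro LIMSEQ_le_const2) auto
        qed (use q in \<open>auto simp: Q_def\<close>)
      qed
    qed
  qed
qed

section \<open>Time integrals of running profits\<close>

definition integral_process :: "(real \<Rightarrow> 'a \<Rightarrow> real) \<Rightarrow> real \<Rightarrow> 'a \<Rightarrow> real" where
  "integral_process \<psi> s \<omega> = (LINT u:{0..s}|lborel. \<psi> u \<omega>)"

lemma space_M2_abs: "\<psi> \<in> space_M2 M F T \<Longrightarrow> (\<lambda>s \<omega>. \<bar>\<psi> s \<omega>\<bar>) \<in> space_M2 M F T"
proof -
  have "(\<lambda>(s, \<omega>). \<bar>\<psi> s \<omega>\<bar>) = (\<lambda>p. \<bar>(\<lambda>(s, \<omega>). \<psi> s \<omega>) p\<bar>)" for \<psi> :: "real \<Rightarrow> 'a \<Rightarrow> real" by auto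
  then show "\<psi> \<in> space_M2 M F T \<Longrightarrow> (\<lambda>s \<omega>. \<bar>\<psi> s \<omega>\<bar>) \<in> space_M2 M F T"
    by (auto simp: space_M2_def progressively_measurable_def intro!: borel_measurable_abs)
qed

lemma progressively_measurable_lborel:
  assumes "progressively_measurable F T \<psi>" "s \<in> {0..T}"
  shows "(\<lambda>(\<omega>, u). \<psi> u \<omega>) \<in> borel_measurable (F s \<Otimes>\<^sub>M restrict_space lborel {0..s})"
proof -
  have "(\<lambda>(u, \<omega>). \<psi> u \<omega>) \<in> borel_measurable (restrict_space borel {0..s} \<Otimes>\<^sub>M F s)"
    using assms by (auto simp: progressively_measurable_def)
  from measurable_compose[OF measurable_pair_swap' this]
  have "(\<lambda>(\<omega>, u). \<psi> u \<omega>) \<in> borel_measurable (F s \<Otimes>\<^sub>M restrict_space borel {0..s})"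
    by (simp add: case_prod_beta')
  also have "borel_measurable (F s \<Otimes>\<^sub>M restrict_space borel {0..s}) = borel_measurable (F s \<Otimes>\<^sub>M restrict_space lborel {0..s})"
    by (intro measurable_cong_sets sets_pair_measure_cong sets_restrict_space_cong) auto
  finally show ?thesis .
qed

lemma progressively_measurable_path:
  assumes "progressively_measurable F T \<psi>" "\<omega> \<in> space M"
  shows "set_borel_measurable lborel {0..T} (\<lambda>u. \<psi> u \<omega>)"
proof -
  have "(\<lambda>u. \<psi> u \<omega>) \<in> borel_measurable (restrict_space lborel {0..T})"
    using measurable_compose[OF measurable_Pair1'[of \<omega> "F T" "restrict_space lborel {0..T}"]
        progressively_measurable_lborel[OF assms(1), of T]] assms(2) T_pos
    by (simp add: space_F)
  then show ?thesis
    by (simp add: set_borel_measurable_def borel_measurable_restrict_space_iff)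
qed

lemma borel_measurable_integral_process:
  assumes "progressively_measurable F T \<psi>" "s \<in> {0..T}"
  shows "integral_process \<psi> s \<in> borel_measurable (F s)"
proof -
  interpret L: sigma_finite_measure "restrict_space lborel {0..s}"
    by (intro sigma_finite_measure_restrict_space sigma_finite_lborel) simp
  have "(\<lambda>\<omega>. \<integral>u. \<psi> u \<omega> \<partial>restrict_space lborel {0..s}) \<in> borel_measurable (F s)"
    using progressively_measurable_lborel[OF assms] by (intro L.borel_measurable_lebesgue_integral) simp
  then show ?thesis
    by (simp add: integral_process_def[abs_def] set_lebesgue_integral_def integral_restrict_space)
qed

text \<open>Cauchy-Schwarz in the time variable on each path: the square of the integral of the
  absolute value is at most \<open>T\<close> times the integral of the square, which has finite
  expectation by membership in \<open>space_M2\<close>.\<close>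

lemma space_M2_square_integral:
  assumes \<psi>: "\<psi> \<in> space_M2 M F T"
  shows "AE \<omega> in M. set_integrable lborel {0..T} (\<lambda>u. \<psi> u \<omega>)"
    and "integrable M (\<lambda>\<omega>. (integral_process (\<lambda>s \<omega>. \<bar>\<psi> s \<omega>\<bar>) T \<omega>)\<^sup>2)"
proof -
  have pm: "progressively_measurable F T \<psi>" using \<psi> by (simp add: space_M2_def)
  interpret L: sigma_finite_measure "restrict_space lborel {0..T}"
    by (intro sigma_finite_measure_restrict_space sigma_finite_lborel) simp
  define v where "v \<omega> = (\<integral>\<^sup>+s\<in>{0..T}. ennreal (\<bar>\<psi> s \<omega>\<bar>\<^sup>2) \<partial>lborel)" for \<omega>
  have "(\<lambda>(\<omega>, u). ennreal (\<bar>\<psi> u \<omega>\<bar>\<^sup>2)) \<in> borel_measurable (F T \<Otimes>\<^sub>M restrict_space lborel {0..T})"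
    using measurable_compose[OF progressively_measurable_lborel[OF pm, of T], of "\<lambda>x. ennreal (\<bar>x\<bar>\<^sup>2)" borel] T_pos
    by (simp add: case_prod_beta')
  then have "(\<lambda>\<omega>. \<integral>\<^sup>+u. ennreal (\<bar>\<psi> u \<omega>\<bar>\<^sup>2) \<partial>restrict_space lborel {0..T}) \<in> borel_measurable (F T)"
    by (intro L.borel_measurable_nn_integral) simp
  then have "v \<in> borel_measurable (F T)"
    by (simp add: v_def[abs_def] nn_integral_restrict_space)
  then have [measurable]: "v \<in> borel_measurable M" by (rule measurable_from_subalg[OF subalgebra_F])
  have vfin: "(\<integral>\<^sup>+\<omega>. v \<omega> \<partial>M) < \<infinity>" using \<psi> by (simp add: space_M2_def v_def)
  then have "AE \<omega> in M. v \<omega> \<noteq> \<infinity>" by (intro nn_integral_PInf_AE) auto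
  then have path: "AE \<omega> in M. v \<omega> \<noteq> \<infinity> \<and> set_integrable lborel {0..T} (\<lambda>u. \<psi> u \<omega>) \<and>
      ennreal ((integral_process (\<lambda>s \<omega>. \<bar>\<psi> s \<omega>\<bar>) T \<omega>)\<^sup>2) \<le> ennreal T * v \<omega>"
    using AE_space
  proof eventually_elim
    case (elim \<omega>)
    let ?I = "indicator {0..T} :: real \<Rightarrow> real"
    have meas: "(\<lambda>u. ?I u * \<psi> u \<omega>) \<in> borel_measurable lborel"
      using progressively_measurable_path[OF pm elim(2)] by (simp add: set_borel_measurable_def)
    have sq: "?I u * (\<psi> u \<omega>)\<^sup>2 = (?I u * \<psi> u \<omega>)\<^sup>2" for u by (simp add: indicator_def)
    have meas2: "(\<lambda>u. ?I u * (\<psi> u \<omega>)\<^sup>2) \<in> borel_measurable lborel" unfolding sq using meas by measurable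
    have veq: "(\<integral>\<^sup>+u. ennreal (?I u * (\<psi> u \<omega>)\<^sup>2) \<partial>lborel) = v \<omega>"
      unfolding v_def by (intro nn_integral_cong) (auto simp: indicator_def)
    then have int2: "integrable lborel (\<lambda>u. ?I u * (\<psi> u \<omega>)\<^sup>2)"
      using elim(1) meas2 by (intro integrableI_nonneg) (auto simp: less_top)
    have int1: "integrable lborel (\<lambda>u. ?I u)" using T_pos by (intro integrable_real_indicator) auto
    have int: "integrable lborel (\<lambda>u. ?I u * \<psi> u \<omega>)"
    proof (rule Bochner_Integration.integrable_bound[OF Bochner_Integration.integrable_add[OF int1 int2] meas])
      show "AE u in lborel. norm (?I u * \<psi> u \<omega>) \<le> norm (?I u + ?I u * (\<psi> u \<omega>)\<^sup>2)"
      proof (rule AE_I2)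
        fix u
        have "0 \<le> (\<bar>\<psi> u \<omega>\<bar> - 1)\<^sup>2 + (\<bar>\<psi> u \<omega>\<bar>)\<^sup>2" by simp
        then have "2 * \<bar>\<psi> u \<omega>\<bar> \<le> 1 + 2 * (\<psi> u \<omega>)\<^sup>2" by (simp add: power2_eq_square algebra_simps)
        then have "\<bar>\<psi> u \<omega>\<bar> \<le> 1 + (\<psi> u \<omega>)\<^sup>2" by simp
        then show "norm (?I u * \<psi> u \<omega>) \<le> norm (?I u + ?I u * (\<psi> u \<omega>)\<^sup>2)" by (auto simp: indicator_def)
      qed
    qed
    then have inta: "integrable lborel (\<lambda>u. ?I u * \<bar>\<psi> u \<omega>\<bar>)"
      using integrable_abs[OF int] by (simp add: abs_mult)
    define \<theta> where "\<theta> = integral_process (\<lambda>s \<omega>. \<bar>\<psi> s \<omega>\<bar>) T \<omega>"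
    have \<theta>: "\<theta> = (\<integral>u. ?I u * \<bar>\<psi> u \<omega>\<bar> \<partial>lborel)"
      by (simp add: \<theta>_def integral_process_def set_lebesgue_integral_def)
    \<comment> \<open>The time average of the absolute value. Nonnegativity of the corresponding
      variance is the Cauchy-Schwarz inequality with its sharp constant \<open>T\<close>.\<close>
    define c where "c = \<theta> / T"
    have "0 \<le> (\<integral>u. ?I u * (\<bar>\<psi> u \<omega>\<bar> - c)\<^sup>2 \<partial>lborel)" by (intro integral_nonneg_AE) auto
    also have "(\<lambda>u. ?I u * (\<bar>\<psi> u \<omega>\<bar> - c)\<^sup>2) = (\<lambda>u. ?I u * (\<psi> u \<omega>)\<^sup>2 - 2 * c * (?I u * \<bar>\<psi> u \<omega>\<bar>) + c\<^sup>2 * ?I u)"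
      by (auto simp: indicator_def power2_eq_square algebra_simps)
    also have "(\<integral>u. ?I u * (\<psi> u \<omega>)\<^sup>2 - 2 * c * (?I u * \<bar>\<psi> u \<omega>\<bar>) + c\<^sup>2 * ?I u \<partial>lborel)
      = (\<integral>u. ?I u * (\<psi> u \<omega>)\<^sup>2 \<partial>lborel) - 2 * c * \<theta> + c\<^sup>2 * T"
      using int1 int2 inta T_pos unfolding \<theta> by simp
    also have "\<dots> = (\<integral>u. ?I u * (\<psi> u \<omega>)\<^sup>2 \<partial>lborel) - \<theta>\<^sup>2 / T"
      using T_pos by (simp add: c_def power2_eq_square field_simps)
    finally have "\<theta>\<^sup>2 / T \<le> (\<integral>u. ?I u * (\<psi> u \<omega>)\<^sup>2 \<partial>lborel)" by linarith
    then have "\<theta>\<^sup>2 \<le> T * (\<integral>u. ?I u * (\<psi> u \<omega>)\<^sup>2 \<partial>lborel)"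
      using T_pos by (simp add: pos_divide_le_eq mult.commute)
    moreover have "ennreal (\<integral>u. ?I u * (\<psi> u \<omega>)\<^sup>2 \<partial>lborel) = v \<omega>"
      using nn_integral_eq_integral[OF int2] veq by simp
    ultimately have "ennreal (\<theta>\<^sup>2) \<le> ennreal T * v \<omega>"
      using T_pos ennreal_leI[of "\<theta>\<^sup>2" "T * (\<integral>u. ?I u * (\<psi> u \<omega>)\<^sup>2 \<partial>lborel)"] ennreal_mult'[of T "\<integral>u. ?I u * (\<psi> u \<omega>)\<^sup>2 \<partial>lborel"] by simp
    then show ?case using elim(1) int by (simp add: \<theta>_def set_integrable_def)
  qed
  then show "AE \<omega> in M. set_integrable lborel {0..T} (\<lambda>u. \<psi> u \<omega>)" by eventually_elim simp
  have "integral_process (\<lambda>s \<omega>. \<bar>\<psi> s \<omega>\<bar>) T \<in> borel_measurable (F T)"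
    using space_M2_abs[OF \<psi>] T_pos by (intro borel_measurable_integral_process) (auto simp: space_M2_def)
  then have [measurable]: "integral_process (\<lambda>s \<omega>. \<bar>\<psi> s \<omega>\<bar>) T \<in> borel_measurable M"
    by (rule measurable_from_subalg[OF subalgebra_F])
  have "(\<integral>\<^sup>+\<omega>. ennreal ((integral_process (\<lambda>s \<omega>. \<bar>\<psi> s \<omega>\<bar>) T \<omega>)\<^sup>2) \<partial>M) \<le> (\<integral>\<^sup>+\<omega>. ennreal T * v \<omega> \<partial>M)"
    using path by (intro nn_integral_mono_AE) auto
  also have "\<dots> < \<infinity>" using vfin by (simp add: nn_integral_cmult ennreal_mult_less_top)
  finally show "integrable M (\<lambda>\<omega>. (integral_process (\<lambda>s \<omega>. \<bar>\<psi> s \<omega>\<bar>) T \<omega>)\<^sup>2)"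
    by (intro integrableI_nonneg) auto
qed

text \<open>The last estimate bounds increments by those of a nondecreasing process, so that they
  can be summed over any number of switching intervals without loss.\<close>

lemma integral_process_diff:
  assumes int: "set_integrable lborel {0..T} (\<lambda>u. \<psi> u \<omega>)" and ab: "0 \<le> a" "a \<le> b" "b \<le> T"
  shows "set_integrable lborel {a<..b} (\<lambda>u. \<psi> u \<omega>)"
    and "integral_process \<psi> b \<omega> - integral_process \<psi> a \<omega> = (LINT u:{a<..b}|lborel. \<psi> u \<omega>)"
    and "\<bar>integral_process \<psi> b \<omega> - integral_process \<psi> a \<omega>\<bar>
      \<le> integral_process (\<lambda>s \<omega>. \<bar>\<psi> s \<omega>\<bar>) b \<omega> - integral_process (\<lambda>s \<omega>. \<bar>\<psi> s \<omega>\<bar>) a \<omega>"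
proof -
  have *: "set_integrable lborel {a<..b} (\<lambda>u. f u) \<and>
     (LINT u:{0..b}|lborel. f u) - (LINT u:{0..a}|lborel. f u) = (LINT u:{a<..b}|lborel. f u)"
    if int: "set_integrable lborel {0..T} (\<lambda>u. f u)" for f :: "real \<Rightarrow> real"
  proof -
    have 1: "set_integrable lborel {a<..b} f" "set_integrable lborel {0..a} f"
      using ab by (auto intro!: set_integrable_subset[OF int])
    have "(LINT u:{0..a} \<union> {a<..b}|lborel. f u) = (LINT u:{0..a}|lborel. f u) + (LINT u:{a<..b}|lborel. f u)"
      by (rule set_integral_Un) (use 1 in auto)
    moreover have "{0..a} \<union> {a<..b} = {0..b}" using ab by auto
    ultimately show ?thesis using 1 by simp
  qed
  show 1: "set_integrable lborel {a<..b} (\<lambda>u. \<psi> u \<omega>)"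
    and 2: "integral_process \<psi> b \<omega> - integral_process \<psi> a \<omega> = (LINT u:{a<..b}|lborel. \<psi> u \<omega>)"
    using *[OF int] by (auto simp: integral_process_def)
  have inta: "set_integrable lborel {0..T} (\<lambda>u. \<bar>\<psi> u \<omega>\<bar>)"
    using set_integrable_abs[OF int] .
  have "\<bar>LINT u:{a<..b}|lborel. \<psi> u \<omega>\<bar> \<le> (LINT u:{a<..b}|lborel. \<bar>\<psi> u \<omega>\<bar>)"
    using set_integral_norm_bound[OF 1] by simp
  then show "\<bar>integral_process \<psi> b \<omega> - integral_process \<psi> a \<omega>\<bar>
      \<le> integral_process (\<lambda>s \<omega>. \<bar>\<psi> s \<omega>\<bar>) b \<omega> - integral_process (\<lambda>s \<omega>. \<bar>\<psi> s \<omega>\<bar>) a \<omega>"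
    using *[OF inta] unfolding 2 by (simp add: integral_process_def)
qed

text \<open>Almost every path is continuous, being an indefinite integral, so left limits agree with
  values at every time of the interval and in particular at predictable ones.\<close>

lemma integral_process_space_Q:
  assumes \<psi>: "\<psi> \<in> space_M2 M F T"
  shows "integral_process \<psi> \<in> space_Q M F T"
proof -
  have cont: "AE \<omega> in M. continuous_on {0..T} (\<lambda>s. integral_process \<psi> s \<omega>)"
    using space_M2_square_integral(1)[OF \<psi>]
  proof eventually_elim
    case (elim \<omega>)
    have "continuous_on {0..T} (\<lambda>s. integral {0..s} (\<lambda>u. \<psi> u \<omega>))"
      by (rule indefinite_integral_continuous_1) (rule set_borel_integral_eq_integral(1)[OF elim])
    moreover have "integral {0..s} (\<lambda>u. \<psi> u \<omega>) = integral_process \<psi> s \<omega>" if "s \<in> {0..T}" for s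
      unfolding integral_process_def
      by (rule set_borel_integral_eq_integral(2)[symmetric], rule set_integrable_subset[OF elim]) (use that in auto)
    ultimately show ?case by (rule continuous_on_eq)
  qed
  have *: "cadlag_on T x \<and> (\<forall>s\<in>{0..T}. left_limit x s = x s)" if x: "continuous_on {0..T} x" for x :: "real \<Rightarrow> real"
  proof -
    have tend: "(x \<longlongrightarrow> x s) (at s within {0..T})" if "s \<in> {0..T}" for s
      using x that by (auto simp: continuous_on_def)
    have r: "(x \<longlongrightarrow> x s) (at_right s)" if "0 \<le> s" "s < T" for s
    proof -
      have "(x \<longlongrightarrow> x s) (at s within {s..T})"
        by (rule tendsto_within_subset[OF tend]) (use that in auto)
      then show ?thesis using that by (simp add: at_within_Icc_at_right)
    qed
    have l: "(x \<longlongrightarrow> x s) (at_left s)" if "0 < s" "s \<le> T" for s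
    proof -
      have "(x \<longlongrightarrow> x s) (at s within {0..s})"
        by (rule tendsto_within_subset[OF tend]) (use that in auto)
      then show ?thesis using that by (simp add: at_within_Icc_at_left)
    qed
    have "left_limit x s = x s" if "s \<in> {0..T}" for s
      using that l[of s] by (auto simp: left_limit_def tendsto_Lim[OF trivial_limit_at_left_real])
    then show ?thesis using r l by (auto simp: cadlag_on_def)
  qed
  have pm: "progressively_measurable F T \<psi>" using \<psi> by (simp add: space_M2_def)
  show ?thesis
    unfolding space_Q_def adapted_cadlag_def
  proof (intro CollectI conjI allI impI ballI)
    show "integral_process \<psi> s \<in> borel_measurable (F s)" if "s \<in> {0..T}" for s
      using borel_measurable_integral_process[OF pm that] .
    show "AE \<omega> in M. cadlag_on T (\<lambda>t. integral_process \<psi> t \<omega>)"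
      using cont by eventually_elim (simp add: *)
    fix S assume S: "predictable_time M F T S"
    show "AE \<omega> in M. integral_process \<psi> (S \<omega>) \<omega> = left_limit (\<lambda>t. integral_process \<psi> t \<omega>) (S \<omega>)"
      using cont predictable_time_range[OF S] by eventually_elim (simp add: *)
  qed
qed

end

section \<open>Essential suprema of directed families\<close>

text \<open>Directedness turns a maximising sequence into one that increases almost surely. Its
  limit \<open>V\<close> has the supremum of the expectations as expectation, and dominates every
  member, for otherwise the maximum with that member would have a larger expectation. Hence
  \<open>Z \<le> V\<close>, and \<open>Z\<close> is approximated in mean.\<close>

lemma (in prob_space) ess_sup_directed_approx:
  fixes R :: "'i \<Rightarrow> 'a \<Rightarrow> real"
  assumes G: "subalgebra M G"
    and sup: "is_ess_sup M {real_cond_exp M G (R a) | a. a \<in> I} Z" and Z: "integrable M Z"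
    and I: "I \<noteq> {}" and R: "\<And>a. a \<in> I \<Longrightarrow> integrable M (R a)"
    and directed: "\<And>a b. a \<in> I \<Longrightarrow> b \<in> I \<Longrightarrow> \<exists>c\<in>I. AE \<omega> in M.
      real_cond_exp M G (R c) \<omega> = max (real_cond_exp M G (R a) \<omega>) (real_cond_exp M G (R b) \<omega>)"
    and \<epsilon>: "0 < \<epsilon>"
  shows "\<exists>a\<in>I. expectation Z \<le> expectation (R a) + \<epsilon>"
proof -
  interpret G: finite_measure_subalgebra M G by unfold_locales (rule G)
  define C where "C a = real_cond_exp M G (R a)" for a
  have C_int: "integrable M (C a)" and C_exp: "expectation (C a) = expectation (R a)" if "a \<in> I" for a
    using G.real_cond_exp_int[OF R[OF that]] by (auto simp: C_def)
  have C_meas[measurable]: "C a \<in> borel_measurable M" for a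
    unfolding C_def by (rule borel_measurable_cond_exp2)
  have CZ: "AE \<omega> in M. C a \<omega> \<le> Z \<omega>" if "a \<in> I" for a
    using sup that by (auto simp: is_ess_sup_def C_def)
  have Zle: "expectation (R a) \<le> expectation Z" if "a \<in> I" for a
    unfolding C_exp[OF that, symmetric] by (rule integral_mono_AE[OF C_int[OF that] Z CZ[OF that]])
  define s where "s = (SUP a\<in>I. expectation (R a))"
  have bdd: "bdd_above ((\<lambda>a. expectation (R a)) ` I)" using Zle by (auto simp: bdd_above_def)
  have s: "expectation (R a) \<le> s" if "a \<in> I" for a
    unfolding s_def by (rule cSUP_upper[OF that bdd])
  have near: "\<exists>a\<in>I. s - e < expectation (R a)" if "0 < e" for e
    using that less_cSUP_iff[OF I bdd, of "s - e"] by (auto simp: s_def)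
  have "\<exists>a. \<forall>n. a n \<in> I \<and> s - 1 / real (Suc n) < expectation (R (a n))"
    using near by (intro choice) (auto simp: Bex_def)
  then obtain a where a: "\<And>n. a n \<in> I" "\<And>n. s - 1 / real (Suc n) < expectation (R (a n))" by auto
  have "\<exists>d. \<forall>a\<in>I. \<forall>b\<in>I. d a b \<in> I \<and> (AE \<omega> in M. C (d a b) \<omega> = max (C a \<omega>) (C b \<omega>))"
    using directed unfolding C_def Bex_def by metis
  then obtain d where d: "\<And>a b. a \<in> I \<Longrightarrow> b \<in> I \<Longrightarrow> d a b \<in> I"
    "\<And>a b. a \<in> I \<Longrightarrow> b \<in> I \<Longrightarrow> AE \<omega> in M. C (d a b) \<omega> = max (C a \<omega>) (C b \<omega>)"
    by auto
  \<comment> \<open>Successive combination of the maximising sequence: the conditional reward of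
    \<open>b n\<close> is at least that of \<open>a n\<close>, and increases with
    \<open>n\<close>.\<close>
  define b where "b = rec_nat (a 0) (\<lambda>n c. d c (a (Suc n)))"
  have b_simps: "b 0 = a 0" "b (Suc n) = d (b n) (a (Suc n))" for n by (simp_all add: b_def)
  have b: "b n \<in> I" for n by (induction n) (auto simp: b_simps a d)
  have step: "AE \<omega> in M. C (b (Suc n)) \<omega> = max (C (b n) \<omega>) (C (a (Suc n)) \<omega>)" for n
    using d(2)[OF b[of n] a(1)[of "Suc n"]] by (simp add: b_simps)
  have good: "AE \<omega> in M. incseq (\<lambda>n. C (b n) \<omega>) \<and> (\<forall>n. C (b n) \<omega> \<le> Z \<omega>)"
  proof -
    have "AE \<omega> in M. \<forall>n. C (b (Suc n)) \<omega> = max (C (b n) \<omega>) (C (a (Suc n)) \<omega>)"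
      using step by (simp add: AE_all_countable)
    moreover have "AE \<omega> in M. \<forall>n. C (b n) \<omega> \<le> Z \<omega>"
      using CZ b by (simp add: AE_all_countable)
    ultimately show ?thesis by eventually_elim (auto intro!: incseq_SucI)
  qed
  have lower: "s - 1 / real (Suc n) \<le> expectation (C (b n))" for n
  proof (cases n)
    case 0
    then show ?thesis using a(2)[of 0] C_exp[OF a(1)[of 0]] by (simp add: b_simps)
  next
    case (Suc k)
    have "expectation (C (a n)) \<le> expectation (C (b n))"
      using step[of k] Suc by (intro integral_mono_AE C_int a b) auto
    then show ?thesis using a(2)[of n] C_exp[OF a(1)[of n]] by simp
  qed
  define V where "V \<omega> = lim (\<lambda>n. C (b n) \<omega>)" for \<omega>
  have V_meas[measurable]: "V \<in> borel_measurable M" unfolding V_def by measurable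
  have V: "AE \<omega> in M. (\<lambda>n. C (b n) \<omega>) \<longlonglongrightarrow> V \<omega>"
    using good
  proof eventually_elim
    case (elim \<omega>)
    then obtain L where "(\<lambda>n. C (b n) \<omega>) \<longlonglongrightarrow> L"
      using incseq_convergent[of "\<lambda>n. C (b n) \<omega>" "Z \<omega>"] by metis
    then show ?case by (simp add: V_def limI)
  qed
  define \<zeta> where "\<zeta> \<omega> = \<bar>C (b 0) \<omega>\<bar> + \<bar>Z \<omega>\<bar>" for \<omega>
  have \<zeta>: "integrable M \<zeta>" unfolding \<zeta>_def using C_int[OF b] Z by auto
  have between: "AE \<omega> in M. C (b 0) \<omega> \<le> C (b n) \<omega> \<and> C (b n) \<omega> \<le> Z \<omega>" for n
    using good by eventually_elim (auto dest: incseqD)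
  have dom: "AE \<omega> in M. norm (C (b n) \<omega>) \<le> \<zeta> \<omega>" for n
    using between[of n] by eventually_elim (auto simp: \<zeta>_def)
  have V_int: "integrable M V"
    by (rule integrable_dominated_convergence[OF V_meas _ \<zeta> V dom]) measurable
  have V_lim: "(\<lambda>n. expectation (C (b n))) \<longlonglongrightarrow> expectation V"
    by (rule integral_dominated_convergence[OF V_meas _ \<zeta> V dom]) measurable
  have Vs: "expectation V = s"
  proof (rule antisym)
    show "expectation V \<le> s"
      using s b C_exp by (intro LIMSEQ_le_const2[OF V_lim]) auto
    have "(\<lambda>n. s - 1 / real (Suc n)) \<longlonglongrightarrow> s - 0"
      by (intro tendsto_intros LIMSEQ_Suc[OF lim_1_over_n])
    then show "s \<le> expectation V"
      using lower by (intro LIMSEQ_le[OF _ V_lim, of "\<lambda>n. s - 1 / real (Suc n)"]) auto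
  qed
  have upper: "AE \<omega> in M. C c \<omega> \<le> V \<omega>" if c: "c \<in> I" for c
  proof -
    \<comment> \<open>A maximum of two members is almost surely a member, so its expectation cannot
      exceed \<open>s\<close>.\<close>
    have m: "expectation (\<lambda>\<omega>. max (C (b n) \<omega>) (C c \<omega>)) \<le> s" for n
    proof -
      have "expectation (\<lambda>\<omega>. max (C (b n) \<omega>) (C c \<omega>)) = expectation (C (d (b n) c))"
        using d(2)[OF b[of n] c] by (intro integral_cong_AE) auto
      then show ?thesis using s[OF d(1)[OF b c]] C_exp[OF d(1)[OF b c]] by simp
    qed
    have dom': "AE \<omega> in M. norm (max (C (b n) \<omega>) (C c \<omega>)) \<le> \<zeta> \<omega>" for n
      using between[of n] CZ[OF c] by eventually_elim (auto simp: \<zeta>_def max_def)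
    have lim': "AE \<omega> in M. (\<lambda>n. max (C (b n) \<omega>) (C c \<omega>)) \<longlonglongrightarrow> max (V \<omega>) (C c \<omega>)"
      using V by eventually_elim (intro tendsto_intros)
    have "(\<lambda>n. expectation (\<lambda>\<omega>. max (C (b n) \<omega>) (C c \<omega>))) \<longlonglongrightarrow> expectation (\<lambda>\<omega>. max (V \<omega>) (C c \<omega>))"
      by (rule integral_dominated_convergence[OF _ _ \<zeta> lim' dom']) measurable
    then have "expectation (\<lambda>\<omega>. max (V \<omega>) (C c \<omega>)) \<le> expectation V"
      unfolding Vs using m by (intro LIMSEQ_le_const2) auto
    moreover have int: "integrable M (\<lambda>\<omega>. max (V \<omega>) (C c \<omega>))"
      using V_int C_int[OF c] by simp
    ultimately have "expectation (\<lambda>\<omega>. max (V \<omega>) (C c \<omega>) - V \<omega>) = 0"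
      using V_int by (intro antisym integral_nonneg_AE) auto
    then have "AE \<omega> in M. max (V \<omega>) (C c \<omega>) - V \<omega> = 0"
      using int V_int by (subst (asm) integral_nonneg_eq_0_iff_AE) auto
    then show ?thesis by eventually_elim (auto simp: max_def split: if_splits)
  qed
  have "\<forall>f\<in>{real_cond_exp M G (R a) | a. a \<in> I}. AE \<omega> in M. f \<omega> \<le> V \<omega>"
    using upper by (auto simp: C_def)
  then have "AE \<omega> in M. Z \<omega> \<le> V \<omega>"
    using sup V_meas unfolding is_ess_sup_def by (elim conjE) (drule (1) bspec, drule (1) mp)
  then have "expectation Z \<le> s" unfolding Vs[symmetric] by (intro integral_mono_AE Z V_int)
  moreover obtain c where "c \<in> I" "s - \<epsilon> < expectation (R c)" using near[OF \<epsilon>] by blast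
  ultimately show ?thesis by (intro bexI[of _ c]) auto
qed

lemma (in prob_space) integrable_of_square:
  fixes f :: "'a \<Rightarrow> real"
  assumes "f \<in> borel_measurable M" "integrable M (\<lambda>\<omega>. (f \<omega>)\<^sup>2)"
  shows "integrable M f"
proof (rule Bochner_Integration.integrable_bound)
  show "integrable M (\<lambda>\<omega>. 1 + (f \<omega>)\<^sup>2)" using assms(2) by simp
  show "AE \<omega> in M. norm (f \<omega>) \<le> norm (1 + (f \<omega>)\<^sup>2)"
  proof (rule AE_I2)
    fix \<omega>
    have "0 \<le> (\<bar>f \<omega>\<bar> - 1)\<^sup>2 + (\<bar>f \<omega>\<bar>)\<^sup>2" by simp
    then have "2 * \<bar>f \<omega>\<bar> \<le> 1 + 2 * (f \<omega>)\<^sup>2" by (simp add: power2_eq_square algebra_simps)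
    then show "norm (f \<omega>) \<le> norm (1 + (f \<omega>)\<^sup>2)" by simp
  qed
qed (rule assms)

lemma integrable_square_add:
  fixes f g :: "'a \<Rightarrow> real"
  assumes [measurable]: "f \<in> borel_measurable M" "g \<in> borel_measurable M"
    and sq: "integrable M (\<lambda>\<omega>. (f \<omega>)\<^sup>2)" "integrable M (\<lambda>\<omega>. (g \<omega>)\<^sup>2)"
  shows "integrable M (\<lambda>\<omega>. (f \<omega> + g \<omega>)\<^sup>2)"
proof (rule Bochner_Integration.integrable_bound)
  show "integrable M (\<lambda>\<omega>. 2 * (f \<omega>)\<^sup>2 + 2 * (g \<omega>)\<^sup>2)" using sq by simp
  show "AE \<omega> in M. norm ((f \<omega> + g \<omega>)\<^sup>2) \<le> norm (2 * (f \<omega>)\<^sup>2 + 2 * (g \<omega>)\<^sup>2)"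
  proof (rule AE_I2)
    fix \<omega>
    have le: "(p + q)\<^sup>2 \<le> 2 * p\<^sup>2 + 2 * q\<^sup>2" for p q :: real
      using zero_le_power2[of "p - q"] by (simp add: power2_eq_square algebra_simps)
    show "norm ((f \<omega> + g \<omega>)\<^sup>2) \<le> norm (2 * (f \<omega>)\<^sup>2 + 2 * (g \<omega>)\<^sup>2)"
      using order_trans[OF le abs_ge_self] by (simp only: real_norm_def abs_power2)
  qed
qed measurable

lemma integrable_square_sum:
  fixes f :: "'i \<Rightarrow> 'a \<Rightarrow> real"
  assumes "finite I" "\<And>i. i \<in> I \<Longrightarrow> f i \<in> borel_measurable M" "\<And>i. i \<in> I \<Longrightarrow> integrable M (\<lambda>\<omega>. (f i \<omega>)\<^sup>2)"
  shows "integrable M (\<lambda>\<omega>. (\<Sum>i\<in>I. f i \<omega>)\<^sup>2)"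
  using assms
proof (induction I rule: finite_induct)
  case (insert i I)
  have "integrable M (\<lambda>\<omega>. (f i \<omega> + (\<Sum>i\<in>I. f i \<omega>))\<^sup>2)"
    using insert by (intro integrable_square_add borel_measurable_sum) auto
  then show ?case using insert.hyps by simp
qed simp

section \<open>The value processes\<close>

locale switching_system = switching_problem M F T m \<psi> \<gamma> \<Gamma>
  for M :: "'a measure" and F :: "real \<Rightarrow> 'a measure" and T :: real and m :: nat
    and \<psi> :: "nat \<Rightarrow> real \<Rightarrow> 'a \<Rightarrow> real"
    and \<gamma> :: "nat \<Rightarrow> nat \<Rightarrow> real \<Rightarrow> 'a \<Rightarrow> real"
    and \<Gamma> :: "nat \<Rightarrow> 'a \<Rightarrow> real" +
  fixes Y :: "nat \<Rightarrow> real \<Rightarrow> 'a \<Rightarrow> real"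
  assumes system: "optimal_stopping_system M F T m \<psi> \<gamma> \<Gamma> Y"
begin

abbreviation \<Psi> :: "nat \<Rightarrow> real \<Rightarrow> 'a \<Rightarrow> real" where
  "\<Psi> i \<equiv> integral_process (\<psi> i)"

abbreviation L :: "nat \<Rightarrow> real \<Rightarrow> 'a \<Rightarrow> real" where
  "L i \<equiv> switching_value m \<gamma> Y i"

definition X :: "nat \<Rightarrow> real \<Rightarrow> 'a \<Rightarrow> real" where
  "X i s \<omega> = Y i s \<omega> + \<Psi> i s \<omega>"

lemma Y_spaces:
  assumes "i \<in> {1..m}"
  shows "Y i \<in> space_Q M F T" "Y i \<in> space_S2 M F T"
  using conjunct1[OF bspec[OF system[unfolded optimal_stopping_system_def] assms]] by simp_all

lemma Y_ess_sup:
  assumes "i \<in> {1..m}" "s \<in> {0..T}"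
  shows "is_ess_sup M {real_cond_exp M (F s) (stopping_reward T m \<psi> \<gamma> \<Gamma> Y i s \<tau>) | \<tau>.
    \<tau> \<in> stopping_times_from M F T (\<lambda>_. s)} (Y i s)"
  using bspec[OF conjunct1[OF conjunct2[OF bspec[OF system[unfolded optimal_stopping_system_def] assms(1)]]] assms(2)] .

lemma Y_terminal: "i \<in> {1..m} \<Longrightarrow> AE \<omega> in M. Y i T \<omega> = \<Gamma> i \<omega>"
  using conjunct2[OF conjunct2[OF bspec[OF system[unfolded optimal_stopping_system_def]]]] .

lemma other_modes: "finite ({1..m} - {i})" "{1..m} - {i} \<noteq> {}"
proof -
  have "(if i = 1 then 2 else 1) \<in> {1..m} - {i}" using m_ge_2 by auto
  then show "{1..m} - {i} \<noteq> {}" by blast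
qed simp

lemma L_ge: "j \<in> {1..m} \<Longrightarrow> j \<noteq> i \<Longrightarrow> Y j s \<omega> - \<gamma> i j s \<omega> \<le> L i s \<omega>"
  unfolding switching_value_def
  by (rule Max_ge[OF finite_imageI[OF other_modes(1)] imageI[of j _ "\<lambda>j. Y j s \<omega> - \<gamma> i j s \<omega>"]]) simp

lemma L_attained:
  obtains j where "j \<in> {1..m}" "j \<noteq> i" "L i s \<omega> = Y j s \<omega> - \<gamma> i j s \<omega>"
proof -
  have "L i s \<omega> \<in> (\<lambda>j. Y j s \<omega> - \<gamma> i j s \<omega>) ` ({1..m} - {i})"
    unfolding switching_value_def using other_modes[of i] by (intro Max_in) auto
  then obtain j where "j \<in> {1..m} - {i}" "L i s \<omega> = Y j s \<omega> - \<gamma> i j s \<omega>" by blast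
  then show thesis using that by blast
qed

lemma L_space_Q: "i \<in> {1..m} \<Longrightarrow> L i \<in> space_Q M F T"
  unfolding switching_value_def[abs_def]
proof (rule space_Q_Max[OF other_modes])
  fix j assume "i \<in> {1..m}" "j \<in> {1..m} - {i}"
  then have "Y j \<in> space_Q M F T" "\<gamma> i j \<in> space_Q M F T"
    using Y_spaces(1)[of j] gamma_Q_S2[of i j] by blast+
  then show "(\<lambda>s \<omega>. Y j s \<omega> - \<gamma> i j s \<omega>) \<in> space_Q M F T" by (rule space_Q_diff)
qed

lemma X_space_Q: "i \<in> {1..m} \<Longrightarrow> X i \<in> space_Q M F T"
  unfolding X_def[abs_def] by (rule space_Q_add[OF Y_spaces(1) integral_process_space_Q[OF psi_M2]])

text \<open>Summation over all modes makes this a bound for the accumulated profit under arbitrary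
  switching between them.\<close>

definition total_variation :: "real \<Rightarrow> 'a \<Rightarrow> real" where
  "total_variation s \<omega> = (\<Sum>i\<in>{1..m}. integral_process (\<lambda>s \<omega>. \<bar>\<psi> i s \<omega>\<bar>) s \<omega>)"

text \<open>There are finitely many modes, so the bounds of the \<open>Y j\<close>, of the
  \<open>\<gamma> i j\<close> and of the integrals of the absolute profits can be added up. The
  switching value is attained at one mode and is thus bounded by one \<open>Y\<close> term and one
  cost term.\<close>

lemma exists_bound:
  "\<exists>\<xi>. \<xi> \<in> borel_measurable M \<and> (\<forall>\<omega>. 0 \<le> \<xi> \<omega>) \<and> integrable M (\<lambda>\<omega>. (\<xi> \<omega>)\<^sup>2) \<and>
    (\<forall>i\<in>{1..m}. dominated (Y i) \<xi> \<and> dominated (L i) \<xi> \<and> dominated (X i) \<xi>) \<and>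
    (\<forall>\<omega>. total_variation T \<omega> \<le> \<xi> \<omega>)"
proof -
  have "\<exists>\<xi>. \<xi> \<in> borel_measurable M \<and> (\<forall>\<omega>. 0 \<le> \<xi> \<omega>) \<and> integrable M (\<lambda>\<omega>. (\<xi> \<omega>)\<^sup>2) \<and> dominated (Y i) \<xi>"
    if "i \<in> {1..m}" for i
    using space_S2_dominated[OF Y_spaces(2)[OF that]] by metis
  then obtain y where y: "\<And>i. i \<in> {1..m} \<Longrightarrow> y i \<in> borel_measurable M" "\<And>i \<omega>. i \<in> {1..m} \<Longrightarrow> 0 \<le> y i \<omega>"
    "\<And>i. i \<in> {1..m} \<Longrightarrow> integrable M (\<lambda>\<omega>. (y i \<omega>)\<^sup>2)" "\<And>i. i \<in> {1..m} \<Longrightarrow> dominated (Y i) (y i)"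
    by metis
  have "\<exists>\<xi>. \<xi> \<in> borel_measurable M \<and> (\<forall>\<omega>. 0 \<le> \<xi> \<omega>) \<and> integrable M (\<lambda>\<omega>. (\<xi> \<omega>)\<^sup>2) \<and> dominated (\<gamma> (fst p) (snd p)) \<xi>"
    if "p \<in> {1..m} \<times> {1..m}" for p
    using space_S2_dominated[of "\<gamma> (fst p) (snd p)"] gamma_Q_S2[of "fst p" "snd p"] that by (metis Int_iff mem_Times_iff)
  then obtain c where c: "\<And>p. p \<in> {1..m} \<times> {1..m} \<Longrightarrow> c p \<in> borel_measurable M" "\<And>p \<omega>. p \<in> {1..m} \<times> {1..m} \<Longrightarrow> 0 \<le> c p \<omega>"
    "\<And>p. p \<in> {1..m} \<times> {1..m} \<Longrightarrow> integrable M (\<lambda>\<omega>. (c p \<omega>)\<^sup>2)" "\<And>p. p \<in> {1..m} \<times> {1..m} \<Longrightarrow> dominated (\<gamma> (fst p) (snd p)) (c p)"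
    by metis
  define \<theta> where "\<theta> i = integral_process (\<lambda>s \<omega>. \<bar>\<psi> i s \<omega>\<bar>) T" for i
  have \<theta>: "\<theta> i \<in> borel_measurable M" "\<And>\<omega>. 0 \<le> \<theta> i \<omega>" "integrable M (\<lambda>\<omega>. (\<theta> i \<omega>)\<^sup>2)" if "i \<in> {1..m}" for i
  proof -
    have "(\<lambda>s \<omega>. \<bar>\<psi> i s \<omega>\<bar>) \<in> space_M2 M F T" using space_M2_abs psi_M2 that by blast
    then show "\<theta> i \<in> borel_measurable M"
      unfolding \<theta>_def using T_pos
      by (intro borel_measurable_F_M[of _ T] borel_measurable_integral_process) (auto simp: space_M2_def)
    show "0 \<le> \<theta> i \<omega>" for \<omega>
      by (auto simp: \<theta>_def integral_process_def set_lebesgue_integral_def intro!: integral_nonneg_AE)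
    show "integrable M (\<lambda>\<omega>. (\<theta> i \<omega>)\<^sup>2)"
      unfolding \<theta>_def by (rule space_M2_square_integral(2)[OF psi_M2[OF that]])
  qed
  define a where "a \<omega> = (\<Sum>i\<in>{1..m}. y i \<omega>)" for \<omega>
  define b where "b \<omega> = (\<Sum>p\<in>{1..m} \<times> {1..m}. c p \<omega>)" for \<omega>
  define e where "e \<omega> = (\<Sum>i\<in>{1..m}. \<theta> i \<omega>)" for \<omega>
  define \<xi> where "\<xi> \<omega> = a \<omega> + b \<omega> + e \<omega>" for \<omega>
  have [measurable]: "a \<in> borel_measurable M" "b \<in> borel_measurable M" "e \<in> borel_measurable M"
    unfolding a_def[abs_def] b_def[abs_def] e_def[abs_def] using y(1) c(1) \<theta>(1) by auto
  have sq: "integrable M (\<lambda>\<omega>. (a \<omega>)\<^sup>2)" "integrable M (\<lambda>\<omega>. (b \<omega>)\<^sup>2)" "integrable M (\<lambda>\<omega>. (e \<omega>)\<^sup>2)"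
    unfolding a_def b_def e_def
    by (rule integrable_square_sum[OF _ y(1,3)] integrable_square_sum[OF _ c(1,3)] integrable_square_sum[OF _ \<theta>(1,3)]; simp)+
  note \<xi>eq = \<xi>_def
  have pos: "0 \<le> a \<omega>" "0 \<le> b \<omega>" "0 \<le> e \<omega>" for \<omega>
    unfolding a_def b_def e_def by (intro sum_nonneg y(2) c(2) \<theta>(2); assumption)+
  have ya: "y i \<omega> \<le> a \<omega>" if "i \<in> {1..m}" for i \<omega>
    unfolding a_def using that y(2) by (intro member_le_sum) auto
  have cb: "c (i, j) \<omega> \<le> b \<omega>" if "i \<in> {1..m}" "j \<in> {1..m}" for i j \<omega>
    unfolding b_def using that c(2) by (intro member_le_sum) auto
  have te: "\<theta> i \<omega> \<le> e \<omega>" if "i \<in> {1..m}" for i \<omega>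
    unfolding e_def using that \<theta>(2) by (intro member_le_sum) auto
  have domY: "AE \<omega> in M. \<forall>s\<in>{0..T}. \<bar>Y i s \<omega>\<bar> \<le> a \<omega>" if "i \<in> {1..m}" for i
    using y(4)[OF that] ya[OF that] unfolding dominated_def
    by (auto elim!: eventually_mono intro: order_trans)
  have domL: "dominated (L i) \<xi>" if i: "i \<in> {1..m}" for i
  proof -
    have "AE \<omega> in M. \<forall>j\<in>{1..m}. (\<forall>s\<in>{0..T}. \<bar>Y j s \<omega>\<bar> \<le> a \<omega>) \<and> (\<forall>s\<in>{0..T}. \<bar>\<gamma> i j s \<omega>\<bar> \<le> c (i, j) \<omega>)"
    proof (rule AE_finite_allI)
      fix j assume j: "j \<in> {1..m}"
      have "AE \<omega> in M. \<forall>s\<in>{0..T}. \<bar>\<gamma> i j s \<omega>\<bar> \<le> c (i, j) \<omega>"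
        using c(4)[of "(i, j)"] i j by (simp add: dominated_def)
      with domY[OF j] show "AE \<omega> in M. (\<forall>s\<in>{0..T}. \<bar>Y j s \<omega>\<bar> \<le> a \<omega>) \<and> (\<forall>s\<in>{0..T}. \<bar>\<gamma> i j s \<omega>\<bar> \<le> c (i, j) \<omega>)"
        by eventually_elim simp
    qed simp
    then show ?thesis
      unfolding dominated_def
    proof (eventually_elim, intro ballI)
      fix \<omega> s assume *: "\<forall>j\<in>{1..m}. (\<forall>s\<in>{0..T}. \<bar>Y j s \<omega>\<bar> \<le> a \<omega>) \<and> (\<forall>s\<in>{0..T}. \<bar>\<gamma> i j s \<omega>\<bar> \<le> c (i, j) \<omega>)"
        and s: "s \<in> {0..T}"
      obtain j where j: "j \<in> {1..m}" "L i s \<omega> = Y j s \<omega> - \<gamma> i j s \<omega>" by (rule L_attained)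
      have "\<bar>Y j s \<omega>\<bar> \<le> a \<omega>" "\<bar>\<gamma> i j s \<omega>\<bar> \<le> c (i, j) \<omega>" using * j s by blast+
      then show "\<bar>L i s \<omega>\<bar> \<le> \<xi> \<omega>" using cb[OF i j(1), of \<omega>] pos[of \<omega>] unfolding \<xi>eq j(2) by linarith
    qed
  qed
  have domX: "dominated (X i) \<xi>" if i: "i \<in> {1..m}" for i
  proof -
    have "AE \<omega> in M. \<forall>s\<in>{0..T}. \<bar>\<Psi> i s \<omega>\<bar> \<le> \<theta> i \<omega>"
      using space_M2_square_integral(1)[OF psi_M2[OF i]]
    proof (eventually_elim, intro ballI)
      fix \<omega> s assume int: "set_integrable lborel {0..T} (\<lambda>u. \<psi> i u \<omega>)" and s: "s \<in> {0..T}"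
      have "\<bar>LINT u:{0..s}|lborel. \<psi> i u \<omega>\<bar> \<le> (LINT u:{0..s}|lborel. \<bar>\<psi> i u \<omega>\<bar>)"
        using set_integral_norm_bound[OF set_integrable_subset[OF int, of "{0..s}"]] s by simp
      also have "\<dots> \<le> (LINT u:{0..T}|lborel. \<bar>\<psi> i u \<omega>\<bar>)"
        unfolding set_lebesgue_integral_def
      proof (rule integral_mono)
        show "integrable lborel (\<lambda>u. indicator {0..T} u *\<^sub>R \<bar>\<psi> i u \<omega>\<bar>)"
          using set_integrable_abs[OF int] by (simp add: set_integrable_def)
        show "integrable lborel (\<lambda>u. indicator {0..s} u *\<^sub>R \<bar>\<psi> i u \<omega>\<bar>)"
          using set_integrable_abs[OF set_integrable_subset[OF int, of "{0..s}"]] s by (simp add: set_integrable_def)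
      qed (use s in \<open>auto simp: indicator_def\<close>)
      finally show "\<bar>\<Psi> i s \<omega>\<bar> \<le> \<theta> i \<omega>" unfolding integral_process_def \<theta>_def .
    qed
    then show ?thesis
      unfolding dominated_def using domY[OF i]
    proof (eventually_elim, intro ballI)
      fix \<omega> s assume "\<forall>s\<in>{0..T}. \<bar>\<Psi> i s \<omega>\<bar> \<le> \<theta> i \<omega>" "\<forall>s\<in>{0..T}. \<bar>Y i s \<omega>\<bar> \<le> a \<omega>" "s \<in> {0..T}"
      then have "\<bar>\<Psi> i s \<omega>\<bar> \<le> \<theta> i \<omega>" "\<bar>Y i s \<omega>\<bar> \<le> a \<omega>" by blast+
      then show "\<bar>X i s \<omega>\<bar> \<le> \<xi> \<omega>" using te[OF i, of \<omega>] pos[of \<omega>] unfolding \<xi>eq X_def by linarith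
    qed
  qed
  have "dominated (Y i) \<xi>" if "i \<in> {1..m}" for i
    unfolding dominated_def using domY[OF that]
  proof (eventually_elim, intro ballI)
    fix \<omega> s assume "\<forall>s\<in>{0..T}. \<bar>Y i s \<omega>\<bar> \<le> a \<omega>" "s \<in> {0..T}"
    then have "\<bar>Y i s \<omega>\<bar> \<le> a \<omega>" by blast
    then show "\<bar>Y i s \<omega>\<bar> \<le> \<xi> \<omega>" using pos[of \<omega>] unfolding \<xi>eq by linarith
  qed
  moreover have "integrable M (\<lambda>\<omega>. (\<xi> \<omega>)\<^sup>2)"
    unfolding \<xi>_def using sq by (intro integrable_square_add borel_measurable_add) simp_all
  moreover have "\<xi> \<in> borel_measurable M" unfolding \<xi>eq by measurable
  moreover have "0 \<le> \<xi> \<omega>" "total_variation T \<omega> \<le> \<xi> \<omega>" for \<omega>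
    using pos[of \<omega>] unfolding \<xi>eq total_variation_def e_def \<theta>_def by simp_all
  ultimately show ?thesis using domL domX by blast
qed

definition \<xi> :: "'a \<Rightarrow> real" where
  "\<xi> = (SOME \<xi>. \<xi> \<in> borel_measurable M \<and> (\<forall>\<omega>. 0 \<le> \<xi> \<omega>) \<and> integrable M (\<lambda>\<omega>. (\<xi> \<omega>)\<^sup>2) \<and>
    (\<forall>i\<in>{1..m}. dominated (Y i) \<xi> \<and> dominated (L i) \<xi> \<and> dominated (X i) \<xi>) \<and>
    (\<forall>\<omega>. total_variation T \<omega> \<le> \<xi> \<omega>))"

lemma \<xi>:
  shows \<xi>_measurable: "\<xi> \<in> borel_measurable M" and \<xi>_nonneg: "0 \<le> \<xi> \<omega>"
    and \<xi>_square: "integrable M (\<lambda>\<omega>. (\<xi> \<omega>)\<^sup>2)" and \<xi>_integrable: "integrable M \<xi>"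
    and dominated_Y: "i \<in> {1..m} \<Longrightarrow> dominated (Y i) \<xi>"
    and dominated_L: "i \<in> {1..m} \<Longrightarrow> dominated (L i) \<xi>"
    and dominated_X: "i \<in> {1..m} \<Longrightarrow> dominated (X i) \<xi>"
    and total_variation_le: "total_variation T \<omega> \<le> \<xi> \<omega>"
proof -
  note * = someI_ex[OF exists_bound, folded \<xi>_def]
  show "\<xi> \<in> borel_measurable M" "0 \<le> \<xi> \<omega>" "integrable M (\<lambda>\<omega>. (\<xi> \<omega>)\<^sup>2)"
    "i \<in> {1..m} \<Longrightarrow> dominated (Y i) \<xi>" "i \<in> {1..m} \<Longrightarrow> dominated (L i) \<xi>" "i \<in> {1..m} \<Longrightarrow> dominated (X i) \<xi>"
    "total_variation T \<omega> \<le> \<xi> \<omega>"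
    using * by blast+
  show "integrable M \<xi>" by (rule integrable_of_square) (use * in blast)+
qed

text \<open>Stopping at once is admissible, which gives the inequality at each fixed time before
  \<open>T\<close>; at \<open>T\<close> it is the terminal condition on \<open>\<Gamma>\<close>.
  Rational times and right-continuity merge the exceptional sets into one.\<close>

lemma Y_L_ge: "i \<in> {1..m} \<Longrightarrow> AE \<omega> in M. \<forall>s\<in>{0..T}. L i s \<omega> \<le> Y i s \<omega>"
proof -
  assume i: "i \<in> {1..m}"
  define Q where "Q = \<rat> \<inter> {0..<T}"
  have "countable Q" by (auto simp: Q_def countable_rat)
  moreover have "AE \<omega> in M. L i s \<omega> \<le> Y i s \<omega>" if "s \<in> Q" for s
  proof -
    have s: "s \<in> {0..T}" "s < T" using that by (auto simp: Q_def)
    interpret G: finite_measure_subalgebra M "F s" by unfold_locales (rule subalgebra_F)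
    have "stopping_reward T m \<psi> \<gamma> \<Gamma> Y i s (\<lambda>_. s) \<omega> = L i s \<omega>" for \<omega>
    proof -
      have "(LINT u:{s..s}|lborel. \<psi> i u \<omega>) = 0"
        using set_integral_Icc_Ioc(2)[of s s "\<lambda>u. \<psi> i u \<omega>"] by (simp add: set_integrable_def set_lebesgue_integral_def)
      then show ?thesis using s by (simp add: stopping_reward_def)
    qed
    then have eq: "stopping_reward T m \<psi> \<gamma> \<Gamma> Y i s (\<lambda>_. s) = L i s" by blast
    have "(\<lambda>_. s) \<in> stopping_times_from M F T (\<lambda>_. s)"
      using s bounded_times_stopping_times[OF bounded_times_const[OF s(1)]] by (auto simp: stopping_times_from_def)
    then have "real_cond_exp M (F s) (stopping_reward T m \<psi> \<gamma> \<Gamma> Y i s (\<lambda>_. s))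
      \<in> {real_cond_exp M (F s) (stopping_reward T m \<psi> \<gamma> \<Gamma> Y i s \<tau>) | \<tau>. \<tau> \<in> stopping_times_from M F T (\<lambda>_. s)}"
      by blast
    then have "AE \<omega> in M. real_cond_exp M (F s) (L i s) \<omega> \<le> Y i s \<omega>"
      using Y_ess_sup[OF i s(1)] unfolding is_ess_sup_def eq by (elim conjE) (drule (1) bspec)
    moreover have "AE \<omega> in M. real_cond_exp M (F s) (L i s) \<omega> = L i s \<omega>"
    proof (rule G.real_cond_exp_F_meas)
      show "L i s \<in> borel_measurable (F s)"
        using adapted_cadlagD(1)[OF space_Q_adapted[OF L_space_Q[OF i]] s(1)] .
      show "integrable M (L i s)"
        using integrable_stopped[OF space_Q_adapted[OF L_space_Q[OF i]] bounded_times_const[OF s(1)] dominated_L[OF i] \<xi>_integrable] .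
    qed
    ultimately show ?thesis by eventually_elim simp
  qed
  ultimately have "AE \<omega> in M. \<forall>s\<in>Q. L i s \<omega> \<le> Y i s \<omega>" by (simp add: AE_ball_countable)
  moreover have "AE \<omega> in M. \<forall>j\<in>{1..m}. Y j T \<omega> = \<Gamma> j \<omega>"
    using Y_terminal by (intro AE_finite_allI) auto
  moreover have "AE \<omega> in M. cadlag_on T (\<lambda>s. L i s \<omega>)" "AE \<omega> in M. cadlag_on T (\<lambda>s. Y i s \<omega>)"
    using adapted_cadlagD(2)[OF space_Q_adapted] L_space_Q[OF i] Y_spaces[OF i] by auto
  ultimately show ?thesis
    using Gamma_terminal[OF i]
  proof (eventually_elim, intro ballI)
    fix \<omega> s assume Q: "\<forall>s\<in>Q. L i s \<omega> \<le> Y i s \<omega>" and fin: "\<forall>j\<in>{1..m}. Y j T \<omega> = \<Gamma> j \<omega>"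
      and c: "cadlag_on T (\<lambda>s. L i s \<omega>)" "cadlag_on T (\<lambda>s. Y i s \<omega>)"
      and \<Gamma>: "\<Gamma> i \<omega> \<ge> Max ((\<lambda>j. \<Gamma> j \<omega> - \<gamma> i j T \<omega>) ` ({1..m} - {i}))" and s: "s \<in> {0..T}"
    show "L i s \<omega> \<le> Y i s \<omega>"
    proof (cases "s = T")
      case True
      have "L i T \<omega> = Max ((\<lambda>j. \<Gamma> j \<omega> - \<gamma> i j T \<omega>) ` ({1..m} - {i}))"
        unfolding switching_value_def using fin by (intro arg_cong[where f=Max] image_cong) auto
      moreover have "Y i T \<omega> = \<Gamma> i \<omega>" using fin i by blast
      ultimately show ?thesis unfolding True using \<Gamma> by (simp only:)
    next
      case False
      then have "s < T" using s by simp
      \<comment> \<open>The midpoint keeps the approximating times strictly below \<open>T\<close>,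
        where the comparison with immediate stopping was made.\<close>
      then obtain u where u: "\<And>n. u n \<in> \<rat>" "\<And>n. s < u n" "\<And>n. u n \<le> (s + T) / 2" "u \<longlonglongrightarrow> s"
        using rational_approx_right[of s "(s + T) / 2"] by auto
      have uT: "u n \<in> Q" "s \<le> u n" "u n \<le> T" for n
        using u(1,2,3)[of n] s \<open>s < T\<close> by (auto simp: Q_def)
      show ?thesis
      proof (rule LIMSEQ_le)
        show "(\<lambda>n. L i (u n) \<omega>) \<longlonglongrightarrow> L i s \<omega>" "(\<lambda>n. Y i (u n) \<omega>) \<longlonglongrightarrow> Y i s \<omega>"
          by (rule cadlag_on_tendsto_right[OF c(1) s u(4) uT(2,3)] cadlag_on_tendsto_right[OF c(2) s u(4) uT(2,3)])+
      qed (use Q uT(1) in auto)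
    qed
  qed
qed

text \<open>The reward counted from time \<open>0\<close>. It does not depend on the starting time
  of the stopping problem, so one stopping time can be compared with \<open>X i\<close> at several
  starting times; \<open>stopping_reward_AE\<close> gives the relation with
  \<open>stopping_reward\<close>.\<close>

definition stopped_value :: "nat \<Rightarrow> ('a \<Rightarrow> real) \<Rightarrow> 'a \<Rightarrow> real" where
  "stopped_value i \<theta> \<omega> = \<Psi> i (\<theta> \<omega>) \<omega> + \<Gamma> i \<omega> * of_bool (\<theta> \<omega> = T) + L i (\<theta> \<omega>) \<omega> * of_bool (\<theta> \<omega> < T)"

text \<open>The loss from stopping at \<open>\<theta>\<close>: the distance of \<open>Y i\<close>
  from the switching value before \<open>T\<close>, and nothing at \<open>T\<close> because of the
  terminal value of \<open>Y i\<close>.\<close>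

lemma stopped_value_eq_X:
  assumes i: "i \<in> {1..m}" and \<theta>: "\<theta> \<in> bounded_times"
  shows "AE \<omega> in M. X i (\<theta> \<omega>) \<omega> - stopped_value i \<theta> \<omega> = (Y i (\<theta> \<omega>) \<omega> - L i (\<theta> \<omega>) \<omega>) * of_bool (\<theta> \<omega> < T)"
  using Y_terminal[OF i]
proof eventually_elim
  case (elim \<omega>)
  then show ?case using bounded_timesD(3)[OF \<theta>, of \<omega>] by (cases "\<theta> \<omega> = T") (auto simp: X_def stopped_value_def)
qed

lemma stopped_value_integrable:
  assumes i: "i \<in> {1..m}" and \<theta>: "\<theta> \<in> bounded_times"
  shows "integrable M (stopped_value i \<theta>)"
proof -
  have [measurable]: "\<theta> \<in> borel_measurable M"
    by (rule measurable_stopping_time[OF bounded_timesD(1)[OF \<theta>] F_subset space_F])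
  have 1: "integrable M (\<lambda>\<omega>. X i (\<theta> \<omega>) \<omega>)" "integrable M (\<lambda>\<omega>. Y i (\<theta> \<omega>) \<omega>)" "integrable M (\<lambda>\<omega>. L i (\<theta> \<omega>) \<omega>)"
    by (rule integrable_stopped[OF space_Q_adapted[OF X_space_Q[OF i]] \<theta> dominated_X[OF i] \<xi>_integrable]
        integrable_stopped[OF space_Q_adapted[OF Y_spaces(1)[OF i]] \<theta> dominated_Y[OF i] \<xi>_integrable]
        integrable_stopped[OF space_Q_adapted[OF L_space_Q[OF i]] \<theta> dominated_L[OF i] \<xi>_integrable])+
  define B where "B = {\<omega> \<in> space M. \<theta> \<omega> < T}"
  have B: "B \<in> sets M" unfolding B_def by measurable
  have g: "integrable M (\<lambda>\<omega>. X i (\<theta> \<omega>) \<omega> - indicator B \<omega> * (Y i (\<theta> \<omega>) \<omega> - L i (\<theta> \<omega>) \<omega>))" (is "integrable M ?g")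
    using 1 by (intro Bochner_Integration.integrable_diff integrable_indicator_times B) auto
  have ae: "AE \<omega> in M. ?g \<omega> = stopped_value i \<theta> \<omega>"
    using stopped_value_eq_X[OF i \<theta>] AE_space by eventually_elim (auto simp: B_def indicator_def)
  have "stopped_value i \<theta> \<in> borel_measurable M"
    using borel_measurable_AE_cong[OF borel_measurable_integrable[OF g] ae] .
  from integrable_cong_AE_imp[OF g this ae] show ?thesis .
qed

definition later_times :: "real \<Rightarrow> ('a \<Rightarrow> real) set" where
  "later_times t = {\<theta> \<in> bounded_times. \<forall>\<omega>. t \<le> \<theta> \<omega>}"

lemma later_times_clip:
  assumes t: "t \<in> {0..T}" and \<theta>: "\<theta> \<in> stopping_times_from M F T (\<lambda>_. t)"
  shows "(\<lambda>\<omega>. max t (min T (\<theta> \<omega>))) \<in> later_times t" "AE \<omega> in M. max t (min T (\<theta> \<omega>)) = \<theta> \<omega>"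
proof -
  have "stopping_time F (\<lambda>\<omega>. max t (min T (\<theta> \<omega>)))"
    using \<theta> by (intro stopping_time_max stopping_time_min stopping_time_const)
      (auto simp: stopping_times_from_def stopping_times_def)
  then show "(\<lambda>\<omega>. max t (min T (\<theta> \<omega>))) \<in> later_times t"
    using t by (auto simp: later_times_def intro!: bounded_timesI)
  have "AE \<omega> in M. t \<le> \<theta> \<omega>" "AE \<omega> in M. 0 \<le> \<theta> \<omega> \<and> \<theta> \<omega> \<le> T"
    using \<theta> by (auto simp: stopping_times_from_def stopping_times_def)
  then show "AE \<omega> in M. max t (min T (\<theta> \<omega>)) = \<theta> \<omega>" by eventually_elim auto
qed

lemma later_times_stopping_times_from: "\<theta> \<in> later_times t \<Longrightarrow> \<theta> \<in> stopping_times_from M F T (\<lambda>_. t)"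
  using bounded_times_stopping_times[of \<theta>] by (auto simp: later_times_def stopping_times_from_def)

lemma integrable_\<Psi>:
  assumes i: "i \<in> {1..m}" and t: "t \<in> {0..T}"
  shows "integrable M (\<Psi> i t)"
proof -
  have "integrable M (\<lambda>\<omega>. X i t \<omega> - Y i t \<omega>)"
    using integrable_stopped[OF space_Q_adapted[OF X_space_Q[OF i]] bounded_times_const[OF t] dominated_X[OF i] \<xi>_integrable]
      integrable_stopped[OF space_Q_adapted[OF Y_spaces(1)[OF i]] bounded_times_const[OF t] dominated_Y[OF i] \<xi>_integrable]
    by (rule Bochner_Integration.integrable_diff)
  then show ?thesis by (simp add: X_def)
qed

lemma integrable_X_stopped: "i \<in> {1..m} \<Longrightarrow> \<sigma> \<in> bounded_times \<Longrightarrow> integrable M (\<lambda>\<omega>. X i (\<sigma> \<omega>) \<omega>)"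
  by (rule integrable_stopped[OF space_Q_adapted[OF X_space_Q] _ dominated_X \<xi>_integrable])

lemma stopping_reward_AE:
  assumes i: "i \<in> {1..m}" and t: "t \<in> {0..T}" and \<theta>: "\<theta> \<in> later_times t"
  shows "AE \<omega> in M. stopped_value i \<theta> \<omega> - \<Psi> i t \<omega> = stopping_reward T m \<psi> \<gamma> \<Gamma> Y i t \<theta> \<omega>"
  using space_M2_square_integral(1)[OF psi_M2[OF i]]
proof eventually_elim
  case (elim \<omega>)
  have "0 \<le> t" "t \<le> \<theta> \<omega>" "\<theta> \<omega> \<le> T"
    using t \<theta> bounded_timesD(3)[of \<theta> \<omega>] by (auto simp: later_times_def)
  note * = integral_process_diff[where \<psi>="\<psi> i" and \<omega>=\<omega>, OF elim this]
  have "(LINT u:{t..\<theta> \<omega>}|lborel. \<psi> i u \<omega>) = \<Psi> i (\<theta> \<omega>) \<omega> - \<Psi> i t \<omega>"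
    using set_integral_Icc_Ioc(2)[OF \<open>t \<le> \<theta> \<omega>\<close> *(1)] *(2) by simp
  then show ?case by (simp add: stopped_value_def stopping_reward_def)
qed

lemma stopping_reward_integrable:
  assumes i: "i \<in> {1..m}" and t: "t \<in> {0..T}" and \<theta>: "\<theta> \<in> later_times t"
  shows "integrable M (stopping_reward T m \<psi> \<gamma> \<Gamma> Y i t \<theta>)"
    and "expectation (stopping_reward T m \<psi> \<gamma> \<Gamma> Y i t \<theta>) = expectation (stopped_value i \<theta>) - expectation (\<Psi> i t)"
proof -
  have b: "\<theta> \<in> bounded_times" using \<theta> by (simp add: later_times_def)
  have g: "integrable M (\<lambda>\<omega>. stopped_value i \<theta> \<omega> - \<Psi> i t \<omega>)"
    using stopped_value_integrable[OF i b] integrable_\<Psi>[OF i t] by simp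
  note ae = stopping_reward_AE[OF assms]
  have meas: "stopping_reward T m \<psi> \<gamma> \<Gamma> Y i t \<theta> \<in> borel_measurable M"
    using borel_measurable_AE_cong[OF borel_measurable_integrable[OF g] ae] .
  show "integrable M (stopping_reward T m \<psi> \<gamma> \<Gamma> Y i t \<theta>)"
    by (rule integrable_cong_AE_imp[OF g meas ae])
  have "expectation (\<lambda>\<omega>. stopped_value i \<theta> \<omega> - \<Psi> i t \<omega>) = expectation (stopping_reward T m \<psi> \<gamma> \<Gamma> Y i t \<theta>)"
    by (rule integral_cong_AE[OF borel_measurable_integrable[OF g] meas ae])
  then show "expectation (stopping_reward T m \<psi> \<gamma> \<Gamma> Y i t \<theta>) = expectation (stopped_value i \<theta>) - expectation (\<Psi> i t)"
    using stopped_value_integrable[OF i b] integrable_\<Psi>[OF i t] by simp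
qed

lemma cond_exp_reward_le:
  assumes i: "i \<in> {1..m}" and t: "t \<in> {0..T}" and \<theta>: "\<theta> \<in> later_times t"
  shows "AE \<omega> in M. real_cond_exp M (F t) (stopping_reward T m \<psi> \<gamma> \<Gamma> Y i t \<theta>) \<omega> \<le> Y i t \<omega>"
proof -
  have "real_cond_exp M (F t) (stopping_reward T m \<psi> \<gamma> \<Gamma> Y i t \<theta>)
      \<in> {real_cond_exp M (F t) (stopping_reward T m \<psi> \<gamma> \<Gamma> Y i t \<tau>) | \<tau>. \<tau> \<in> stopping_times_from M F T (\<lambda>_. t)}"
    using later_times_stopping_times_from[OF \<theta>] by blast
  then show ?thesis
    using Y_ess_sup[OF i t] unfolding is_ess_sup_def by (elim conjE) (drule (1) bspec)
qed

text \<open>The upper-bound half of the essential supremum, integrated over an event of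
  \<open>F t\<close>. Adding the profit up to \<open>t\<close> on both sides turns
  \<open>Y i t\<close> into \<open>X i t\<close>.\<close>

lemma stopped_value_le:
  assumes i: "i \<in> {1..m}" and t: "t \<in> {0..T}" and \<theta>: "\<theta> \<in> later_times t" and A: "A \<in> sets (F t)"
  shows "expectation (\<lambda>\<omega>. indicator A \<omega> * stopped_value i \<theta> \<omega>) \<le> expectation (\<lambda>\<omega>. indicator A \<omega> * X i t \<omega>)"
proof -
  interpret G: finite_measure_subalgebra M "F t" by unfold_locales (rule subalgebra_F)
  have AM: "A \<in> sets M" using A F_subset by blast
  have b: "\<theta> \<in> bounded_times" using \<theta> by (simp add: later_times_def)
  define R where "R = stopping_reward T m \<psi> \<gamma> \<Gamma> Y i t \<theta>"
  have R: "integrable M R" unfolding R_def by (rule stopping_reward_integrable(1)[OF i t \<theta>])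
  have Yint: "integrable M (Y i t)"
    using integrable_stopped[OF space_Q_adapted[OF Y_spaces(1)[OF i]] bounded_times_const[OF t] dominated_Y[OF i] \<xi>_integrable] by simp
  have "expectation (\<lambda>\<omega>. indicator A \<omega> * R \<omega>) = expectation (\<lambda>\<omega>. indicator A \<omega> * real_cond_exp M (F t) R \<omega>)"
    using G.real_cond_exp_intA[OF R A] by (simp add: set_lebesgue_integral_def)
  also have "\<dots> \<le> expectation (\<lambda>\<omega>. indicator A \<omega> * Y i t \<omega>)"
  proof (rule integral_mono_AE)
    show "AE \<omega> in M. indicator A \<omega> * real_cond_exp M (F t) R \<omega> \<le> indicator A \<omega> * Y i t \<omega>"
      using cond_exp_reward_le[OF i t \<theta>] unfolding R_def by eventually_elim (auto simp: indicator_def)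
  qed (use integrable_indicator_times[OF AM] G.real_cond_exp_int(1)[OF R] Yint in auto)
  finally have le: "expectation (\<lambda>\<omega>. indicator A \<omega> * R \<omega>) \<le> expectation (\<lambda>\<omega>. indicator A \<omega> * Y i t \<omega>)" .
  have "expectation (\<lambda>\<omega>. indicator A \<omega> * stopped_value i \<theta> \<omega>)
      = expectation (\<lambda>\<omega>. indicator A \<omega> * R \<omega> + indicator A \<omega> * \<Psi> i t \<omega>)"
  proof (rule integral_cong_AE)
    show "AE \<omega> in M. indicator A \<omega> * stopped_value i \<theta> \<omega> = indicator A \<omega> * R \<omega> + indicator A \<omega> * \<Psi> i t \<omega>"
      using stopping_reward_AE[OF i t \<theta>] unfolding R_def
      by eventually_elim (auto simp: indicator_def)
  qed (use AM R integrable_\<Psi>[OF i t] stopped_value_integrable[OF i b] in \<open>auto dest: borel_measurable_integrable\<close>)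
  also have "\<dots> = expectation (\<lambda>\<omega>. indicator A \<omega> * R \<omega>) + expectation (\<lambda>\<omega>. indicator A \<omega> * \<Psi> i t \<omega>)"
    using integrable_indicator_times[OF AM] R integrable_\<Psi>[OF i t] by (intro Bochner_Integration.integral_add) auto
  also have "\<dots> \<le> expectation (\<lambda>\<omega>. indicator A \<omega> * Y i t \<omega>) + expectation (\<lambda>\<omega>. indicator A \<omega> * \<Psi> i t \<omega>)"
    using le by simp
  also have "\<dots> = expectation (\<lambda>\<omega>. indicator A \<omega> * Y i t \<omega> + indicator A \<omega> * \<Psi> i t \<omega>)"
    using integrable_indicator_times[OF AM] Yint integrable_\<Psi>[OF i t] by (intro Bochner_Integration.integral_add[symmetric]) auto
  also have "\<dots> = expectation (\<lambda>\<omega>. indicator A \<omega> * X i t \<omega>)"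
    by (simp add: X_def distrib_left)
  finally show ?thesis .
qed

text \<open>Both times are at least \<open>t\<close>, so the event \<open>B\<close> is known before
  either of them occurs.\<close>

lemma later_times_paste:
  assumes t: "t \<in> {0..T}" and ab: "a \<in> later_times t" "b \<in> later_times t" and B: "B \<in> sets (F t)"
  shows "(\<lambda>\<omega>. if \<omega> \<in> B then a \<omega> else b \<omega>) \<in> later_times t"
proof -
  let ?c = "\<lambda>\<omega>. if \<omega> \<in> B then a \<omega> else b \<omega>"
  have "stopping_time F ?c"
    unfolding stopping_time_iff
  proof
    fix s
    show "{\<omega> \<in> space M. ?c \<omega> \<le> s} \<in> sets (F s)"
    proof (cases "t \<le> s")
      case True
      have *: "{\<omega> \<in> space M. a \<omega> \<le> s} \<in> sets (F s)" "{\<omega> \<in> space M. b \<omega> \<le> s} \<in> sets (F s)" "B \<in> sets (F s)"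
        using ab B sets_F_mono[OF True] by (simp_all add: later_times_def bounded_times_def stopping_time_iff subset_iff)
      have "(B \<inter> {\<omega> \<in> space M. a \<omega> \<le> s}) \<union> ({\<omega> \<in> space M. b \<omega> \<le> s} - B) \<in> sets (F s)"
        using * by blast
      also have "(B \<inter> {\<omega> \<in> space M. a \<omega> \<le> s}) \<union> ({\<omega> \<in> space M. b \<omega> \<le> s} - B) = {\<omega> \<in> space M. ?c \<omega> \<le> s}"
        by auto
      finally show ?thesis .
    next
      case False
      have "t \<le> ?c \<omega>" for \<omega> using ab by (auto simp: later_times_def)
      then have "\<not> ?c \<omega> \<le> s" for \<omega> using False order_trans by blast
      then have "{\<omega> \<in> space M. ?c \<omega> \<le> s} = {}" by blast
      then show ?thesis by (rule ssubst) (rule sets.empty_sets)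
    qed
  qed
  then show ?thesis using ab by (auto simp: later_times_def bounded_times_def)
qed

text \<open>Follow whichever of the two times has the larger conditional reward; this choice is an
  event of \<open>F t\<close>. The reward at a point depends on the stopping time only through its
  value there, so pasting the times pastes the rewards, and the indicators can be pulled out of the
  conditional expectation.\<close>

lemma reward_directed:
  assumes i: "i \<in> {1..m}" and t: "t \<in> {0..T}" and ab: "a \<in> later_times t" "b \<in> later_times t"
  defines "C \<equiv> \<lambda>\<theta>. real_cond_exp M (F t) (stopping_reward T m \<psi> \<gamma> \<Gamma> Y i t \<theta>)"
  shows "\<exists>c\<in>later_times t. AE \<omega> in M. C c \<omega> = max (C a \<omega>) (C b \<omega>)"
proof -
  interpret G: finite_measure_subalgebra M "F t" by unfold_locales (rule subalgebra_F)
  have [measurable]: "C \<theta> \<in> borel_measurable (F t)" for \<theta> unfolding C_def by (rule borel_measurable_cond_exp)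
  define B where "B = {\<omega> \<in> space (F t). C b \<omega> \<le> C a \<omega>}"
  have B: "B \<in> sets (F t)" unfolding B_def by measurable
  then have BM: "B \<in> sets M" using F_subset by blast
  define B' where "B' = space (F t) - B"
  have B': "B' \<in> sets (F t)" unfolding B'_def by (rule sets.compl_sets[OF B])
  then have B'M: "B' \<in> sets M" using F_subset by blast
  define c where "c = (\<lambda>\<omega>. if \<omega> \<in> B then a \<omega> else b \<omega>)"
  have c: "c \<in> later_times t" unfolding c_def by (rule later_times_paste[OF t ab B])
  let ?R = "stopping_reward T m \<psi> \<gamma> \<Gamma> Y i t"
  have R: "integrable M (?R \<theta>)" if "\<theta> \<in> later_times t" for \<theta>
    using stopping_reward_integrable(1)[OF i t that] .
  have int: "integrable M (\<lambda>\<omega>. indicator B \<omega> * ?R a \<omega>)" "integrable M (\<lambda>\<omega>. indicator B' \<omega> * ?R b \<omega>)"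
    using R ab BM B'M by (auto intro!: integrable_indicator_times)
  have "AE \<omega> in M. C c \<omega> = real_cond_exp M (F t) (\<lambda>\<omega>. indicator B \<omega> * ?R a \<omega> + indicator B' \<omega> * ?R b \<omega>) \<omega>"
    unfolding C_def
  proof (rule G.real_cond_exp_cong)
    show "AE \<omega> in M. ?R c \<omega> = indicator B \<omega> * ?R a \<omega> + indicator B' \<omega> * ?R b \<omega>"
      by (rule AE_I2) (auto simp: c_def stopping_reward_def B'_def space_F)
  qed (use R[OF c] int in \<open>auto intro: borel_measurable_integrable\<close>)
  moreover have "AE \<omega> in M. real_cond_exp M (F t) (\<lambda>\<omega>. indicator B \<omega> * ?R a \<omega> + indicator B' \<omega> * ?R b \<omega>) \<omega>
      = real_cond_exp M (F t) (\<lambda>\<omega>. indicator B \<omega> * ?R a \<omega>) \<omega> + real_cond_exp M (F t) (\<lambda>\<omega>. indicator B' \<omega> * ?R b \<omega>) \<omega>"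
    by (rule G.real_cond_exp_add[OF int])
  moreover have "AE \<omega> in M. real_cond_exp M (F t) (\<lambda>\<omega>. indicator B \<omega> * ?R a \<omega>) \<omega> = indicator B \<omega> * C a \<omega>"
    unfolding C_def using B R[OF ab(1)] int by (intro G.real_cond_exp_mult) (auto intro: borel_measurable_integrable)
  moreover have "AE \<omega> in M. real_cond_exp M (F t) (\<lambda>\<omega>. indicator B' \<omega> * ?R b \<omega>) \<omega> = indicator B' \<omega> * C b \<omega>"
    unfolding C_def using B' R[OF ab(2)] int by (intro G.real_cond_exp_mult) (auto intro: borel_measurable_integrable)
  ultimately have "AE \<omega> in M. C c \<omega> = max (C a \<omega>) (C b \<omega>)"
    using AE_space
  proof eventually_elim
    case (elim \<omega>)
    then have "C c \<omega> = indicator B \<omega> * C a \<omega> + indicator B' \<omega> * C b \<omega>" by simp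
    then show ?case using elim(5) by (cases "\<omega> \<in> B") (auto simp: B_def B'_def space_F max_def)
  qed
  then show ?thesis using c by blast
qed

text \<open>Clipping changes an admissible time only on a null set, so restricting the family to
  \<open>later_times\<close> leaves its almost sure upper bounds the same. The directed family is
  then approximated in mean.\<close>

lemma stopped_value_near_optimal:
  assumes i: "i \<in> {1..m}" and t: "t \<in> {0..T}" and \<epsilon>: "0 < \<epsilon>"
  shows "\<exists>\<theta>\<in>later_times t. expectation (X i t) \<le> expectation (stopped_value i \<theta>) + \<epsilon>"
proof -
  interpret G: finite_measure_subalgebra M "F t" by unfold_locales (rule subalgebra_F)
  let ?R = "stopping_reward T m \<psi> \<gamma> \<Gamma> Y i t"
  have Yint: "integrable M (Y i t)"
    using integrable_stopped[OF space_Q_adapted[OF Y_spaces(1)[OF i]] bounded_times_const[OF t] dominated_Y[OF i] \<xi>_integrable] by simp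
  have sup: "is_ess_sup M {real_cond_exp M (F t) (?R \<theta>) | \<theta>. \<theta> \<in> later_times t} (Y i t)"
    unfolding is_ess_sup_def
  proof (intro conjI ballI impI)
    show "Y i t \<in> borel_measurable M" using Yint by simp
    show "AE \<omega> in M. f \<omega> \<le> Y i t \<omega>" if "f \<in> {real_cond_exp M (F t) (?R \<theta>) | \<theta>. \<theta> \<in> later_times t}" for f
      using that cond_exp_reward_le[OF i t] by auto
    fix W assume W: "W \<in> borel_measurable M"
      "\<forall>f\<in>{real_cond_exp M (F t) (?R \<theta>) | \<theta>. \<theta> \<in> later_times t}. AE \<omega> in M. f \<omega> \<le> W \<omega>"
    have "AE \<omega> in M. real_cond_exp M (F t) (?R \<theta>) \<omega> \<le> W \<omega>" if \<theta>: "\<theta> \<in> stopping_times_from M F T (\<lambda>_. t)" for \<theta>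
    proof -
      define \<theta>' where "\<theta>' = (\<lambda>\<omega>. max t (min T (\<theta> \<omega>)))"
      have \<theta>': "\<theta>' \<in> later_times t" "AE \<omega> in M. \<theta>' \<omega> = \<theta> \<omega>"
        using later_times_clip[OF t \<theta>] by (auto simp: \<theta>'_def)
      have meas: "?R \<theta>' \<in> borel_measurable M"
        using stopping_reward_integrable(1)[OF i t \<theta>'(1)] by simp
      have ae: "AE \<omega> in M. ?R \<theta>' \<omega> = ?R \<theta> \<omega>"
        using \<theta>'(2) by eventually_elim (simp add: stopping_reward_def)
      have "AE \<omega> in M. real_cond_exp M (F t) (?R \<theta>') \<omega> = real_cond_exp M (F t) (?R \<theta>) \<omega>"
        by (rule G.real_cond_exp_cong[OF ae meas borel_measurable_AE_cong[OF meas ae]])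
      moreover have "AE \<omega> in M. real_cond_exp M (F t) (?R \<theta>') \<omega> \<le> W \<omega>"
        using W(2) \<theta>'(1) by blast
      ultimately show ?thesis by eventually_elim simp
    qed
    then have "\<forall>f\<in>{real_cond_exp M (F t) (?R \<tau>) | \<tau>. \<tau> \<in> stopping_times_from M F T (\<lambda>_. t)}. AE \<omega> in M. f \<omega> \<le> W \<omega>"
      by auto
    then show "AE \<omega> in M. Y i t \<omega> \<le> W \<omega>"
      using Y_ess_sup[OF i t] W(1) unfolding is_ess_sup_def by (elim conjE) (drule (1) bspec, drule (1) mp)
  qed
  have ne: "later_times t \<noteq> {}"
    using bounded_times_const[OF t] by (auto simp: later_times_def)
  obtain \<theta> where \<theta>: "\<theta> \<in> later_times t" "expectation (Y i t) \<le> expectation (?R \<theta>) + \<epsilon>"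
    using ess_sup_directed_approx[OF subalgebra_F sup Yint ne stopping_reward_integrable(1)[OF i t] reward_directed[OF i t] \<epsilon>]
    by blast
  have "expectation (X i t) = expectation (Y i t) + expectation (\<Psi> i t)"
    unfolding X_def[abs_def] using Yint integrable_\<Psi>[OF i t] by simp
  then show ?thesis using \<theta> stopping_reward_integrable(2)[OF i t \<theta>(1)] by (intro bexI[of _ \<theta>]) auto
qed

text \<open>Take a nearly optimal time after \<open>u\<close>. On \<open>A\<close> it competes at
  the earlier time \<open>s\<close>, where it is admissible as well; on the complement it competes
  at \<open>u\<close>. Adding the two inequalities and cancelling the complement leaves the claim up
  to an arbitrarily small error.\<close>

lemma X_supermartingale_const:
  assumes i: "i \<in> {1..m}" and su: "0 \<le> s" "s \<le> u" "u \<le> T" and A: "A \<in> sets (F s)"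
  shows "expectation (\<lambda>\<omega>. indicator A \<omega> * (X i u \<omega> - X i s \<omega>)) \<le> 0"
proof -
  have s: "s \<in> {0..T}" "u \<in> {0..T}" using su by auto
  have AM: "A \<in> sets M" and Au: "space M - A \<in> sets (F u)"
    using A F_subset sets_F_mono[OF su(2)] sets.compl_sets[of A "F u"] by (auto simp: space_F)
  have AM': "space M - A \<in> sets M" using AM by auto
  have Xint: "integrable M (X i s)" "integrable M (X i u)"
    using integrable_X_stopped[OF i bounded_times_const] s by auto
  have le: "expectation (\<lambda>\<omega>. indicator A \<omega> * X i u \<omega>) \<le> expectation (\<lambda>\<omega>. indicator A \<omega> * X i s \<omega>) + e" if e: "0 < e" for e
  proof -
    obtain \<theta> where \<theta>: "\<theta> \<in> later_times u" "expectation (X i u) \<le> expectation (stopped_value i \<theta>) + e"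
      using stopped_value_near_optimal[OF i s(2) e] by blast
    have V: "integrable M (stopped_value i \<theta>)" using stopped_value_integrable[OF i] \<theta>(1) by (simp add: later_times_def)
    have split: "expectation f = expectation (\<lambda>\<omega>. indicator A \<omega> * f \<omega>) + expectation (\<lambda>\<omega>. indicator (space M - A) \<omega> * f \<omega>)"
      if f: "integrable M f" for f :: "'a \<Rightarrow> real"
    proof -
      have "expectation f = expectation (\<lambda>\<omega>. indicator A \<omega> * f \<omega> + indicator (space M - A) \<omega> * f \<omega>)"
        by (rule Bochner_Integration.integral_cong) (auto simp: indicator_def)
      then show ?thesis
        using integrable_indicator_times[OF AM f] integrable_indicator_times[OF AM' f] by simp
    qed
    have "\<theta> \<in> later_times s" using \<theta>(1) su by (auto simp: later_times_def intro: order_trans)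
    then have "expectation (\<lambda>\<omega>. indicator A \<omega> * stopped_value i \<theta> \<omega>) \<le> expectation (\<lambda>\<omega>. indicator A \<omega> * X i s \<omega>)"
      using stopped_value_le[OF i s(1) _ A] by blast
    moreover have "expectation (\<lambda>\<omega>. indicator (space M - A) \<omega> * stopped_value i \<theta> \<omega>) \<le> expectation (\<lambda>\<omega>. indicator (space M - A) \<omega> * X i u \<omega>)"
      using stopped_value_le[OF i s(2) \<theta>(1) Au] .
    ultimately show ?thesis using \<theta>(2) split[OF V] split[OF Xint(2)] by linarith
  qed
  have "expectation (\<lambda>\<omega>. indicator A \<omega> * X i u \<omega>) \<le> expectation (\<lambda>\<omega>. indicator A \<omega> * X i s \<omega>)"
    by (rule field_le_epsilon) (rule le)
  moreover have "expectation (\<lambda>\<omega>. indicator A \<omega> * (X i u \<omega> - X i s \<omega>)) =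
      expectation (\<lambda>\<omega>. indicator A \<omega> * X i u \<omega>) - expectation (\<lambda>\<omega>. indicator A \<omega> * X i s \<omega>)"
    using integrable_indicator_times[OF AM] Xint by (simp add: right_diff_distrib)
  ultimately show ?thesis by linarith
qed

lemma X_supermartingale:
  assumes i: "i \<in> {1..m}" and "\<sigma> \<in> bounded_times" "\<tau> \<in> bounded_times" "\<And>\<omega>. \<sigma> \<omega> \<le> \<tau> \<omega>" "A \<in> sets (pre_sigma \<sigma>)"
  shows "expectation (\<lambda>\<omega>. indicator A \<omega> * (X i (\<tau> \<omega>) \<omega> - X i (\<sigma> \<omega>) \<omega>)) \<le> 0"
  by (rule optional_sampling[OF space_Q_adapted[OF X_space_Q[OF i]] dominated_X[OF i] \<xi>_integrable
        X_supermartingale_const[OF i] assms(2-5)])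

lemma X_supermartingale_expectation:
  assumes i: "i \<in> {1..m}" and \<sigma>: "\<sigma> \<in> bounded_times" and \<tau>: "\<tau> \<in> bounded_times" and le: "\<And>\<omega>. \<sigma> \<omega> \<le> \<tau> \<omega>"
  shows "expectation (\<lambda>\<omega>. X i (\<tau> \<omega>) \<omega>) \<le> expectation (\<lambda>\<omega>. X i (\<sigma> \<omega>) \<omega>)"
proof -
  have "expectation (\<lambda>\<omega>. indicator (space M) \<omega> * (X i (\<tau> \<omega>) \<omega> - X i (\<sigma> \<omega>) \<omega>)) \<le> 0"
    using sets.top[of "pre_sigma \<sigma>"] by (intro X_supermartingale assms) (simp add: space_pre_sigma)
  also have "expectation (\<lambda>\<omega>. indicator (space M) \<omega> * (X i (\<tau> \<omega>) \<omega> - X i (\<sigma> \<omega>) \<omega>)) = expectation (\<lambda>\<omega>. X i (\<tau> \<omega>) \<omega> - X i (\<sigma> \<omega>) \<omega>)"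
    by (rule Bochner_Integration.integral_cong) auto
  finally show ?thesis using integrable_X_stopped[OF i] \<sigma> \<tau> by simp
qed

text \<open>Over \<open>A\<close> and over its complement the increment has nonpositive expectation,
  and the two add up to something nonnegative, so both vanish. Martingale properties thus reduce to
  a single comparison of expectations.\<close>

lemma X_martingale_of_expectation:
  assumes i: "i \<in> {1..m}" and \<sigma>: "\<sigma> \<in> bounded_times" and \<tau>: "\<tau> \<in> bounded_times" and le: "\<And>\<omega>. \<sigma> \<omega> \<le> \<tau> \<omega>"
    and exp: "expectation (\<lambda>\<omega>. X i (\<sigma> \<omega>) \<omega>) \<le> expectation (\<lambda>\<omega>. X i (\<tau> \<omega>) \<omega>)" and A: "A \<in> sets (pre_sigma \<sigma>)"
  shows "expectation (\<lambda>\<omega>. indicator A \<omega> * (X i (\<tau> \<omega>) \<omega> - X i (\<sigma> \<omega>) \<omega>)) = 0"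
proof -
  let ?d = "\<lambda>\<omega>. X i (\<tau> \<omega>) \<omega> - X i (\<sigma> \<omega>) \<omega>"
  have A': "space M - A \<in> sets (pre_sigma \<sigma>)"
    using sets.compl_sets[OF A] by (simp add: space_pre_sigma)
  have AM: "A \<in> sets M" "space M - A \<in> sets M"
    using A A' subalgebra_pre_sigma[OF \<sigma>] by (auto simp: subalgebra_def)
  have d: "integrable M ?d" using integrable_X_stopped[OF i] \<sigma> \<tau> by simp
  have "0 \<le> expectation ?d" using exp integrable_X_stopped[OF i] \<sigma> \<tau> by simp
  also have "expectation ?d = expectation (\<lambda>\<omega>. indicator A \<omega> * ?d \<omega> + indicator (space M - A) \<omega> * ?d \<omega>)"
    by (rule Bochner_Integration.integral_cong) (auto simp: indicator_def)
  also have "\<dots> = expectation (\<lambda>\<omega>. indicator A \<omega> * ?d \<omega>) + expectation (\<lambda>\<omega>. indicator (space M - A) \<omega> * ?d \<omega>)"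
    by (intro Bochner_Integration.integral_add integrable_indicator_times AM d)
  finally show ?thesis
    using X_supermartingale[OF i \<sigma> \<tau> le A] X_supermartingale[OF i \<sigma> \<tau> le A'] by linarith
qed

end

section \<open>Hitting times\<close>

text \<open>Common form of the hitting times of \<open>Z = 0\<close> and of \<open>Z < c\<close>.
  The value \<open>T\<close> also stands for "never", so information on the path at this time is
  stated only where it is below \<open>T\<close>.\<close>

definition first_time :: "real \<Rightarrow> real \<Rightarrow> (real \<Rightarrow> bool) \<Rightarrow> real" where
  "first_time T r P = (if {s \<in> {r..T}. P s} = {} then T else Inf {s \<in> {r..T}. P s})"

lemma first_time_le: "s \<in> {r..T} \<Longrightarrow> P s \<Longrightarrow> first_time T r P \<le> s"
  by (auto simp: first_time_def intro!: cInf_lower bdd_belowI[of _ r])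

lemma first_time_bounds:
  assumes "r \<le> T"
  shows "r \<le> first_time T r P" "first_time T r P \<le> T"
proof -
  show "r \<le> first_time T r P"
    using assms by (auto simp: first_time_def intro!: cInf_greatest)
  show "first_time T r P \<le> T"
  proof (cases "{s \<in> {r..T}. P s} = {}")
    case False
    then obtain s where "s \<in> {r..T}" "P s" by blast
    then show ?thesis using first_time_le[of s r T P] by auto
  qed (simp add: first_time_def)
qed

lemma first_time_less:
  assumes "first_time T r P < s" "s \<le> T"
  obtains u where "r \<le> u" "u < s" "P u"
proof -
  have ne: "{s \<in> {r..T}. P s} \<noteq> {}"
  proof
    assume "{s \<in> {r..T}. P s} = {}"
    then have "first_time T r P = T" unfolding first_time_def by (rule if_P)
    then show False using assms by linarith
  qed
  then have "first_time T r P = Inf {s \<in> {r..T}. P s}" unfolding first_time_def by (rule if_not_P)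
  then have "Inf {s \<in> {r..T}. P s} < s" using assms(1) by metis
  then obtain u where "u \<in> {s \<in> {r..T}. P s}" "u < s" using cInf_lessD[OF ne] by blast
  then show thesis using that by auto
qed

lemma first_time_mono:
  assumes "r \<le> T" "\<And>s. s \<in> {r..T} \<Longrightarrow> P s \<Longrightarrow> P' s"
  shows "first_time T r P' \<le> first_time T r P"
proof (cases "{s \<in> {r..T}. P s} = {}")
  case True
  then have "first_time T r P = T" unfolding first_time_def by (rule if_P)
  then show ?thesis using first_time_bounds(2)[OF assms(1), of P'] by linarith
next
  case False
  have "first_time T r P' \<le> Inf {s \<in> {r..T}. P s}"
    by (rule cInf_greatest[OF False]) (use assms(2) in \<open>auto intro: first_time_le\<close>)
  moreover have "first_time T r P = Inf {s \<in> {r..T}. P s}"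
    unfolding first_time_def using False by (rule if_not_P)
  ultimately show ?thesis by linarith
qed

text \<open>No time before \<open>r'\<close> satisfies \<open>P\<close>, as it would lie below the
  infimum. This permits replacing a random starting time by a slightly later grid time.\<close>

lemma first_time_restart:
  assumes "r \<le> r'" "r' \<le> first_time T r P"
  shows "first_time T r' P = first_time T r P"
proof -
  have "{s \<in> {r..T}. P s} = {s \<in> {r'..T}. P s}"
    using assms first_time_le[of _ r T P] by (auto intro: order_trans)
  then show ?thesis unfolding first_time_def by (simp only:)
qed

lemma next_switching_time_eq:
  "next_switching_time T m \<gamma> Y r i \<omega> = first_time T r (\<lambda>s. Y i s \<omega> = switching_value m \<gamma> Y i s \<omega>)"
  unfolding next_switching_time_def first_time_def Let_def ..

text \<open>The infimum need not be attained. If the path were above \<open>c\<close> there,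
  right-continuity would keep it above \<open>c\<close> for a while, and the infimum would be
  larger.\<close>

lemma first_time_below_value:
  assumes z: "cadlag_on T z" and r: "0 \<le> r" "r \<le> T" and less: "first_time T r (\<lambda>s. z s < c) < T"
  shows "z (first_time T r (\<lambda>s. z s < c)) \<le> c"
proof (rule ccontr)
  let ?d = "first_time T r (\<lambda>s. z s < c)"
  assume "\<not> ?thesis"
  then have gt: "c < z ?d" by simp
  have d: "0 \<le> ?d" using first_time_bounds(1)[OF r(2), of "\<lambda>s. z s < c"] r(1) by linarith
  have "(z \<longlongrightarrow> z ?d) (at_right ?d)" using z d less by (simp add: cadlag_on_def)
  then have "eventually (\<lambda>s. c < z s) (at_right ?d)" using gt by (rule order_tendstoD)
  then obtain b where b: "?d < b" "\<And>s. ?d < s \<Longrightarrow> s < b \<Longrightarrow> c < z s"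
    unfolding eventually_at_right_field by blast
  obtain u where u: "r \<le> u" "u < min b T" "z u < c"
    using first_time_less[of T r "\<lambda>s. z s < c" "min b T"] b(1) less by auto
  have "?d \<le> u" using u by (intro first_time_le) auto
  then show False using b(2)[of u] u gt by (cases "u = ?d") auto
qed

context filtered_prob_space
begin

text \<open>By right-continuity a path that lies below \<open>c\<close> at some time before
  \<open>s\<close> also does so at a rational time before \<open>s\<close>. The event
  \<open>first_time < s\<close> is therefore, up to a null set, a countable union of events of
  \<open>F s\<close>.\<close>

lemma first_time_below_bounded_times:
  assumes Z: "Z \<in> adapted_cadlag M F T" and \<rho>: "\<rho> \<in> bounded_times"
  shows "(\<lambda>\<omega>. first_time T (\<rho> \<omega>) (\<lambda>s. Z s \<omega> < c)) \<in> bounded_times"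
proof (rule bounded_time_of_less)
  let ?f = "\<lambda>\<omega>. first_time T (\<rho> \<omega>) (\<lambda>s. Z s \<omega> < c)"
  show "0 \<le> ?f \<omega>" "?f \<omega> \<le> T" for \<omega>
    by (rule order_trans[OF bounded_timesD(2)[OF \<rho>] first_time_bounds(1)[OF bounded_timesD(3)[OF \<rho>]]],
        rule first_time_bounds(2)[OF bounded_timesD(3)[OF \<rho>]])
  fix s assume s: "0 < s" "s \<le> T"
  define Q where "Q = \<rat> \<inter> {0..<s}"
  show "{\<omega> \<in> space M. ?f \<omega> < s} \<in> sets (F s)"
  proof (rule sets_F_AE_cong)
    show "(\<Union>q\<in>Q. {\<omega> \<in> space M. \<rho> \<omega> \<le> q} \<inter> {\<omega> \<in> space M. Z q \<omega> < c}) \<in> sets (F s)"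
    proof (rule sets.countable_UN'')
      show "countable Q" by (simp add: Q_def countable_rat)
      fix q assume q: "q \<in> Q"
      then have "Z q \<in> borel_measurable (F s)"
        using s by (intro adapted_cadlagD(3)[OF Z]) (auto simp: Q_def)
      then have "{\<omega> \<in> space (F s). Z q \<omega> < c} \<in> sets (F s)" by measurable
      moreover have "{\<omega> \<in> space M. \<rho> \<omega> \<le> q} \<in> sets (F s)"
        using q by (intro sets_F_of_stopping_time[OF bounded_timesD(1)[OF \<rho>]]) (simp add: Q_def)
      ultimately show "{\<omega> \<in> space M. \<rho> \<omega> \<le> q} \<inter> {\<omega> \<in> space M. Z q \<omega> < c} \<in> sets (F s)"
        unfolding space_F by blast
    qed
    show "AE \<omega> in M. (\<omega> \<in> (\<Union>q\<in>Q. {\<omega> \<in> space M. \<rho> \<omega> \<le> q} \<inter> {\<omega> \<in> space M. Z q \<omega> < c}))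
        = (\<omega> \<in> {\<omega> \<in> space M. ?f \<omega> < s})"
      using adapted_cadlagD(2)[OF Z] AE_space
    proof eventually_elim
      case (elim \<omega>)
      have "?f \<omega> < s" if q: "q \<in> Q" "\<rho> \<omega> \<le> q" "Z q \<omega> < c" for q
        using first_time_le[of q "\<rho> \<omega>" T "\<lambda>s. Z s \<omega> < c"] q s by (auto simp: Q_def)
      moreover have "\<exists>q\<in>Q. \<rho> \<omega> \<le> q \<and> Z q \<omega> < c" if less: "?f \<omega> < s"
      proof -
        obtain u where u: "\<rho> \<omega> \<le> u" "u < s" "Z u \<omega> < c"
          using first_time_less[OF less s(2)] by blast
        have u0: "u \<in> {0..T}" using u s bounded_timesD(2)[OF \<rho>, of \<omega>] by auto
        obtain v where v: "\<And>n. v n \<in> \<rat>" "\<And>n. u < v n" "\<And>n. v n \<le> s" "v \<longlonglongrightarrow> u"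
          using rational_approx_right[OF u(2)] by blast
        have "(\<lambda>n. Z (v n) \<omega>) \<longlonglongrightarrow> Z u \<omega>"
          by (rule cadlag_on_tendsto_right[OF elim(1) u0 v(4)]) (use v s in \<open>auto intro: less_imp_le order_trans\<close>)
        then have "\<forall>\<^sub>F n in sequentially. Z (v n) \<omega> < c" using u(3) by (rule order_tendstoD)
        moreover have "\<forall>\<^sub>F n in sequentially. v n < s" using v(4) u(2) by (rule order_tendstoD)
        ultimately have "\<forall>\<^sub>F n in sequentially. Z (v n) \<omega> < c \<and> v n < s" by (rule eventually_conj)
        then obtain n where n: "Z (v n) \<omega> < c" "v n < s" using eventually_happens'[OF sequentially_bot] by blast
        have "v n \<in> Q" "\<rho> \<omega> \<le> v n" using v(1,2)[of n] n(2) u u0 by (auto simp: Q_def)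
        then show ?thesis using n(1) by blast
      qed
      ultimately show ?case using elim(2) by blast
    qed
  qed auto
qed

text \<open>The hitting times of the sets \<open>{Z < 1 / Suc k}\<close> increase to the hitting time of
  \<open>{Z = 0}\<close>: at their limit \<open>Z\<close> vanishes because \<open>Z\<close> is quasi-left-continuous.\<close>

lemma first_zero:
  assumes Z: "Z \<in> space_Q M F T" and Z_nonneg: "AE \<omega> in M. \<forall>s\<in>{0..T}. 0 \<le> Z s \<omega>"
    and \<rho>: "\<rho> \<in> bounded_times"
  defines "near \<equiv> \<lambda>k \<omega>. first_time T (\<rho> \<omega>) (\<lambda>s. Z s \<omega> < 1 / Suc k)"
  defines "hit \<equiv> \<lambda>\<omega>. first_time T (\<rho> \<omega>) (\<lambda>s. Z s \<omega> = 0)"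
  shows first_zero_bounded_times: "hit \<in> bounded_times"
    and first_zero_value: "AE \<omega> in M. hit \<omega> < T \<longrightarrow> Z (hit \<omega>) \<omega> = 0"
    and first_zero_approx: "\<And>X. X \<in> space_Q M F T \<Longrightarrow> AE \<omega> in M. (\<lambda>k. X (near k \<omega>) \<omega>) \<longlonglongrightarrow> X (hit \<omega>) \<omega>"
proof -
  have \<rho>T: "\<rho> \<omega> \<le> T" for \<omega> using bounded_timesD[OF \<rho>] by simp
  have near: "near k \<in> bounded_times" for k
    unfolding near_def by (rule first_time_below_bounded_times[OF space_Q_adapted[OF Z] \<rho>])
  have mono: "near k \<omega> \<le> near (Suc k) \<omega>" for k \<omega>
    unfolding near_def
  proof (rule first_time_mono[OF \<rho>T])
    fix s assume "Z s \<omega> < 1 / real (Suc (Suc k))"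
    also have "1 / real (Suc (Suc k)) \<le> 1 / real (Suc k)" by (intro divide_left_mono) auto
    finally show "Z s \<omega> < 1 / real (Suc k)" .
  qed
  have near_hit: "near k \<omega> \<le> hit \<omega>" for k \<omega>
    unfolding near_def hit_def by (rule first_time_mono[OF \<rho>T]) simp
  define D where "D \<omega> = lim (\<lambda>k. near k \<omega>)" for \<omega>
  have D: "(\<lambda>k. near k \<omega>) \<longlonglongrightarrow> D \<omega>" for \<omega>
  proof -
    obtain l where "(\<lambda>k. near k \<omega>) \<longlonglongrightarrow> l"
      using incseq_convergent[of "\<lambda>k. near k \<omega>" T] incseq_SucI[of "\<lambda>k. near k \<omega>", OF mono] bounded_timesD(3)[OF near] by metis
    then show ?thesis by (simp add: D_def limI)
  qed
  note D_bt = bounded_times_limit[of near, OF near mono D]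
  have D_hit: "D \<omega> \<le> hit \<omega>" for \<omega> by (rule LIMSEQ_le_const2[OF D]) (use near_hit in auto)
  have hitT: "hit \<omega> \<le> T" for \<omega> unfolding hit_def by (rule first_time_bounds(2)[OF \<rho>T])
  have "AE \<omega> in M. (\<lambda>k. Z (near k \<omega>) \<omega>) \<longlonglongrightarrow> Z (D \<omega>) \<omega>"
    by (rule space_Q_tendsto[OF Z near mono D])
  then have good: "AE \<omega> in M. D \<omega> = hit \<omega> \<and> (D \<omega> < T \<longrightarrow> Z (D \<omega>) \<omega> = 0)"
    using Z_nonneg adapted_cadlagD(2)[OF space_Q_adapted[OF Z]]
  proof eventually_elim
    case (elim \<omega>)
    show ?case
    proof (cases "D \<omega> < T")
      case True
      have "Z (near k \<omega>) \<omega> \<le> 1 / real (Suc k)" for k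
        unfolding near_def
      proof (rule first_time_below_value[OF elim(3)])
        show "first_time T (\<rho> \<omega>) (\<lambda>s. Z s \<omega> < 1 / real (Suc k)) < T"
          using True D_bt(2)[of k \<omega>] unfolding near_def by linarith
      qed (use bounded_timesD[OF \<rho>] in auto)
      then have "Z (D \<omega>) \<omega> \<le> 0"
        using LIMSEQ_le[OF elim(1) LIMSEQ_Suc[OF lim_1_over_n]] by auto
      moreover have "0 \<le> Z (D \<omega>) \<omega>" using elim(2) bounded_timesD(2,3)[OF D_bt(1)] by simp
      ultimately have Z0: "Z (D \<omega>) \<omega> = 0" by simp
      have "\<rho> \<omega> \<le> D \<omega>"
        using D_bt(2)[of 0 \<omega>] first_time_bounds(1)[OF \<rho>T[of \<omega>], of "\<lambda>s. Z s \<omega> < 1 / real (Suc 0)"]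
        unfolding near_def by linarith
      then have "hit \<omega> \<le> D \<omega>"
        unfolding hit_def using Z0 True by (intro first_time_le) auto
      then show ?thesis using D_hit[of \<omega>] Z0 by simp
    next
      case False
      then show ?thesis using D_hit[of \<omega>] hitT[of \<omega>] by simp
    qed
  qed
  \<comment> \<open>An infimum over uncountably many times; the stopping time property is inherited
    from \<open>D\<close>, with which \<open>hit\<close> agrees almost surely.\<close>
  have "stopping_time F hit"
    by (rule stopping_time_AE_cong[OF bounded_timesD(1)[OF D_bt(1)]]) (use good in \<open>eventually_elim, simp\<close>)
  then show "hit \<in> bounded_times"
  proof (rule bounded_timesI)
    show "0 \<le> hit \<omega>" for \<omega> using D_hit[of \<omega>] bounded_timesD(2)[OF D_bt(1), of \<omega>] by linarith
  qed (rule hitT)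
  show "AE \<omega> in M. hit \<omega> < T \<longrightarrow> Z (hit \<omega>) \<omega> = 0" using good by eventually_elim auto
  show "AE \<omega> in M. (\<lambda>k. X (near k \<omega>) \<omega>) \<longlonglongrightarrow> X (hit \<omega>) \<omega>" if X: "X \<in> space_Q M F T" for X
    using space_Q_tendsto[of X near, OF X near mono D] good by eventually_elim simp
qed

end

section \<open>The martingale property up to the next switching time\<close>

context switching_system
begin

definition Z :: "nat \<Rightarrow> real \<Rightarrow> 'a \<Rightarrow> real" where
  "Z i s \<omega> = Y i s \<omega> - L i s \<omega>"

lemma Z_space_Q: "i \<in> {1..m} \<Longrightarrow> Z i \<in> space_Q M F T"
  unfolding Z_def[abs_def] by (rule space_Q_diff[OF Y_spaces(1) L_space_Q])

lemma Z_nonneg: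
  assumes "i \<in> {1..m}"
  shows "AE \<omega> in M. \<forall>s\<in>{0..T}. 0 \<le> Z i s \<omega>"
  using Y_L_ge[OF assms] by eventually_elim (simp add: Z_def)

abbreviation hit :: "nat \<Rightarrow> real \<Rightarrow> 'a \<Rightarrow> real" where
  "hit i r \<omega> \<equiv> next_switching_time T m \<gamma> Y r i \<omega>"

lemma hit_eq: "hit i r \<omega> = first_time T r (\<lambda>s. Z i s \<omega> = 0)"
  by (simp add: next_switching_time_eq Z_def)

lemma hit_bounds: "r \<le> T \<Longrightarrow> r \<le> hit i r \<omega>" "r \<le> T \<Longrightarrow> hit i r \<omega> \<le> T"
  unfolding hit_eq by (rule first_time_bounds; assumption)+

lemma hit_bounded_times: "i \<in> {1..m} \<Longrightarrow> \<rho> \<in> bounded_times \<Longrightarrow> (\<lambda>\<omega>. hit i (\<rho> \<omega>) \<omega>) \<in> bounded_times"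
  unfolding hit_eq by (rule first_zero_bounded_times[OF Z_space_Q Z_nonneg])

lemma hit_value:
  assumes "i \<in> {1..m}" "\<rho> \<in> bounded_times"
  shows "AE \<omega> in M. hit i (\<rho> \<omega>) \<omega> < T \<longrightarrow> Y i (hit i (\<rho> \<omega>) \<omega>) \<omega> = L i (hit i (\<rho> \<omega>) \<omega>) \<omega>"
  using first_zero_value[OF Z_space_Q Z_nonneg, OF assms(1) assms(1) assms(2)]
  unfolding hit_eq by eventually_elim (simp add: Z_def)

definition near :: "nat \<Rightarrow> nat \<Rightarrow> real \<Rightarrow> 'a \<Rightarrow> real" where
  "near i k r \<omega> = first_time T r (\<lambda>s. Z i s \<omega> < 1 / Suc k)"

text \<open>A near-optimal time falls before \<open>near i k t\<close> only with small probability, since the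
  expected loss from stopping at it is at least \<open>1 / Suc k\<close> times that probability.\<close>

lemma X_near_expectation:
  assumes i: "i \<in> {1..m}" and t: "t \<in> {0..T}"
  shows "expectation (X i t) \<le> expectation (\<lambda>\<omega>. X i (near i k t \<omega>) \<omega>)"
proof -
  have near: "(\<lambda>\<omega>. near i k t \<omega>) \<in> bounded_times"
    unfolding near_def by (rule first_time_below_bounded_times[OF space_Q_adapted[OF Z_space_Q[OF i]] bounded_times_const[OF t]])
  define K where "K = expectation (\<lambda>\<omega>. (\<xi> \<omega>)\<^sup>2)"
  \<comment> \<open>The tolerance is \<open>\<delta>\<^sup>2\<close>, so that the bad event
    \<open>B\<close> has probability at most \<open>Suc k\<close> times
    \<open>\<delta>\<^sup>2\<close>. On \<open>B\<close> the process is bounded by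
    \<open>\<xi>\<close>, and Young's inequality
    \<open>\<xi> \<le> \<delta> * \<xi>\<^sup>2 + 1 / (4 * \<delta>)\<close> splits the product of
    \<open>\<xi>\<close> with the indicator of \<open>B\<close> into two terms of order
    \<open>\<delta>\<close>.\<close>
  have le: "expectation (X i t) \<le> expectation (\<lambda>\<omega>. X i (near i k t \<omega>) \<omega>) + (\<delta>\<^sup>2 + 2 * (\<delta> * K + real (Suc k) * \<delta> / 4))"
    if \<delta>: "0 < \<delta>" for \<delta>
  proof -
    have "0 < \<delta>\<^sup>2" using \<delta> by simp
    then obtain \<theta> where \<theta>: "\<theta> \<in> later_times t" "expectation (X i t) \<le> expectation (stopped_value i \<theta>) + \<delta>\<^sup>2"
      using stopped_value_near_optimal[OF i t] by blast
    have b: "\<theta> \<in> bounded_times" and t\<theta>: "\<And>\<omega>. t \<le> \<theta> \<omega>" using \<theta>(1) by (simp_all add: later_times_def)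
    have [measurable]: "\<theta> \<in> borel_measurable M" "(\<lambda>\<omega>. near i k t \<omega>) \<in> borel_measurable M"
      by (rule measurable_stopping_time[OF bounded_timesD(1)[OF b] F_subset space_F]
          measurable_stopping_time[OF bounded_timesD(1)[OF near] F_subset space_F])+
    define B where "B = {\<omega> \<in> space M. \<theta> \<omega> < near i k t \<omega>}"
    have B: "B \<in> sets M" unfolding B_def by measurable
    \<comment> \<open>Equal to the hitting time off \<open>B\<close> and no later than
      \<open>\<theta>\<close>, so the supermartingale property bounds the expectation at
      \<open>\<theta>\<close> by that at \<open>\<eta>\<close>; only \<open>B\<close> separates it
      from the hitting time.\<close>
    define \<eta> where "\<eta> = (\<lambda>\<omega>. min (\<theta> \<omega>) (near i k t \<omega>))"
    have \<eta>: "\<eta> \<in> bounded_times" unfolding \<eta>_def by (rule bounded_times_min[OF b near])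
    have V: "integrable M (stopped_value i \<theta>)" by (rule stopped_value_integrable[OF i b])
    note Xi = integrable_X_stopped[OF i b] integrable_X_stopped[OF i near] integrable_X_stopped[OF i \<eta>]
    have iB: "integrable M (indicator B :: 'a \<Rightarrow> real)" using B by (simp add: integrable_real_indicator emeasure_finite less_top[symmetric])
    have "expectation (\<lambda>\<omega>. indicator B \<omega> / real (Suc k)) \<le> expectation (\<lambda>\<omega>. X i (\<theta> \<omega>) \<omega> - stopped_value i \<theta> \<omega>)"
    proof (rule integral_mono_AE)
      show "AE \<omega> in M. indicator B \<omega> / real (Suc k) \<le> X i (\<theta> \<omega>) \<omega> - stopped_value i \<theta> \<omega>"
        using stopped_value_eq_X[OF i b] Z_nonneg[OF i]
      proof eventually_elim
        case (elim \<omega>)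
        have eq: "X i (\<theta> \<omega>) \<omega> - stopped_value i \<theta> \<omega> = Z i (\<theta> \<omega>) \<omega> * of_bool (\<theta> \<omega> < T)"
          using elim(1) by (simp add: Z_def)
        show ?case
        proof (cases "\<omega> \<in> B")
          case True
          then have less: "\<theta> \<omega> < near i k t \<omega>" by (simp add: B_def)
          then have "\<theta> \<omega> < T" using bounded_timesD(3)[OF near, of \<omega>] by linarith
          moreover have "\<not> Z i (\<theta> \<omega>) \<omega> < 1 / real (Suc k)"
            using first_time_le[of "\<theta> \<omega>" t T "\<lambda>s. Z i s \<omega> < 1 / Suc k"] less t\<theta>[of \<omega>] bounded_timesD(3)[OF b, of \<omega>]
            by (auto simp: near_def)
          ultimately show ?thesis using True eq by simp
        next
          case False
          have "0 \<le> Z i (\<theta> \<omega>) \<omega>" using elim(2) bounded_timesD(2,3)[OF b] by simp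
          then show ?thesis using False eq by simp
        qed
      qed
    qed (use iB V Xi in auto)
    also have "\<dots> = expectation (\<lambda>\<omega>. X i (\<theta> \<omega>) \<omega>) - expectation (stopped_value i \<theta>)" using V Xi by simp
    also have "\<dots> \<le> \<delta>\<^sup>2"
      using \<theta>(2) X_supermartingale_expectation[OF i bounded_times_const[OF t] b t\<theta>] by simp
    finally have P: "expectation (indicator B) \<le> real (Suc k) * \<delta>\<^sup>2"
      using iB by (simp add: divide_le_eq mult.commute del: of_nat_Suc)
    have "expectation (X i t) - \<delta>\<^sup>2 \<le> expectation (stopped_value i \<theta>)" using \<theta>(2) by simp
    also have "\<dots> \<le> expectation (\<lambda>\<omega>. X i (\<theta> \<omega>) \<omega>)"
    proof (rule integral_mono_AE[OF V Xi(1)])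
      show "AE \<omega> in M. stopped_value i \<theta> \<omega> \<le> X i (\<theta> \<omega>) \<omega>"
        using stopped_value_eq_X[OF i b] Z_nonneg[OF i]
      proof eventually_elim
        case (elim \<omega>)
        have "0 \<le> Z i (\<theta> \<omega>) \<omega>" using elim(2) bounded_timesD(2,3)[OF b] by simp
        then show ?case using elim(1) unfolding Z_def by (cases "\<theta> \<omega> < T") auto
      qed
    qed
    also have "\<dots> \<le> expectation (\<lambda>\<omega>. X i (\<eta> \<omega>) \<omega>)"
      by (rule X_supermartingale_expectation[OF i \<eta> b]) (simp add: \<eta>_def)
    also have "\<dots> \<le> expectation (\<lambda>\<omega>. X i (near i k t \<omega>) \<omega> + 2 * (\<delta> * (\<xi> \<omega>)\<^sup>2 + indicator B \<omega> / (4 * \<delta>)))"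
    proof (rule integral_mono_AE)
      show "AE \<omega> in M. X i (\<eta> \<omega>) \<omega> \<le> X i (near i k t \<omega>) \<omega> + 2 * (\<delta> * (\<xi> \<omega>)\<^sup>2 + indicator B \<omega> / (4 * \<delta>))"
        using dominated_stopped[OF dominated_X[OF i] \<eta>] dominated_stopped[OF dominated_X[OF i] near] AE_space
      proof eventually_elim
        case (elim \<omega>)
        show ?case
        proof (cases "\<omega> \<in> B")
          case True
          have "0 \<le> (2 * \<delta> * \<xi> \<omega> - 1)\<^sup>2" by simp
          then have "4 * \<delta> * \<xi> \<omega> \<le> 4 * \<delta>\<^sup>2 * (\<xi> \<omega>)\<^sup>2 + 1" by (simp add: power2_eq_square algebra_simps)
          then have "(4 * \<delta> * \<xi> \<omega>) / (4 * \<delta>) \<le> (4 * \<delta>\<^sup>2 * (\<xi> \<omega>)\<^sup>2 + 1) / (4 * \<delta>)"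
            using \<delta> by (intro divide_right_mono) auto
          also have "(4 * \<delta>\<^sup>2 * (\<xi> \<omega>)\<^sup>2 + 1) / (4 * \<delta>) = \<delta> * (\<xi> \<omega>)\<^sup>2 + 1 / (4 * \<delta>)"
            using \<delta> by (simp add: power2_eq_square field_simps)
          finally have "\<xi> \<omega> \<le> \<delta> * (\<xi> \<omega>)\<^sup>2 + 1 / (4 * \<delta>)" using \<delta> by simp
          then show ?thesis using True elim by simp
        next
          case False
          then have "\<eta> \<omega> = near i k t \<omega>" using elim(3) by (auto simp: B_def \<eta>_def)
          then show ?thesis using False \<delta> by simp
        qed
      qed
    qed (use Xi \<xi>_square iB in auto)
    also have "\<dots> = expectation (\<lambda>\<omega>. X i (near i k t \<omega>) \<omega>) + 2 * (\<delta> * K + expectation (indicator B) / (4 * \<delta>))"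
      using Xi \<xi>_square iB by (simp add: K_def)
    also have "\<dots> \<le> expectation (\<lambda>\<omega>. X i (near i k t \<omega>) \<omega>) + 2 * (\<delta> * K + real (Suc k) * \<delta>\<^sup>2 / (4 * \<delta>))"
      using P \<delta> by (intro add_left_mono mult_left_mono divide_right_mono) auto
    also have "real (Suc k) * \<delta>\<^sup>2 / (4 * \<delta>) = real (Suc k) * \<delta> / 4"
      using \<delta> by (simp add: power2_eq_square)
    finally show ?thesis by linarith
  qed
  show ?thesis
  proof (rule LIMSEQ_le_const)
    have d: "(\<lambda>n. 1 / real (Suc n)) \<longlonglongrightarrow> 0" by (rule LIMSEQ_Suc[OF lim_1_over_n])
    have "(\<lambda>n. expectation (\<lambda>\<omega>. X i (near i k t \<omega>) \<omega>) + ((1 / real (Suc n))\<^sup>2 + 2 * ((1 / real (Suc n)) * K + real (Suc k) * (1 / real (Suc n)) / 4)))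
        \<longlonglongrightarrow> expectation (\<lambda>\<omega>. X i (near i k t \<omega>) \<omega>) + (0\<^sup>2 + 2 * (0 * K + real (Suc k) * 0 / 4))"
      by (intro tendsto_intros d) simp
    then show "(\<lambda>n. expectation (\<lambda>\<omega>. X i (near i k t \<omega>) \<omega>) + ((1 / real (Suc n))\<^sup>2 + 2 * ((1 / real (Suc n)) * K + real (Suc k) * (1 / real (Suc n)) / 4)))
        \<longlonglongrightarrow> expectation (\<lambda>\<omega>. X i (near i k t \<omega>) \<omega>)" by simp
    show "\<exists>N. \<forall>n\<ge>N. expectation (X i t) \<le> expectation (\<lambda>\<omega>. X i (near i k t \<omega>) \<omega>) +
        ((1 / real (Suc n))\<^sup>2 + 2 * ((1 / real (Suc n)) * K + real (Suc k) * (1 / real (Suc n)) / 4))"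
      by (intro exI allI impI le) simp
  qed
qed

text \<open>Along the hitting times of the open sets the expectation of \<open>X i\<close> does not
  fall below its initial value. Quasi-left-continuity of \<open>X i\<close> and domination carry
  this to the limit, and equality of expectations upgrades to the martingale property.\<close>

lemma X_hit_const:
  assumes i: "i \<in> {1..m}" and t: "t \<in> {0..T}" and A: "A \<in> sets (F t)"
  shows "expectation (\<lambda>\<omega>. indicator A \<omega> * (X i (hit i t \<omega>) \<omega> - X i t \<omega>)) = 0"
proof -
  note tb = bounded_times_const[OF t]
  have hitb: "(\<lambda>\<omega>. hit i t \<omega>) \<in> bounded_times" using hit_bounded_times[OF i tb] .
  have near: "(\<lambda>\<omega>. near i k t \<omega>) \<in> bounded_times" for k
    unfolding near_def by (rule first_time_below_bounded_times[OF space_Q_adapted[OF Z_space_Q[OF i]] tb])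
  have "(\<lambda>k. expectation (\<lambda>\<omega>. X i (near i k t \<omega>) \<omega>)) \<longlonglongrightarrow> expectation (\<lambda>\<omega>. X i (hit i t \<omega>) \<omega>)"
  proof (rule integral_dominated_convergence)
    show "AE \<omega> in M. (\<lambda>k. X i (near i k t \<omega>) \<omega>) \<longlonglongrightarrow> X i (hit i t \<omega>) \<omega>"
      unfolding near_def hit_eq
      by (rule first_zero_approx[OF Z_space_Q[OF i] Z_nonneg[OF i] tb X_space_Q[OF i]])
    show "AE \<omega> in M. norm (X i (near i k t \<omega>) \<omega>) \<le> \<xi> \<omega>" for k
      using dominated_stopped[OF dominated_X[OF i] near[of k]] by simp
  qed (use integrable_X_stopped[OF i near] integrable_X_stopped[OF i hitb] \<xi>_integrable in \<open>auto intro: borel_measurable_integrable\<close>)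
  then have "expectation (X i t) \<le> expectation (\<lambda>\<omega>. X i (hit i t \<omega>) \<omega>)"
    using X_near_expectation[OF i t] by (intro LIMSEQ_le_const) auto
  moreover have "A \<in> sets (pre_sigma (\<lambda>_. t))"
    by (rule sets_F_pre_sigma[OF stopping_time_const _ A]) simp
  ultimately show ?thesis
    using t by (intro X_martingale_of_expectation[OF i tb hitb]) (auto intro: hit_bounds)
qed

text \<open>For a starting time with values in the grid the claim splits into the deterministic
  cases. A general \<open>\<rho>\<close> is rounded up to the grid; the hitting time from the
  rounded start must then be compared with the original one.\<close>

lemma X_hit_martingale:
  assumes i: "i \<in> {1..m}" and \<rho>: "\<rho> \<in> bounded_times" and A: "A \<in> sets (pre_sigma \<rho>)"
  shows "expectation (\<lambda>\<omega>. indicator A \<omega> * (X i (hit i (\<rho> \<omega>) \<omega>) \<omega> - X i (\<rho> \<omega>) \<omega>)) = 0"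
proof -
  note hitb = hit_bounded_times[OF i \<rho>]
  define \<sigma> where "\<sigma> n = (\<lambda>\<omega>. grid_time n (\<rho> \<omega>))" for n
  have \<sigma>: "\<sigma> n \<in> bounded_times" "\<rho> \<omega> \<le> \<sigma> n \<omega>" for n \<omega>
    unfolding \<sigma>_def by (rule grid_time_bounded_times[OF \<rho>], rule grid_time_bounds(1))
  \<comment> \<open>Only on \<open>C\<close> do the rounded times eventually precede the hitting
    time, so that restarting there does not change it. Off \<open>C\<close> a rounded start could
    miss the hit altogether, but the increment in question vanishes.\<close>
  define C where "C = {\<omega> \<in> space M. \<rho> \<omega> < hit i (\<rho> \<omega>) \<omega>}"
  have C: "C \<in> sets (pre_sigma \<rho>)"
    using stopping_time_less[OF bounded_timesD(1)[OF \<rho>] bounded_timesD(1)[OF hitb]]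
    by (simp add: pred_def C_def space_pre_sigma)
  have C\<sigma>: "C \<in> sets (pre_sigma (\<sigma> n))" for n
    using mono_pre_sigma[OF bounded_timesD(1)[OF \<rho>] bounded_timesD(1)[OF \<sigma>(1)]] \<sigma>(2) C by blast
  have CM: "C \<in> sets M" using C subalgebra_pre_sigma[OF \<rho>] by (auto simp: subalgebra_def)
  note hit\<sigma> = hit_bounded_times[OF i \<sigma>(1)]
  have grid: "expectation (\<lambda>\<omega>. indicator C \<omega> * (X i (hit i (\<sigma> n \<omega>) \<omega>) \<omega> - X i (\<sigma> n \<omega>) \<omega>)) = 0" for n
  proof -
    define h where "h = T / Suc n"
    have h: "0 < h" "h * real (Suc n) = T" using T_pos by (simp_all add: h_def)
    have kT: "h * real k \<in> {0..T}" if "k \<le> Suc n" for k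
    proof -
      have "h * real k \<le> h * real (Suc n)" using that h by (intro mult_left_mono) auto
      then show ?thesis using h(1) unfolding h(2) by simp
    qed
    define B where "B k = {\<omega> \<in> C. \<sigma> n \<omega> = h * real k}" for k
    have B: "B k \<in> sets (F (h * real k))" for k
    proof -
      have "{\<omega> \<in> C. \<sigma> n \<omega> \<le> h * real k} \<in> sets (F (h * real k))"
        using sets_pre_sigmaD[OF bounded_timesD(1)[OF \<sigma>(1)] C\<sigma>] .
      moreover have "{\<omega> \<in> space M. \<sigma> n \<omega> = h * real k} \<in> sets (F (h * real k))"
        using stopping_time_eq_const[OF bounded_timesD(1)[OF \<sigma>(1)[of n]], of "h * real k"] by (simp add: pred_def space_F)
      ultimately have "{\<omega> \<in> C. \<sigma> n \<omega> \<le> h * real k} \<inter> {\<omega> \<in> space M. \<sigma> n \<omega> = h * real k} \<in> sets (F (h * real k))" by blast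
      also have "{\<omega> \<in> C. \<sigma> n \<omega> \<le> h * real k} \<inter> {\<omega> \<in> space M. \<sigma> n \<omega> = h * real k} = B k"
        using sets.sets_into_space[OF CM] by (auto simp: B_def)
      finally show ?thesis .
    qed
    have "indicator C \<omega> * (X i (hit i (\<sigma> n \<omega>) \<omega>) \<omega> - X i (\<sigma> n \<omega>) \<omega>)
        = (\<Sum>k\<le>Suc n. indicator (B k) \<omega> * (X i (hit i (h * real k) \<omega>) \<omega> - X i (h * real k) \<omega>))" for \<omega>
    proof -
      define k where "k = nat \<lceil>\<rho> \<omega> / h\<rceil>"
      have \<rho>0: "0 \<le> \<rho> \<omega>" "\<rho> \<omega> \<le> T" using bounded_timesD[OF \<rho>] by auto
      then have g: "\<sigma> n \<omega> = h * real k"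
        using h(1) by (simp add: \<sigma>_def grid_time_def h_def k_def)
      have "h * real k \<le> h * real (Suc n)"
        using bounded_timesD(3)[OF \<sigma>(1), of n \<omega>] unfolding g h(2) .
      then have k: "k \<le> Suc n" using h(1) by (simp del: of_nat_Suc)
      have "(\<Sum>j\<le>Suc n. indicator (B j) \<omega> * (X i (hit i (h * real j) \<omega>) \<omega> - X i (h * real j) \<omega>))
        = (\<Sum>j\<le>Suc n. if j = k then indicator C \<omega> * (X i (hit i (h * real k) \<omega>) \<omega> - X i (h * real k) \<omega>) else 0)"
        by (intro sum.cong refl) (use g h(1) in \<open>auto simp: B_def indicator_def\<close>)
      also have "\<dots> = indicator C \<omega> * (X i (hit i (h * real k) \<omega>) \<omega> - X i (h * real k) \<omega>)"
        using k by (subst sum.delta) auto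
      finally show ?thesis unfolding g by (rule sym)
    qed
    then have "expectation (\<lambda>\<omega>. indicator C \<omega> * (X i (hit i (\<sigma> n \<omega>) \<omega>) \<omega> - X i (\<sigma> n \<omega>) \<omega>))
      = expectation (\<lambda>\<omega>. \<Sum>k\<le>Suc n. indicator (B k) \<omega> * (X i (hit i (h * real k) \<omega>) \<omega> - X i (h * real k) \<omega>))"
      by simp
    also have "\<dots> = (\<Sum>k\<le>Suc n. expectation (\<lambda>\<omega>. indicator (B k) \<omega> * (X i (hit i (h * real k) \<omega>) \<omega> - X i (h * real k) \<omega>)))"
    proof (rule Bochner_Integration.integral_sum)
      fix k assume "k \<in> {..Suc n}"
      then have tb: "(\<lambda>_. h * real k) \<in> bounded_times" by (intro bounded_times_const kT) simp
      have "B k \<in> sets M" using B[of k] F_subset by blast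
      then show "integrable M (\<lambda>\<omega>. indicator (B k) \<omega> * (X i (hit i (h * real k) \<omega>) \<omega> - X i (h * real k) \<omega>))"
        by (intro integrable_indicator_times Bochner_Integration.integrable_diff
            integrable_X_stopped[OF i hit_bounded_times[OF i tb]] integrable_X_stopped[OF i tb])
    qed
    also have "\<dots> = 0"
      by (intro sum.neutral ballI X_hit_const[OF i kT B]) simp
    finally show ?thesis .
  qed
  have "(\<lambda>n. expectation (\<lambda>\<omega>. indicator C \<omega> * (X i (hit i (\<sigma> n \<omega>) \<omega>) \<omega> - X i (\<sigma> n \<omega>) \<omega>)))
      \<longlonglongrightarrow> expectation (\<lambda>\<omega>. indicator C \<omega> * (X i (hit i (\<rho> \<omega>) \<omega>) \<omega> - X i (\<rho> \<omega>) \<omega>))"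
  proof (rule integral_dominated_convergence)
    show "integrable M (\<lambda>\<omega>. 2 * \<xi> \<omega>)" using \<xi>_integrable by simp
    show "(\<lambda>\<omega>. indicator C \<omega> * (X i (hit i (\<rho> \<omega>) \<omega>) \<omega> - X i (\<rho> \<omega>) \<omega>)) \<in> borel_measurable M"
      by (intro borel_measurable_integrable integrable_indicator_times CM Bochner_Integration.integrable_diff
          integrable_X_stopped[OF i hitb] integrable_X_stopped[OF i \<rho>])
    show "(\<lambda>\<omega>. indicator C \<omega> * (X i (hit i (\<sigma> n \<omega>) \<omega>) \<omega> - X i (\<sigma> n \<omega>) \<omega>)) \<in> borel_measurable M" for n
      by (intro borel_measurable_integrable integrable_indicator_times CM Bochner_Integration.integrable_diff
          integrable_X_stopped[OF i hit\<sigma>] integrable_X_stopped[OF i \<sigma>(1)])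
    show "AE \<omega> in M. norm (indicator C \<omega> * (X i (hit i (\<sigma> n \<omega>) \<omega>) \<omega> - X i (\<sigma> n \<omega>) \<omega>)) \<le> 2 * \<xi> \<omega>" for n
      using dominated_stopped[OF dominated_X[OF i] hit\<sigma>[of n]] dominated_stopped[OF dominated_X[OF i] \<sigma>(1)[of n]]
      by eventually_elim (auto simp: indicator_def)
    show "AE \<omega> in M. (\<lambda>n. indicator C \<omega> * (X i (hit i (\<sigma> n \<omega>) \<omega>) \<omega> - X i (\<sigma> n \<omega>) \<omega>))
      \<longlonglongrightarrow> indicator C \<omega> * (X i (hit i (\<rho> \<omega>) \<omega>) \<omega> - X i (\<rho> \<omega>) \<omega>)"
      using grid_time_stopped_tendsto[OF space_Q_adapted[OF X_space_Q[OF i]] \<rho>]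
    proof eventually_elim
      case (elim \<omega>)
      show ?case
      proof (cases "\<omega> \<in> C")
        case True
        then have "\<rho> \<omega> < hit i (\<rho> \<omega>) \<omega>" by (simp add: C_def)
        then have "\<forall>\<^sub>F n in sequentially. \<sigma> n \<omega> < hit i (\<rho> \<omega>) \<omega>"
          using order_tendstoD(2)[OF grid_time_tendsto] unfolding \<sigma>_def by blast
        then have "\<forall>\<^sub>F n in sequentially. X i (hit i (\<rho> \<omega>) \<omega>) \<omega> = X i (hit i (\<sigma> n \<omega>) \<omega>) \<omega>"
        proof eventually_elim
          case (elim n)
          have "hit i (\<sigma> n \<omega>) \<omega> = hit i (\<rho> \<omega>) \<omega>"
            using elim \<sigma>(2)[of \<omega> n] unfolding hit_eq by (intro first_time_restart) auto
          then show ?case by simp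
        qed
        then have "(\<lambda>n. X i (hit i (\<sigma> n \<omega>) \<omega>) \<omega>) \<longlonglongrightarrow> X i (hit i (\<rho> \<omega>) \<omega>) \<omega>"
          by (rule Lim_transform_eventually[OF tendsto_const])
        then show ?thesis using elim unfolding \<sigma>_def by (intro tendsto_intros)
      qed simp
    qed
  qed
  then have "expectation (\<lambda>\<omega>. indicator C \<omega> * (X i (hit i (\<rho> \<omega>) \<omega>) \<omega> - X i (\<rho> \<omega>) \<omega>)) = 0"
    unfolding grid by (rule LIMSEQ_unique[OF _ tendsto_const])
  moreover have "expectation (\<lambda>\<omega>. indicator C \<omega> * (X i (hit i (\<rho> \<omega>) \<omega>) \<omega> - X i (\<rho> \<omega>) \<omega>))
      = expectation (\<lambda>\<omega>. X i (hit i (\<rho> \<omega>) \<omega>) \<omega> - X i (\<rho> \<omega>) \<omega>)"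
  proof (rule Bochner_Integration.integral_cong[OF refl])
    fix \<omega> assume "\<omega> \<in> space M"
    moreover have "\<rho> \<omega> \<le> hit i (\<rho> \<omega>) \<omega>" by (rule hit_bounds(1)[OF bounded_timesD(3)[OF \<rho>]])
    ultimately show "indicator C \<omega> * (X i (hit i (\<rho> \<omega>) \<omega>) \<omega> - X i (\<rho> \<omega>) \<omega>) = X i (hit i (\<rho> \<omega>) \<omega>) \<omega> - X i (\<rho> \<omega>) \<omega>"
      by (cases "\<omega> \<in> C") (auto simp: C_def)
  qed
  ultimately have "expectation (\<lambda>\<omega>. X i (\<rho> \<omega>) \<omega>) \<le> expectation (\<lambda>\<omega>. X i (hit i (\<rho> \<omega>) \<omega>) \<omega>)"
    using integrable_X_stopped[OF i hitb] integrable_X_stopped[OF i \<rho>] by simp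
  then show ?thesis
    by (intro X_martingale_of_expectation[OF i \<rho> hitb _ _ A] hit_bounds(1) bounded_timesD(3)[OF \<rho>])
qed

end

section \<open>Square-integrable martingales in discrete time\<close>

text \<open>One-sided, for the sake of the recursion in the pathwise inequality; absolute values are
  covered by applying it to a path and to its negative.\<close>

fun running_max :: "(nat \<Rightarrow> real) \<Rightarrow> nat \<Rightarrow> real" where
  "running_max y 0 = y 0"
| "running_max y (Suc n) = max (running_max y n) (y (Suc n))"

lemma running_max_ge: "k \<le> n \<Longrightarrow> y k \<le> running_max y n"
  by (induction n) (auto simp: le_Suc_eq max_def)

text \<open>A bound that grows with \<open>n\<close>; it serves integrability of the squared maximum
  only, not the uniform estimate.\<close>

lemma running_max_square_le: "(running_max y n)\<^sup>2 \<le> (\<Sum>k\<le>n. (y k)\<^sup>2)"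
proof (induction n)
  case (Suc n)
  have "(running_max y (Suc n))\<^sup>2 \<le> (running_max y n)\<^sup>2 + (y (Suc n))\<^sup>2" by (auto simp: max_def)
  then show ?case using Suc by simp
qed simp

text \<open>The pathwise form of Doob's maximal inequality: for a martingale the sum on the right has
  expectation zero.\<close>

lemma running_max_pathwise:
  assumes "y 0 = 0"
  shows "(running_max y n)\<^sup>2 \<le> 4 * (y n)\<^sup>2 - 4 * (\<Sum>k<n. running_max y k * (y (Suc k) - y k))"
proof -
  \<comment> \<open>Summation by parts: the maximum increases only when the new value is the
    maximum, so the correction terms have the form \<open>R' * (R' - R)\<close>, which is at least
    half the increase of \<open>R\<^sup>2\<close>.\<close>
  have *: "(\<Sum>k<n. running_max y k * (y (Suc k) - y k)) \<le> running_max y n * y n - (running_max y n)\<^sup>2 / 2"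
  proof (induction n)
    case 0
    then show ?case using assms by simp
  next
    case (Suc n)
    have "running_max y n * y (Suc n) - (running_max y n)\<^sup>2 / 2
        \<le> running_max y (Suc n) * y (Suc n) - (running_max y (Suc n))\<^sup>2 / 2"
    proof (cases "y (Suc n) \<le> running_max y n")
      case False
      have "0 \<le> (y (Suc n) - running_max y n)\<^sup>2" by simp
      then show ?thesis using False by (simp add: max_def power2_eq_square algebra_simps)
    qed (simp add: max_def)
    then show ?case using Suc by (simp add: algebra_simps)
  qed
  \<comment> \<open>Completing the square with this weight produces the factor \<open>4\<close>,
    Doob's constant for second moments.\<close>
  have "0 \<le> (running_max y n - 2 * y n)\<^sup>2" by simp
  then have "(running_max y n)\<^sup>2 \<le> 4 * (y n)\<^sup>2 + 2 * (running_max y n)\<^sup>2 - 4 * (running_max y n * y n)"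
    by (simp add: power2_eq_square algebra_simps)
  then show ?thesis using * by linarith
qed

lemma integrable_mult_of_squares:
  fixes f g :: "'a \<Rightarrow> real"
  assumes [measurable]: "f \<in> borel_measurable M" "g \<in> borel_measurable M"
    and sq: "integrable M (\<lambda>\<omega>. (f \<omega>)\<^sup>2)" "integrable M (\<lambda>\<omega>. (g \<omega>)\<^sup>2)"
  shows "integrable M (\<lambda>\<omega>. f \<omega> * g \<omega>)"
proof (rule Bochner_Integration.integrable_bound)
  show "integrable M (\<lambda>\<omega>. (f \<omega>)\<^sup>2 + (g \<omega>)\<^sup>2)" using sq by simp
  show "AE \<omega> in M. norm (f \<omega> * g \<omega>) \<le> norm ((f \<omega>)\<^sup>2 + (g \<omega>)\<^sup>2)"
  proof (rule AE_I2)
    fix \<omega>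
    have "0 \<le> (f \<omega> + g \<omega>)\<^sup>2" "0 \<le> (f \<omega> - g \<omega>)\<^sup>2" "0 \<le> (f \<omega>)\<^sup>2 + (g \<omega>)\<^sup>2" by simp_all
    then have "- (2 * (f \<omega> * g \<omega>)) \<le> (f \<omega>)\<^sup>2 + (g \<omega>)\<^sup>2" "2 * (f \<omega> * g \<omega>) \<le> (f \<omega>)\<^sup>2 + (g \<omega>)\<^sup>2"
      unfolding power2_sum power2_diff by linarith+
    then show "norm (f \<omega> * g \<omega>) \<le> norm ((f \<omega>)\<^sup>2 + (g \<omega>)\<^sup>2)"
      using \<open>0 \<le> (f \<omega>)\<^sup>2 + (g \<omega>)\<^sup>2\<close> unfolding real_norm_def by linarith
  qed
qed measurable

lemma integrable_square_diff:
  fixes f g :: "'a \<Rightarrow> real"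
  assumes "f \<in> borel_measurable M" "g \<in> borel_measurable M"
    "integrable M (\<lambda>\<omega>. (f \<omega>)\<^sup>2)" "integrable M (\<lambda>\<omega>. (g \<omega>)\<^sup>2)"
  shows "integrable M (\<lambda>\<omega>. (f \<omega> - g \<omega>)\<^sup>2)"
  using integrable_square_add[of f M "\<lambda>\<omega>. - g \<omega>"] assms by simp

text \<open>Kept abstract in order to be instantiated with the stopped sigma-algebras along a
  sequence of switching times.\<close>

locale discrete_filtration = prob_space M for M :: "'a measure" +
  fixes G :: "nat \<Rightarrow> 'a measure"
  assumes subalgebra_G: "subalgebra M (G k)"
    and sets_G_Suc: "sets (G k) \<subseteq> sets (G (Suc k))"
begin

lemma sets_G_mono: "k \<le> l \<Longrightarrow> sets (G k) \<subseteq> sets (G l)"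
  by (rule lift_Suc_mono_le[of "\<lambda>k. sets (G k)", OF sets_G_Suc])

lemma measurable_G_mono:
  assumes "k \<le> l" "f \<in> borel_measurable (G k)"
  shows "f \<in> borel_measurable (G l)"
proof (rule measurable_from_subalg[OF _ assms(2)])
  show "subalgebra (G l) (G k)"
    using sets_G_mono[OF assms(1)] subalgebra_G[of k] subalgebra_G[of l] by (simp add: subalgebra_def)
qed

lemma measurable_G_M: "f \<in> borel_measurable (G k) \<Longrightarrow> f \<in> borel_measurable M"
  by (rule measurable_from_subalg[OF subalgebra_G])

lemma expectation_mult_cond_exp:
  assumes "f \<in> borel_measurable (G k)" "g \<in> borel_measurable M"
    and "integrable M (\<lambda>\<omega>. (f \<omega>)\<^sup>2)" "integrable M (\<lambda>\<omega>. (g \<omega>)\<^sup>2)"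
  shows "expectation (\<lambda>\<omega>. f \<omega> * real_cond_exp M (G k) g \<omega>) = expectation (\<lambda>\<omega>. f \<omega> * g \<omega>)"
proof -
  interpret K: finite_measure_subalgebra M "G k" by unfold_locales (rule subalgebra_G)
  show ?thesis
    by (rule K.real_cond_exp_intg(2)[OF integrable_mult_of_squares[OF measurable_G_M[OF assms(1)] assms(2-4)] assms(1,2)])
qed

text \<open>Vanishing on events means that the conditional expectation is zero; a factor known at
  step \<open>k\<close> can then be moved inside it.\<close>

lemma expectation_mult_martingale_difference:
  fixes d :: "'a \<Rightarrow> real"
  assumes d: "d \<in> borel_measurable M" "integrable M (\<lambda>\<omega>. (d \<omega>)\<^sup>2)"
    and mart: "\<And>A. A \<in> sets (G k) \<Longrightarrow> expectation (\<lambda>\<omega>. indicator A \<omega> * d \<omega>) = 0"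
    and f: "f \<in> borel_measurable (G k)" "integrable M (\<lambda>\<omega>. (f \<omega>)\<^sup>2)"
  shows "expectation (\<lambda>\<omega>. f \<omega> * d \<omega>) = 0"
proof -
  interpret K: finite_measure_subalgebra M "G k" by unfold_locales (rule subalgebra_G)
  have "AE \<omega> in M. real_cond_exp M (G k) d \<omega> = (\<lambda>_. 0) \<omega>"
    by (rule K.real_cond_exp_charact) (use integrable_of_square[OF d] mart in \<open>simp_all add: set_lebesgue_integral_def\<close>)
  then have "AE \<omega> in M. f \<omega> * real_cond_exp M (G k) d \<omega> = 0" by eventually_elim simp
  then have "expectation (\<lambda>\<omega>. f \<omega> * real_cond_exp M (G k) d \<omega>) = 0" by (rule integral_eq_zero_AE)
  then show ?thesis using expectation_mult_cond_exp[OF f(1) d(1) f(2) d(2)] by simp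
qed

text \<open>Discrete Doob decomposition: the compensator \<open>\<Sum>k<n. a k\<close> of a supermartingale dominated by
  \<open>\<xi>\<close> has second moment at most \<open>16\<close> times that of \<open>\<xi>\<close>.\<close>

lemma supermartingale_quadratic_variation:
  fixes x :: "nat \<Rightarrow> 'a \<Rightarrow> real"
  assumes x: "\<And>k. x k \<in> borel_measurable (G k)"
    and \<xi>: "\<xi> \<in> borel_measurable M" "integrable M (\<lambda>\<omega>. (\<xi> \<omega>)\<^sup>2)"
    and dom: "\<And>k. AE \<omega> in M. \<bar>x k \<omega>\<bar> \<le> \<xi> \<omega>"
    and super: "\<And>k A. A \<in> sets (G k) \<Longrightarrow> expectation (\<lambda>\<omega>. indicator A \<omega> * (x (Suc k) \<omega> - x k \<omega>)) \<le> 0"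
  shows "expectation (\<lambda>\<omega>. \<Sum>k<n. (x (Suc k) \<omega> - x k \<omega>)\<^sup>2) \<le> 18 * expectation (\<lambda>\<omega>. (\<xi> \<omega>)\<^sup>2)"
proof -
  have xM[measurable]: "x k \<in> borel_measurable M" for k by (rule measurable_G_M[OF x])
  note [measurable] = \<xi>(1)
  have x2: "integrable M (\<lambda>\<omega>. (x k \<omega>)\<^sup>2)" for k
  proof (rule Bochner_Integration.integrable_bound[OF \<xi>(2)])
    show "AE \<omega> in M. norm ((x k \<omega>)\<^sup>2) \<le> norm ((\<xi> \<omega>)\<^sup>2)"
      using dom[of k] by eventually_elim (auto simp: abs_le_square_iff[symmetric])
  qed measurable
  define d where "d k \<omega> = x (Suc k) \<omega> - x k \<omega>" for k \<omega>
  have dM[measurable]: "d k \<in> borel_measurable M" for k unfolding d_def by measurable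
  have d2: "integrable M (\<lambda>\<omega>. (d k \<omega>)\<^sup>2)" for k
    unfolding d_def by (rule integrable_square_diff[OF xM xM x2 x2])
  define a where "a k \<omega> = - real_cond_exp M (G k) (d k) \<omega>" for k \<omega>
  have aG: "a k \<in> borel_measurable (G k)" for k unfolding a_def by measurable
  have aM[measurable]: "a k \<in> borel_measurable M" for k by (rule measurable_G_M[OF aG])
  have a2: "integrable M (\<lambda>\<omega>. (a k \<omega>)\<^sup>2)" for k
  proof -
    interpret K: finite_measure_subalgebra M "G k" by unfold_locales (rule subalgebra_G)
    have "integrable M (\<lambda>\<omega>. (real_cond_exp M (G k) (d k) \<omega>)\<^sup>2)"
      by (rule K.integrable_convex_cond_exp[where I=UNIV and q="\<lambda>x. x\<^sup>2"])
        (use integrable_of_square[OF dM d2] d2 convex_power2 in simp_all)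
    then show ?thesis by (simp add: a_def)
  qed
  have a0: "AE \<omega> in M. 0 \<le> a k \<omega>" for k
  proof -
    interpret K: finite_measure_subalgebra M "G k" by unfold_locales (rule subalgebra_G)
    define A where "A = {\<omega> \<in> space (G k). a k \<omega> < 0}"
    have A: "A \<in> sets (G k)" unfolding A_def using aG[of k] by measurable
    then have AM: "A \<in> sets M" using subalgebra_G[of k] by (auto simp: subalgebra_def)
    have di: "integrable M (d k)" by (rule integrable_of_square[OF dM d2])
    have ai: "integrable M (a k)" by (rule integrable_of_square[OF aM a2])
    have "expectation (\<lambda>\<omega>. indicator A \<omega> * a k \<omega>) = - expectation (\<lambda>\<omega>. indicator A \<omega> * d k \<omega>)"
      using K.real_cond_exp_intA[OF di A] by (simp add: set_lebesgue_integral_def a_def)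
    then have "0 \<le> expectation (\<lambda>\<omega>. indicator A \<omega> * a k \<omega>)"
      using super[OF A] by (simp add: d_def)
    then have "expectation (\<lambda>\<omega>. - (indicator A \<omega> * a k \<omega>)) \<le> 0" by simp
    moreover have nn: "0 \<le> - (indicator A \<omega> * a k \<omega>)" for \<omega> by (auto simp: A_def indicator_def)
    ultimately have "expectation (\<lambda>\<omega>. - (indicator A \<omega> * a k \<omega>)) = 0"
      by (intro antisym integral_nonneg_AE) auto
    moreover have "integrable M (\<lambda>\<omega>. - (indicator A \<omega> * a k \<omega>))"
      using integrable_indicator_times[OF AM ai] by simp
    ultimately have "AE \<omega> in M. - (indicator A \<omega> * a k \<omega>) = 0"
      using nn integral_nonneg_eq_0_iff_AE[of M "\<lambda>\<omega>. - (indicator A \<omega> * a k \<omega>)"] by simp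
    then show ?thesis
      using AE_space
    proof eventually_elim
      case (elim \<omega>)
      show ?case
      proof (rule ccontr)
        assume "\<not> 0 \<le> a k \<omega>"
        then have "\<omega> \<in> A" using elim(2) subalgebra_G[of k] by (simp add: A_def subalgebra_def)
        then show False using elim(1) \<open>\<not> 0 \<le> a k \<omega>\<close> by simp
      qed
    qed
  qed
  have comp: "expectation (\<lambda>\<omega>. f \<omega> * a k \<omega>) = - expectation (\<lambda>\<omega>. f \<omega> * d k \<omega>)"
    if "f \<in> borel_measurable (G k)" "integrable M (\<lambda>\<omega>. (f \<omega>)\<^sup>2)" for f k
    using expectation_mult_cond_exp[OF that(1) dM that(2) d2] by (simp add: a_def)
  have aa: "integrable M (\<lambda>\<omega>. a k \<omega> * a l \<omega>)" for k l by (rule integrable_mult_of_squares[OF aM aM a2 a2])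
  have ad: "integrable M (\<lambda>\<omega>. a k \<omega> * d l \<omega>)" for k l by (rule integrable_mult_of_squares[OF aM dM a2 d2])
  have a\<xi>: "integrable M (\<lambda>\<omega>. a k \<omega> * \<xi> \<omega>)" for k by (rule integrable_mult_of_squares[OF aM \<xi>(1) a2 \<xi>(2)])
  define K where "K = expectation (\<lambda>\<omega>. (\<xi> \<omega>)\<^sup>2)"
  define A where "A n \<omega> = (\<Sum>k<n. a k \<omega>)" for n \<omega>
  have AM[measurable]: "A n \<in> borel_measurable M" for n unfolding A_def by measurable
  have A2: "integrable M (\<lambda>\<omega>. (A n \<omega>)\<^sup>2)" for n
    unfolding A_def by (rule integrable_square_sum) (simp_all add: a2)
  have A\<xi>: "integrable M (\<lambda>\<omega>. A n \<omega> * \<xi> \<omega>)" for n by (rule integrable_mult_of_squares[OF AM \<xi>(1) A2 \<xi>(2)])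
  \<comment> \<open>Since \<open>a k\<close> is known at every later step \<open>l\<close>, each
    \<open>a l\<close> may be replaced by \<open>- d l\<close> in the expectation, and the sum
    telescopes to \<open>x k - x n\<close>. This is at most \<open>2 * \<xi>\<close>, and
    \<open>a k\<close> is nonnegative.\<close>
  have step: "expectation (\<lambda>\<omega>. \<Sum>l=k..<n. a k \<omega> * a l \<omega>) \<le> 2 * expectation (\<lambda>\<omega>. a k \<omega> * \<xi> \<omega>)" if "k < n" for k
  proof -
    have "expectation (\<lambda>\<omega>. \<Sum>l=k..<n. a k \<omega> * a l \<omega>) = (\<Sum>l=k..<n. expectation (\<lambda>\<omega>. a k \<omega> * a l \<omega>))"
      by (rule Bochner_Integration.integral_sum) (rule aa)
    also have "\<dots> = (\<Sum>l=k..<n. - expectation (\<lambda>\<omega>. a k \<omega> * d l \<omega>))"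
      by (intro sum.cong refl comp a2 measurable_G_mono[OF _ aG]) simp
    also have "\<dots> = - expectation (\<lambda>\<omega>. \<Sum>l=k..<n. a k \<omega> * d l \<omega>)"
      by (simp add: sum_negf Bochner_Integration.integral_sum ad)
    also have "(\<lambda>\<omega>. \<Sum>l=k..<n. a k \<omega> * d l \<omega>) = (\<lambda>\<omega>. a k \<omega> * (x n \<omega> - x k \<omega>))"
      unfolding sum_distrib_left[symmetric] d_def sum_Suc_diff'[OF less_imp_le[OF that], of "\<lambda>k. x k _"] ..
    also have "- expectation (\<lambda>\<omega>. a k \<omega> * (x n \<omega> - x k \<omega>)) = expectation (\<lambda>\<omega>. - (a k \<omega> * (x n \<omega> - x k \<omega>)))" by simp
    also have "\<dots> \<le> expectation (\<lambda>\<omega>. 2 * (a k \<omega> * \<xi> \<omega>))"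
    proof (rule integral_mono_AE)
      show "integrable M (\<lambda>\<omega>. - (a k \<omega> * (x n \<omega> - x k \<omega>)))"
        by (intro Bochner_Integration.integrable_minus integrable_mult_of_squares aM a2 integrable_square_diff xM x2) measurable
      show "AE \<omega> in M. - (a k \<omega> * (x n \<omega> - x k \<omega>)) \<le> 2 * (a k \<omega> * \<xi> \<omega>)"
        using a0[of k] dom[of n] dom[of k]
      proof eventually_elim
        case (elim \<omega>)
        have "a k \<omega> * (- (x n \<omega> - x k \<omega>)) \<le> a k \<omega> * (2 * \<xi> \<omega>)" using elim by (intro mult_left_mono) auto
        then show ?case by (simp add: algebra_simps)
      qed
    qed (use a\<xi> in simp)
    finally show ?thesis by simp
  qed
  \<comment> \<open>The double sum runs over \<open>k \<le> l\<close>. Doubling it counts the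
    diagonal twice, hence an inequality without any sign condition on \<open>c\<close>.\<close>
  have square: "(\<Sum>k<n. c k)\<^sup>2 \<le> 2 * (\<Sum>k<n. \<Sum>l=k..<n. c k * c l)" for c :: "nat \<Rightarrow> real" and n
  proof (induction n)
    case (Suc n)
    have "(\<Sum>k<Suc n. \<Sum>l=k..<Suc n. c k * c l) = (\<Sum>k<n. \<Sum>l=k..<Suc n. c k * c l) + c n * c n"
      by simp
    also have "(\<Sum>k<n. \<Sum>l=k..<Suc n. c k * c l) = (\<Sum>k<n. (\<Sum>l=k..<n. c k * c l) + c k * c n)"
      by (intro sum.cong refl) simp
    also have "(\<Sum>k<n. (\<Sum>l=k..<n. c k * c l) + c k * c n) = (\<Sum>k<n. \<Sum>l=k..<n. c k * c l) + (\<Sum>k<n. c k) * c n"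
      by (simp only: sum.distrib sum_distrib_right)
    finally have "2 * (\<Sum>k<Suc n. \<Sum>l=k..<Suc n. c k * c l) \<ge> (\<Sum>k<n. c k)\<^sup>2 + 2 * ((\<Sum>k<n. c k) * c n) + 2 * (c n)\<^sup>2"
      using Suc unfolding power2_eq_square[of "c n"] by linarith
    moreover have "(\<Sum>k<Suc n. c k)\<^sup>2 = (\<Sum>k<n. c k)\<^sup>2 + 2 * ((\<Sum>k<n. c k) * c n) + (c n)\<^sup>2"
      unfolding sum.lessThan_Suc power2_sum by simp
    ultimately show ?case using zero_le_power2[of "c n"] by linarith
  qed simp
  \<comment> \<open>The previous estimates give at most four times the mean of
    \<open>A n * \<xi>\<close>. Young's inequality bounds this by half the mean of
    \<open>(A n)\<^sup>2\<close> plus \<open>8 * K\<close>; absorbing the half yields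
    \<open>16\<close>.\<close>
  have A16: "expectation (\<lambda>\<omega>. (A n \<omega>)\<^sup>2) \<le> 16 * K"
  proof -
    have "expectation (\<lambda>\<omega>. (A n \<omega>)\<^sup>2) \<le> expectation (\<lambda>\<omega>. 2 * (\<Sum>k<n. \<Sum>l=k..<n. a k \<omega> * a l \<omega>))"
      unfolding A_def using A2[of n, unfolded A_def] aa
      by (intro integral_mono square Bochner_Integration.integrable_mult_right Bochner_Integration.integrable_sum) auto
    also have "\<dots> = 2 * (\<Sum>k<n. expectation (\<lambda>\<omega>. \<Sum>l=k..<n. a k \<omega> * a l \<omega>))"
      using aa by (simp add: Bochner_Integration.integral_sum)
    also have "\<dots> \<le> 2 * (\<Sum>k<n. 2 * expectation (\<lambda>\<omega>. a k \<omega> * \<xi> \<omega>))"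
      using step by (intro mult_left_mono sum_mono) auto
    also have "\<dots> = 4 * expectation (\<lambda>\<omega>. A n \<omega> * \<xi> \<omega>)"
      using a\<xi> by (simp add: A_def sum_distrib_right Bochner_Integration.integral_sum sum_distrib_left)
    also have "\<dots> = expectation (\<lambda>\<omega>. 4 * (A n \<omega> * \<xi> \<omega>))" by simp
    also have "\<dots> \<le> expectation (\<lambda>\<omega>. (A n \<omega>)\<^sup>2 / 2 + 8 * (\<xi> \<omega>)\<^sup>2)"
    proof (rule integral_mono)
      fix \<omega>
      have "0 \<le> (A n \<omega> - 4 * \<xi> \<omega>)\<^sup>2" by simp
      then show "4 * (A n \<omega> * \<xi> \<omega>) \<le> (A n \<omega>)\<^sup>2 / 2 + 8 * (\<xi> \<omega>)\<^sup>2" by (simp add: power2_eq_square algebra_simps)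
    qed (use A\<xi> A2 \<xi>(2) in simp_all)
    also have "\<dots> = expectation (\<lambda>\<omega>. (A n \<omega>)\<^sup>2) / 2 + 8 * K" using A2 \<xi>(2) by (simp add: K_def)
    finally show ?thesis by simp
  qed
  have xd: "integrable M (\<lambda>\<omega>. x k \<omega> * d k \<omega>)" for k by (rule integrable_mult_of_squares[OF xM dM x2 d2])
  have xa: "integrable M (\<lambda>\<omega>. x k \<omega> * a k \<omega>)" for k by (rule integrable_mult_of_squares[OF xM aM x2 a2])
  \<comment> \<open>Discrete Ito formula. In the mean the sum of \<open>x k * d k\<close> becomes
    minus that of \<open>x k * a k\<close>, so the quadratic variation costs at most
    \<open>K\<close> for the terminal square plus twice the mean of \<open>A n * \<xi>\<close>,
    itself at most \<open>16 * K + K\<close>; altogether \<open>18 * K\<close>.\<close>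
  have tele: "(\<Sum>k<n. (d k \<omega>)\<^sup>2) = (x n \<omega>)\<^sup>2 - (x 0 \<omega>)\<^sup>2 - 2 * (\<Sum>k<n. x k \<omega> * d k \<omega>)" for n \<omega>
    by (induction n) (simp_all add: d_def power2_eq_square algebra_simps)
  have "expectation (\<lambda>\<omega>. \<Sum>k<n. (d k \<omega>)\<^sup>2)
      = expectation (\<lambda>\<omega>. (x n \<omega>)\<^sup>2) - expectation (\<lambda>\<omega>. (x 0 \<omega>)\<^sup>2) - 2 * (\<Sum>k<n. expectation (\<lambda>\<omega>. x k \<omega> * d k \<omega>))"
    unfolding tele using x2 xd by (simp add: Bochner_Integration.integral_sum)
  also have "(\<Sum>k<n. expectation (\<lambda>\<omega>. x k \<omega> * d k \<omega>)) = (\<Sum>k<n. - expectation (\<lambda>\<omega>. x k \<omega> * a k \<omega>))"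
    using comp[OF x x2] by simp
  also have "expectation (\<lambda>\<omega>. (x n \<omega>)\<^sup>2) - expectation (\<lambda>\<omega>. (x 0 \<omega>)\<^sup>2) - 2 * (\<Sum>k<n. - expectation (\<lambda>\<omega>. x k \<omega> * a k \<omega>))
      \<le> K + 2 * (\<Sum>k<n. expectation (\<lambda>\<omega>. a k \<omega> * \<xi> \<omega>))"
  proof -
    have "expectation (\<lambda>\<omega>. (x n \<omega>)\<^sup>2) \<le> K"
      unfolding K_def
    proof (rule integral_mono_AE[OF x2 \<xi>(2)])
      show "AE \<omega> in M. (x n \<omega>)\<^sup>2 \<le> (\<xi> \<omega>)\<^sup>2"
        using dom[of n] by eventually_elim (auto simp: abs_le_square_iff[symmetric])
    qed
    moreover have "0 \<le> expectation (\<lambda>\<omega>. (x 0 \<omega>)\<^sup>2)" by (rule integral_nonneg_AE) simp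
    moreover have "(\<Sum>k<n. expectation (\<lambda>\<omega>. x k \<omega> * a k \<omega>)) \<le> (\<Sum>k<n. expectation (\<lambda>\<omega>. a k \<omega> * \<xi> \<omega>))"
    proof (intro sum_mono integral_mono_AE xa a\<xi>)
      show "AE \<omega> in M. x k \<omega> * a k \<omega> \<le> a k \<omega> * \<xi> \<omega>" for k
        using a0[of k] dom[of k]
      proof eventually_elim
        case (elim \<omega>)
        have "a k \<omega> * x k \<omega> \<le> a k \<omega> * \<xi> \<omega>" using elim by (intro mult_left_mono) auto
        then show ?case by (simp add: mult.commute)
      qed
    qed
    ultimately show ?thesis unfolding sum_negf by linarith
  qed
  also have "(\<Sum>k<n. expectation (\<lambda>\<omega>. a k \<omega> * \<xi> \<omega>)) = expectation (\<lambda>\<omega>. A n \<omega> * \<xi> \<omega>)"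
    using a\<xi> by (simp add: A_def sum_distrib_right Bochner_Integration.integral_sum)
  also have "K + 2 * expectation (\<lambda>\<omega>. A n \<omega> * \<xi> \<omega>) = K + expectation (\<lambda>\<omega>. 2 * (A n \<omega> * \<xi> \<omega>))" by simp
  also have "expectation (\<lambda>\<omega>. 2 * (A n \<omega> * \<xi> \<omega>)) \<le> expectation (\<lambda>\<omega>. (A n \<omega>)\<^sup>2 + (\<xi> \<omega>)\<^sup>2)"
  proof (rule integral_mono)
    fix \<omega>
    have "0 \<le> (A n \<omega> - \<xi> \<omega>)\<^sup>2" by simp
    then show "2 * (A n \<omega> * \<xi> \<omega>) \<le> (A n \<omega>)\<^sup>2 + (\<xi> \<omega>)\<^sup>2" by (simp add: power2_eq_square algebra_simps)
  qed (use A\<xi> A2 \<xi>(2) in simp_all)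
  also have "expectation (\<lambda>\<omega>. (A n \<omega>)\<^sup>2 + (\<xi> \<omega>)\<^sup>2) = expectation (\<lambda>\<omega>. (A n \<omega>)\<^sup>2) + K"
    using A2 \<xi>(2) by (simp add: K_def)
  finally show ?thesis using A16 by (simp add: d_def K_def)
qed

text \<open>Orthogonality of the differences identifies the second moment of the partial sums with
  the mean quadratic variation, which is bounded uniformly in \<open>n\<close>. The maximal
  inequality and monotone convergence pass from finite maxima to the supremum.\<close>

lemma martingale_sup_finite:
  fixes d :: "nat \<Rightarrow> 'a \<Rightarrow> real"
  assumes d: "\<And>k. d k \<in> borel_measurable (G (Suc k))" "\<And>k. integrable M (\<lambda>\<omega>. (d k \<omega>)\<^sup>2)"
    and mart: "\<And>k A. A \<in> sets (G k) \<Longrightarrow> expectation (\<lambda>\<omega>. indicator A \<omega> * d k \<omega>) = 0"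
    and K: "\<And>n. expectation (\<lambda>\<omega>. \<Sum>k<n. (d k \<omega>)\<^sup>2) \<le> K"
  shows "(\<integral>\<^sup>+\<omega>. (SUP n. ennreal \<bar>\<Sum>k<n. d k \<omega>\<bar>) \<partial>M) < \<infinity>"
proof -
  have dM[measurable]: "d k \<in> borel_measurable M" for k by (rule measurable_G_M[OF d(1)])
  define N where "N n \<omega> = (\<Sum>k<n. d k \<omega>)" for n \<omega>
  have NG: "N n \<in> borel_measurable (G n)" for n
    unfolding N_def by (intro borel_measurable_sum measurable_G_mono[OF _ d(1)]) auto
  have NM[measurable]: "N n \<in> borel_measurable M" for n by (rule measurable_G_M[OF NG])
  have N2: "integrable M (\<lambda>\<omega>. (N n \<omega>)\<^sup>2)" for n
    unfolding N_def by (rule integrable_square_sum) (simp_all add: d(2))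
  have orth: "expectation (\<lambda>\<omega>. f \<omega> * d k \<omega>) = 0"
    if "f \<in> borel_measurable (G k)" "integrable M (\<lambda>\<omega>. (f \<omega>)\<^sup>2)" for f k
    by (rule expectation_mult_martingale_difference[OF dM d(2) mart that])
  have second: "expectation (\<lambda>\<omega>. (N n \<omega>)\<^sup>2) = expectation (\<lambda>\<omega>. \<Sum>k<n. (d k \<omega>)\<^sup>2)" for n
  proof (induction n)
    case (Suc n)
    have "(\<lambda>\<omega>. (N (Suc n) \<omega>)\<^sup>2) = (\<lambda>\<omega>. (N n \<omega>)\<^sup>2 + 2 * (N n \<omega> * d n \<omega>) + (d n \<omega>)\<^sup>2)"
      by (rule ext) (simp add: N_def power2_sum algebra_simps)
    then have "expectation (\<lambda>\<omega>. (N (Suc n) \<omega>)\<^sup>2)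
        = expectation (\<lambda>\<omega>. (N n \<omega>)\<^sup>2) + 2 * expectation (\<lambda>\<omega>. N n \<omega> * d n \<omega>) + expectation (\<lambda>\<omega>. (d n \<omega>)\<^sup>2)"
      using N2[of n] d(2)[of n] integrable_mult_of_squares[OF NM dM N2 d(2), of n n] by simp
    also have "expectation (\<lambda>\<omega>. N n \<omega> * d n \<omega>) = 0" by (rule orth[OF NG N2])
    finally show ?case using Suc d(2) by (simp add: Bochner_Integration.integral_sum)
  qed (simp add: N_def)
  \<comment> \<open>The condition on \<open>c\<close> covers exactly the signs \<open>1\<close> and
    \<open>-1\<close>, treating the martingale and its negative at once.\<close>
  have maximal: "integrable M (\<lambda>\<omega>. (running_max (\<lambda>k. c * N k \<omega>) n)\<^sup>2) \<and>
      expectation (\<lambda>\<omega>. (running_max (\<lambda>k. c * N k \<omega>) n)\<^sup>2) \<le> 4 * K" if c: "c\<^sup>2 = 1" for c n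
  proof -
    define R where "R n \<omega> = running_max (\<lambda>k. c * N k \<omega>) n" for n \<omega>
    have RG: "R n \<in> borel_measurable (G n)" for n
    proof (induction n)
      case (Suc n)
      have "(\<lambda>\<omega>. max (R n \<omega>) (c * N (Suc n) \<omega>)) \<in> borel_measurable (G (Suc n))"
        using measurable_G_mono[OF _ Suc, of "Suc n"] NG[of "Suc n"] by (intro borel_measurable_max borel_measurable_times) auto
      then show ?case by (simp add: R_def[abs_def])
    qed (simp add: R_def N_def)
    have RM[measurable]: "R n \<in> borel_measurable M" for n by (rule measurable_G_M[OF RG])
    have c2: "(c * y)\<^sup>2 = y\<^sup>2" for y using c by (simp add: power_mult_distrib)
    have R2: "integrable M (\<lambda>\<omega>. (R n \<omega>)\<^sup>2)" for n
    proof (rule Bochner_Integration.integrable_bound)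
      show "integrable M (\<lambda>\<omega>. \<Sum>k\<le>n. (N k \<omega>)\<^sup>2)" using N2 by simp
      show "AE \<omega> in M. norm ((R n \<omega>)\<^sup>2) \<le> norm (\<Sum>k\<le>n. (N k \<omega>)\<^sup>2)"
        using running_max_square_le[of "\<lambda>k. c * N k _" n]
        by (intro AE_I2) (simp add: R_def c2 sum_nonneg)
    qed measurable
    have int: "integrable M (\<lambda>\<omega>. c * (R k \<omega> * d k \<omega>))" for k
      using integrable_mult_of_squares[OF RM dM R2 d(2)] by simp
    have "expectation (\<lambda>\<omega>. (R n \<omega>)\<^sup>2) \<le> expectation (\<lambda>\<omega>. 4 * (N n \<omega>)\<^sup>2 - 4 * (\<Sum>k<n. c * (R k \<omega> * d k \<omega>)))"
    proof (rule integral_mono[OF R2])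
      show "integrable M (\<lambda>\<omega>. 4 * (N n \<omega>)\<^sup>2 - 4 * (\<Sum>k<n. c * (R k \<omega> * d k \<omega>)))"
        using N2 int by (intro Bochner_Integration.integrable_diff Bochner_Integration.integrable_mult_right Bochner_Integration.integrable_sum) auto
      fix \<omega>
      have "c * N (Suc k) \<omega> - c * N k \<omega> = c * d k \<omega>" for k by (simp add: N_def algebra_simps)
      then show "(R n \<omega>)\<^sup>2 \<le> 4 * (N n \<omega>)\<^sup>2 - 4 * (\<Sum>k<n. c * (R k \<omega> * d k \<omega>))"
        using running_max_pathwise[of "\<lambda>k. c * N k \<omega>" n] by (simp add: R_def c2 N_def mult.left_commute)
    qed
    also have "\<dots> = 4 * expectation (\<lambda>\<omega>. (N n \<omega>)\<^sup>2) - 4 * (\<Sum>k<n. c * expectation (\<lambda>\<omega>. R k \<omega> * d k \<omega>))"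
      using N2 int by (simp add: Bochner_Integration.integral_sum)
    also have "\<dots> = 4 * expectation (\<lambda>\<omega>. (N n \<omega>)\<^sup>2)" using orth[OF RG R2] by simp
    also have "\<dots> \<le> 4 * K" unfolding second using K[of n] by simp
    finally show ?thesis using R2[of n] by (simp add: R_def)
  qed
  \<comment> \<open>Nondecreasing in \<open>n\<close>, unlike the absolute partial sum itself, which
    is dominated by \<open>1 + S n\<close>. Each of the two signs contributes \<open>4 * K\<close>
    to its mean.\<close>
  define S where "S n \<omega> = (running_max (\<lambda>k. 1 * N k \<omega>) n)\<^sup>2 + (running_max (\<lambda>k. - 1 * N k \<omega>) n)\<^sup>2" for n \<omega>
  have S_int: "integrable M (S n)" and S_le: "expectation (S n) \<le> 8 * K" for n
    using maximal[of 1 n] maximal[of "-1" n] unfolding S_def by simp_all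
  have rm0: "0 \<le> running_max (\<lambda>k. c * N k \<omega>) n" for c n \<omega>
    using running_max_ge[of 0 n "\<lambda>k. c * N k \<omega>"] by (simp add: N_def)
  have N_S: "\<bar>N n \<omega>\<bar> \<le> 1 + S n \<omega>" for n \<omega>
  proof -
    let ?p = "running_max (\<lambda>k. 1 * N k \<omega>) n" and ?q = "running_max (\<lambda>k. - 1 * N k \<omega>) n"
    have "N n \<omega> \<le> ?p" "- N n \<omega> \<le> ?q"
      using running_max_ge[of n n "\<lambda>k. 1 * N k \<omega>"] running_max_ge[of n n "\<lambda>k. - 1 * N k \<omega>"] by simp_all
    moreover have "?p \<le> 1 + ?p\<^sup>2" "?q \<le> 1 + ?q\<^sup>2"
    proof -
      have "y \<le> 1 + y\<^sup>2" for y :: real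
        using zero_le_power2[of "y - 1 / 2"] by (simp add: power2_eq_square algebra_simps)
      then show "?p \<le> 1 + ?p\<^sup>2" "?q \<le> 1 + ?q\<^sup>2" by blast+
    qed
    moreover have "0 \<le> ?p\<^sup>2" "0 \<le> ?q\<^sup>2" by simp_all
    ultimately show ?thesis unfolding S_def by linarith
  qed
  have S0: "0 \<le> S n \<omega>" for n \<omega> by (simp add: S_def)
  have S_mono: "S n \<omega> \<le> S (Suc n) \<omega>" for n \<omega>
    unfolding S_def using rm0[of 1 \<omega> n] rm0[of "-1" \<omega> n] by (intro add_mono power_mono) auto
  have "(\<integral>\<^sup>+\<omega>. (SUP n. ennreal \<bar>\<Sum>k<n. d k \<omega>\<bar>) \<partial>M) \<le> (\<integral>\<^sup>+\<omega>. (SUP n. ennreal (1 + S n \<omega>)) \<partial>M)"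
    by (intro nn_integral_mono SUP_mono) (auto intro!: exI ennreal_leI N_S[unfolded N_def])
  also have "\<dots> = (SUP n. \<integral>\<^sup>+\<omega>. ennreal (1 + S n \<omega>) \<partial>M)"
  proof (rule nn_integral_monotone_convergence_SUP)
    show "incseq (\<lambda>n \<omega>. ennreal (1 + S n \<omega>))"
      by (intro incseq_SucI le_funI ennreal_leI add_left_mono S_mono)
    show "(\<lambda>\<omega>. ennreal (1 + S n \<omega>)) \<in> borel_measurable M" for n
      using borel_measurable_integrable[OF S_int[of n]] by measurable
  qed
  also have "\<dots> \<le> ennreal (1 + 8 * K)"
  proof (rule SUP_least)
    fix n
    have "(\<integral>\<^sup>+\<omega>. ennreal (1 + S n \<omega>) \<partial>M) = ennreal (expectation (\<lambda>\<omega>. 1 + S n \<omega>))"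
      using S_int[of n] S0 by (intro nn_integral_eq_integral) auto
    also have "expectation (\<lambda>\<omega>. 1 + S n \<omega>) = 1 + expectation (S n)" using S_int[of n] by (simp add: prob_space)
    finally show "(\<integral>\<^sup>+\<omega>. ennreal (1 + S n \<omega>) \<partial>M) \<le> ennreal (1 + 8 * K)"
      using S_le[of n] by (simp add: ennreal_leI)
  qed
  also have "\<dots> < \<infinity>" by simp
  finally show ?thesis .
qed

end

section \<open>Strategies\<close>

text \<open>The half-open intervals are disjoint, so exactly one summand survives. Simultaneous
  switches give empty intervals, which the hypotheses on \<open>s\<close> rule out.\<close>

lemma mode_indicator_Ioc:
  assumes mono: "\<And>n. \<tau> n \<omega> \<le> \<tau> (Suc n) \<omega>" and s: "\<tau> n \<omega> < s" "s \<le> \<tau> (Suc n) \<omega>"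
  shows "mode_indicator \<tau> \<iota> s \<omega> = \<iota> n \<omega>"
proof -
  have le: "\<tau> k \<omega> \<le> \<tau> l \<omega>" if "k \<le> l" for k l
    using that mono by (rule lift_Suc_mono_le[of "\<lambda>n. \<tau> n \<omega>", rotated])
  have iff: "\<tau> k \<omega> < s \<and> s \<le> \<tau> (Suc k) \<omega> \<longleftrightarrow> k = n" for k
  proof
    assume k: "\<tau> k \<omega> < s \<and> s \<le> \<tau> (Suc k) \<omega>"
    show "k = n"
    proof (rule antisym)
      show "k \<le> n" using le[of "Suc n" k] k s by (intro leI notI) auto
      show "n \<le> k" using le[of "Suc k" n] k s by (intro leI notI) auto
    qed
  qed (use s in simp)
  have suc: "indicator {\<tau> (Suc k) \<omega><..\<tau> (Suc (Suc k)) \<omega>} s = (of_bool (Suc k = n) :: nat)" for k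
    using iff[of "Suc k"] by (simp add: indicator_def)
  show ?thesis
  proof (cases n)
    case 0
    then have "indicator {\<tau> 0 \<omega>..\<tau> 1 \<omega>} s = (1 :: nat)" using s by (simp add: indicator_def)
    moreover have "(\<Sum>k. \<iota> (Suc k) \<omega> * indicator {\<tau> (Suc k) \<omega><..\<tau> (Suc (Suc k)) \<omega>} s) = 0"
      unfolding suc using 0 by simp
    ultimately show ?thesis using 0 unfolding mode_indicator_def by simp
  next
    case (Suc l)
    have "\<not> s \<le> \<tau> 1 \<omega>" using le[of 1 n] Suc s by simp
    then have "indicator {\<tau> 0 \<omega>..\<tau> 1 \<omega>} s = (0 :: nat)" by (simp add: indicator_def)
    moreover have "(\<Sum>k. \<iota> (Suc k) \<omega> * indicator {\<tau> (Suc k) \<omega><..\<tau> (Suc (Suc k)) \<omega>} s)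
        = (\<Sum>k\<in>{l}. \<iota> (Suc k) \<omega> * of_bool (Suc k = n))"
      unfolding suc by (rule suminf_finite) (use Suc in auto)
    ultimately show ?thesis using Suc unfolding mode_indicator_def by simp
  qed
qed

text \<open>Only the first interval is closed on the left, so the initial mode counts at the initial
  time even if switches are made at once. This determines the terminal mode when the problem starts
  at \<open>T\<close>.\<close>

lemma mode_indicator_start:
  assumes mono: "\<And>n. \<tau> n \<omega> \<le> \<tau> (Suc n) \<omega>"
  shows "mode_indicator \<tau> \<iota> (\<tau> 0 \<omega>) \<omega> = \<iota> 0 \<omega>"
proof -
  have "\<tau> 0 \<omega> \<le> \<tau> (Suc k) \<omega>" for k
    using mono by (rule lift_Suc_mono_le[of "\<lambda>n. \<tau> n \<omega>"]) simp
  then have "indicator {\<tau> (Suc k) \<omega><..\<tau> (Suc (Suc k)) \<omega>} (\<tau> 0 \<omega>) = (0 :: nat)" for k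
    by (simp add: indicator_def not_less)
  moreover have "indicator {\<tau> 0 \<omega>..\<tau> 1 \<omega>} (\<tau> 0 \<omega>) = (1 :: nat)" using mono[of 0] by (simp add: indicator_def)
  ultimately show ?thesis unfolding mode_indicator_def by simp
qed

text \<open>A strategy with path conditions on the times at every point, but without the
  requirements that \<open>T\<close> be reached and that the costs have an integrable supremum: for
  the candidate those two are to be proved.\<close>

locale switching_plan = switching_system M F T m \<psi> \<gamma> \<Gamma> Y
  for M :: "'a measure" and F :: "real \<Rightarrow> 'a measure" and T :: real and m :: nat
    and \<psi> :: "nat \<Rightarrow> real \<Rightarrow> 'a \<Rightarrow> real"
    and \<gamma> :: "nat \<Rightarrow> nat \<Rightarrow> real \<Rightarrow> 'a \<Rightarrow> real"
    and \<Gamma> :: "nat \<Rightarrow> 'a \<Rightarrow> real"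
    and Y :: "nat \<Rightarrow> real \<Rightarrow> 'a \<Rightarrow> real" +
  fixes t :: real and i :: nat and \<tau> :: "nat \<Rightarrow> 'a \<Rightarrow> real" and \<iota> :: "nat \<Rightarrow> 'a \<Rightarrow> nat"
  assumes t: "t \<in> {0..T}" and i: "i \<in> {1..m}"
    and \<tau>_bt: "\<And>n. \<tau> n \<in> bounded_times"
    and \<tau>_Suc: "\<And>n \<omega>. \<tau> n \<omega> \<le> \<tau> (Suc n) \<omega>"
    and \<tau>_0: "\<And>\<omega>. \<tau> 0 \<omega> = t"
    and \<iota>_measurable: "\<And>n. \<iota> n \<in> measurable (pre_sigma (\<tau> n)) (count_space {1..m})"
    and \<iota>_0: "\<And>\<omega>. \<omega> \<in> space M \<Longrightarrow> \<iota> 0 \<omega> = i"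
    and \<iota>_Suc: "\<And>n \<omega>. \<omega> \<in> space M \<Longrightarrow> \<iota> n \<omega> \<noteq> \<iota> (Suc n) \<omega>"
begin

sublocale discrete_filtration M "\<lambda>k. pre_sigma (\<tau> k)"
proof
  show "subalgebra M (pre_sigma (\<tau> k))" for k by (rule subalgebra_pre_sigma[OF \<tau>_bt])
  show "sets (pre_sigma (\<tau> k)) \<subseteq> sets (pre_sigma (\<tau> (Suc k)))" for k
    by (rule mono_pre_sigma[OF bounded_timesD(1)[OF \<tau>_bt] bounded_timesD(1)[OF \<tau>_bt] \<tau>_Suc])
qed

lemma \<iota>_range: "\<omega> \<in> space M \<Longrightarrow> \<iota> n \<omega> \<in> {1..m}"
  using measurable_space[OF \<iota>_measurable[of n], of \<omega>] by (simp add: space_pre_sigma)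

lemma \<tau>_range: "0 \<le> \<tau> n \<omega>" "\<tau> n \<omega> \<le> T"
  using bounded_timesD[OF \<tau>_bt] by auto

lemma \<tau>_le: "k \<le> n \<Longrightarrow> \<tau> k \<omega> \<le> \<tau> n \<omega>"
  by (rule lift_Suc_mono_le[of "\<lambda>n. \<tau> n \<omega>", OF \<tau>_Suc])

lemma \<iota>_measurable_later:
  assumes "n \<le> k" shows "\<iota> n \<in> measurable (pre_sigma (\<tau> k)) (count_space {1..m})"
proof (rule measurable_from_subalg[OF _ \<iota>_measurable])
  show "subalgebra (pre_sigma (\<tau> k)) (pre_sigma (\<tau> n))"
    using sets_G_mono[OF assms] by (simp add: subalgebra_def space_pre_sigma)
qed

lemma \<iota>_measurable_M: "\<iota> n \<in> measurable M (count_space {1..m})"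
  by (rule measurable_from_subalg[OF subalgebra_G \<iota>_measurable])

lemma mode_event: "{\<omega> \<in> space M. \<iota> k \<omega> = j} \<in> sets (pre_sigma (\<tau> k))"
proof (cases "j \<in> {1..m}")
  case True
  have "\<iota> k -` {j} \<inter> space (pre_sigma (\<tau> k)) \<in> sets (pre_sigma (\<tau> k))"
    by (rule measurable_sets[OF \<iota>_measurable]) (use True in simp)
  also have "\<iota> k -` {j} \<inter> space (pre_sigma (\<tau> k)) = {\<omega> \<in> space M. \<iota> k \<omega> = j}" by (auto simp: space_pre_sigma)
  finally show ?thesis .
next
  case False
  then have "{\<omega> \<in> space M. \<iota> k \<omega> = j} = {}" using \<iota>_range by blast
  then show ?thesis by (rule ssubst) (rule sets.empty_sets)
qed

definition gain :: "nat \<Rightarrow> 'a \<Rightarrow> real" where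
  "gain k \<omega> = X (\<iota> k \<omega>) (\<tau> (Suc k) \<omega>) \<omega> - X (\<iota> k \<omega>) (\<tau> k \<omega>) \<omega>"

text \<open>The loss at a switch before \<open>T\<close>. It is the sum of two terms that are
  nonnegative on regular paths: the distance of the current value from the switching value, and the
  distance of the chosen mode from the best one. It vanishes for the candidate.\<close>

definition defect :: "nat \<Rightarrow> 'a \<Rightarrow> real" where
  "defect k \<omega> = of_bool (\<tau> (Suc k) \<omega> < T) *
     (Y (\<iota> k \<omega>) (\<tau> (Suc k) \<omega>) \<omega> - Y (\<iota> (Suc k) \<omega>) (\<tau> (Suc k) \<omega>) \<omega>
      + \<gamma> (\<iota> k \<omega>) (\<iota> (Suc k) \<omega>) (\<tau> (Suc k) \<omega>) \<omega>)"

text \<open>Defined through its decomposition into gains and defects;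
  \<open>value_process_eq\<close> identifies it with profit minus costs plus the value at the
  \<open>n\<close>-th switching time.\<close>

definition value_process :: "nat \<Rightarrow> 'a \<Rightarrow> real" where
  "value_process n \<omega> = Y i t \<omega> + (\<Sum>k<n. gain k \<omega>) - (\<Sum>k<n. defect k \<omega>)"

definition running_profit :: "nat \<Rightarrow> 'a \<Rightarrow> real" where
  "running_profit n \<omega> = (\<Sum>k<n. \<Psi> (\<iota> k \<omega>) (\<tau> (Suc k) \<omega>) \<omega> - \<Psi> (\<iota> k \<omega>) (\<tau> k \<omega>) \<omega>)"

abbreviation cost :: "nat \<Rightarrow> 'a \<Rightarrow> real" where
  "cost \<equiv> cumulative_cost T \<gamma> \<tau> \<iota>"

definition payoff :: "'a \<Rightarrow> real" where
  "payoff \<omega> = (LINT s:{t..T}|lborel. \<psi> (mode_indicator \<tau> \<iota> s \<omega>) s \<omega>)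
       + \<Gamma> (mode_indicator \<tau> \<iota> T \<omega>) \<omega>
       - (\<Sum>n. \<gamma> (\<iota> n \<omega>) (\<iota> (Suc n) \<omega>) (\<tau> (Suc n) \<omega>) \<omega> * of_bool (\<tau> (Suc n) \<omega> < T))"

lemma cost_eq:
  "cost n \<omega> = (\<Sum>k<n. \<gamma> (\<iota> k \<omega>) (\<iota> (Suc k) \<omega>) (\<tau> (Suc k) \<omega>) \<omega> * of_bool (\<tau> (Suc k) \<omega> < T))"
  unfolding cumulative_cost_def by (simp add: sum.atLeast1_atMost_eq)

lemma gain_measurable: "gain k \<in> borel_measurable (pre_sigma (\<tau> (Suc k)))"
  unfolding gain_def[abs_def]
proof (rule measurable_compose_countable'[where f="\<lambda>j \<omega>. X j (\<tau> (Suc k) \<omega>) \<omega> - X j (\<tau> k \<omega>) \<omega>", OF _ \<iota>_measurable_later])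
  fix j assume j: "j \<in> {1..m}"
  have "(\<lambda>\<omega>. X j (\<tau> n \<omega>) \<omega>) \<in> borel_measurable (pre_sigma (\<tau> n))" for n
    by (rule borel_measurable_stopped[OF space_Q_adapted[OF X_space_Q[OF j]] \<tau>_bt])
  from borel_measurable_diff[OF this[of "Suc k"] measurable_G_mono[OF _ this[of k]]]
  show "(\<lambda>\<omega>. X j (\<tau> (Suc k) \<omega>) \<omega> - X j (\<tau> k \<omega>) \<omega>) \<in> borel_measurable (pre_sigma (\<tau> (Suc k)))" by simp
qed simp_all

lemma cost_term_measurable:
  "(\<lambda>\<omega>. \<gamma> (\<iota> k \<omega>) (\<iota> (Suc k) \<omega>) (\<tau> (Suc k) \<omega>) \<omega>) \<in> borel_measurable M"
proof (rule measurable_compose_countable'[where f="\<lambda>a \<omega>. \<gamma> a (\<iota> (Suc k) \<omega>) (\<tau> (Suc k) \<omega>) \<omega>", OF _ \<iota>_measurable_M])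
  fix a assume a: "a \<in> {1..m}"
  show "(\<lambda>\<omega>. \<gamma> a (\<iota> (Suc k) \<omega>) (\<tau> (Suc k) \<omega>) \<omega>) \<in> borel_measurable M"
  proof (rule measurable_compose_countable'[where f="\<lambda>b \<omega>. \<gamma> a b (\<tau> (Suc k) \<omega>) \<omega>", OF _ \<iota>_measurable_M])
    fix b assume b: "b \<in> {1..m}"
    have "\<gamma> a b \<in> space_Q M F T" using gamma_Q_S2[OF a b] by simp
    then show "(\<lambda>\<omega>. \<gamma> a b (\<tau> (Suc k) \<omega>) \<omega>) \<in> borel_measurable M"
      by (rule borel_measurable_stopped_M[OF space_Q_adapted \<tau>_bt])
  qed simp
qed simp

lemma \<tau>_measurable: "\<tau> n \<in> borel_measurable M"
  by (rule measurable_stopping_time[OF bounded_timesD(1)[OF \<tau>_bt] F_subset space_F])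

lemma Y_mode_measurable: "(\<lambda>\<omega>. Y (\<iota> k \<omega>) (\<tau> n \<omega>) \<omega>) \<in> borel_measurable M"
proof (rule measurable_compose_countable'[OF _ \<iota>_measurable_M])
  fix j assume "j \<in> {1..m}"
  then show "(\<lambda>\<omega>. Y j (\<tau> n \<omega>) \<omega>) \<in> borel_measurable M"
    by (rule borel_measurable_stopped_M[OF space_Q_adapted[OF Y_spaces(1)] \<tau>_bt])
qed simp

lemma defect_measurable: "defect k \<in> borel_measurable M"
proof -
  note [measurable] = cost_term_measurable Y_mode_measurable \<tau>_measurable
  show ?thesis unfolding defect_def[abs_def] by measurable
qed

lemma cost_measurable: "cost n \<in> borel_measurable M"
proof -
  note [measurable] = cost_term_measurable \<tau>_measurable
  show ?thesis unfolding cost_eq[abs_def] by measurable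
qed

text \<open>Collects the almost sure properties of all modes in one event, so that the arguments
  along a path are free of null sets.\<close>

definition regular :: "'a \<Rightarrow> bool" where
  "regular \<omega> \<longleftrightarrow> \<omega> \<in> space M \<and> (\<forall>j\<in>{1..m}. (\<forall>s\<in>{0..T}. \<bar>X j s \<omega>\<bar> \<le> \<xi> \<omega>) \<and> (\<forall>s\<in>{0..T}. \<bar>Y j s \<omega>\<bar> \<le> \<xi> \<omega>) \<and>
     (\<forall>s\<in>{0..T}. L j s \<omega> \<le> Y j s \<omega>) \<and> Y j T \<omega> = \<Gamma> j \<omega> \<and> set_integrable lborel {0..T} (\<lambda>s. \<psi> j s \<omega>))"

lemma AE_regular: "AE \<omega> in M. regular \<omega>"
proof -
  have "AE \<omega> in M. \<forall>j\<in>{1..m}. (\<forall>s\<in>{0..T}. \<bar>X j s \<omega>\<bar> \<le> \<xi> \<omega>) \<and> (\<forall>s\<in>{0..T}. \<bar>Y j s \<omega>\<bar> \<le> \<xi> \<omega>) \<and>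
     (\<forall>s\<in>{0..T}. L j s \<omega> \<le> Y j s \<omega>) \<and> Y j T \<omega> = \<Gamma> j \<omega> \<and> set_integrable lborel {0..T} (\<lambda>s. \<psi> j s \<omega>)"
  proof (rule AE_finite_allI)
    fix j assume j: "j \<in> {1..m}"
    show "AE \<omega> in M. (\<forall>s\<in>{0..T}. \<bar>X j s \<omega>\<bar> \<le> \<xi> \<omega>) \<and> (\<forall>s\<in>{0..T}. \<bar>Y j s \<omega>\<bar> \<le> \<xi> \<omega>) \<and>
     (\<forall>s\<in>{0..T}. L j s \<omega> \<le> Y j s \<omega>) \<and> Y j T \<omega> = \<Gamma> j \<omega> \<and> set_integrable lborel {0..T} (\<lambda>s. \<psi> j s \<omega>)"
      using dominated_X[OF j, unfolded dominated_def] dominated_Y[OF j, unfolded dominated_def]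
        Y_L_ge[OF j] Y_terminal[OF j] space_M2_square_integral(1)[OF psi_M2[OF j]]
      by (intro AE_conjI)
  qed simp
  then show ?thesis using AE_space by eventually_elim (simp add: regular_def)
qed

lemma regularD:
  assumes "regular \<omega>"
  shows "\<omega> \<in> space M"
    and "j \<in> {1..m} \<Longrightarrow> s \<in> {0..T} \<Longrightarrow> \<bar>X j s \<omega>\<bar> \<le> \<xi> \<omega>"
    and "j \<in> {1..m} \<Longrightarrow> s \<in> {0..T} \<Longrightarrow> \<bar>Y j s \<omega>\<bar> \<le> \<xi> \<omega>"
    and "j \<in> {1..m} \<Longrightarrow> s \<in> {0..T} \<Longrightarrow> L j s \<omega> \<le> Y j s \<omega>"
    and "j \<in> {1..m} \<Longrightarrow> Y j T \<omega> = \<Gamma> j \<omega>"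
    and "j \<in> {1..m} \<Longrightarrow> set_integrable lborel {0..T} (\<lambda>s. \<psi> j s \<omega>)"
  using assms unfolding regular_def by blast+

lemma defect_nonneg: "regular \<omega> \<Longrightarrow> 0 \<le> defect k \<omega>"
proof -
  assume r: "regular \<omega>"
  note \<omega> = regularD(1)[OF r]
  have s: "\<tau> (Suc k) \<omega> \<in> {0..T}" using \<tau>_range by simp
  have "Y (\<iota> (Suc k) \<omega>) (\<tau> (Suc k) \<omega>) \<omega> - \<gamma> (\<iota> k \<omega>) (\<iota> (Suc k) \<omega>) (\<tau> (Suc k) \<omega>) \<omega> \<le> L (\<iota> k \<omega>) (\<tau> (Suc k) \<omega>) \<omega>"
    by (rule L_ge[OF \<iota>_range[OF \<omega>] \<iota>_Suc[OF \<omega>, symmetric]])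
  also have "\<dots> \<le> Y (\<iota> k \<omega>) (\<tau> (Suc k) \<omega>) \<omega>" by (rule regularD(4)[OF r \<iota>_range[OF \<omega>] s])
  finally show ?thesis by (simp add: defect_def)
qed

text \<open>The modes keep alternating after \<open>T\<close> has been reached, while the value must
  stay frozen; hence the terminal mode in place of \<open>\<iota> n\<close> in the second
  case.\<close>

lemma value_process_eq:
  assumes r: "regular \<omega>"
  shows "value_process n \<omega> = running_profit n \<omega> - cost n \<omega> +
    (if \<tau> n \<omega> < T then Y (\<iota> n \<omega>) (\<tau> n \<omega>) \<omega> else Y (mode_indicator \<tau> \<iota> T \<omega>) T \<omega>)"
proof (induction n)
  case 0
  show ?case
  proof (cases "t < T")
    case True
    then show ?thesis using \<tau>_0[of \<omega>] \<iota>_0[OF regularD(1)[OF r]]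
      by (simp add: value_process_def running_profit_def cost_eq)
  next
    case False
    then have "\<tau> 0 \<omega> = T" "t = T" using \<tau>_0[of \<omega>] t by auto
    moreover have "mode_indicator \<tau> \<iota> T \<omega> = i"
      using mode_indicator_start[of \<tau> \<omega> \<iota>] \<tau>_Suc \<iota>_0[OF regularD(1)[OF r]] \<open>\<tau> 0 \<omega> = T\<close> by simp
    ultimately show ?thesis unfolding value_process_def running_profit_def cost_eq by simp
  qed
next
  case (Suc n)
  have step: "value_process (Suc n) \<omega> = value_process n \<omega> + gain n \<omega> - defect n \<omega>"
    by (simp add: value_process_def)
  have S: "running_profit (Suc n) \<omega> = running_profit n \<omega> + (\<Psi> (\<iota> n \<omega>) (\<tau> (Suc n) \<omega>) \<omega> - \<Psi> (\<iota> n \<omega>) (\<tau> n \<omega>) \<omega>)"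
    by (simp add: running_profit_def)
  have C: "cost (Suc n) \<omega> = cost n \<omega> + \<gamma> (\<iota> n \<omega>) (\<iota> (Suc n) \<omega>) (\<tau> (Suc n) \<omega>) \<omega> * of_bool (\<tau> (Suc n) \<omega> < T)"
    by (simp add: cost_eq)
  consider "T \<le> \<tau> n \<omega>" | "\<tau> n \<omega> < T" "T \<le> \<tau> (Suc n) \<omega>" | "\<tau> (Suc n) \<omega> < T" "\<tau> n \<omega> < T"
    using \<tau>_Suc[of n \<omega>] by fastforce
  then show ?case
  proof cases
    case 1
    then have "\<tau> n \<omega> = T" "\<tau> (Suc n) \<omega> = T" using \<tau>_range(2)[of n \<omega>] \<tau>_range(2)[of "Suc n" \<omega>] \<tau>_Suc[of n \<omega>] by linarith+
    then show ?thesis unfolding step S C Suc by (simp add: gain_def defect_def)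
  next
    case 2
    \<comment> \<open>The interval that ends at \<open>T\<close>: the terminal mode is
      \<open>\<iota> n\<close>, and the formal switch at \<open>T\<close> is free of cost.\<close>
    then have T: "\<tau> (Suc n) \<omega> = T" using \<tau>_range(2)[of "Suc n" \<omega>] by simp
    have "mode_indicator \<tau> \<iota> T \<omega> = \<iota> n \<omega>"
      by (rule mode_indicator_Ioc[of \<tau> \<omega> n T, OF \<tau>_Suc 2])
    then show ?thesis unfolding step S C Suc using 2(1) T by (simp add: gain_def defect_def X_def)
  next
    case 3
    then show ?thesis unfolding step S C Suc by (simp add: gain_def defect_def X_def)
  qed
qed

lemma mode_at_end_range:
  assumes \<omega>: "\<omega> \<in> space M" and K: "T \<le> \<tau> K \<omega>"
  shows "mode_indicator \<tau> \<iota> T \<omega> \<in> {1..m}"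
proof (cases "t = T")
  case True
  then show ?thesis using mode_indicator_start[of \<tau> \<omega> \<iota>] \<tau>_Suc \<iota>_0[OF \<omega>] \<tau>_0[of \<omega>] i by simp
next
  case False
  define n where "n = (LEAST k. T \<le> \<tau> k \<omega>)"
  have n: "T \<le> \<tau> n \<omega>" unfolding n_def by (rule LeastI[of "\<lambda>k. T \<le> \<tau> k \<omega>", OF K])
  have "n \<noteq> 0" using n \<tau>_0[of \<omega>] False t by (intro notI) simp
  then obtain k where k: "n = Suc k" by (cases n) auto
  have "\<not> T \<le> \<tau> k \<omega>" using not_less_Least[of k "\<lambda>k. T \<le> \<tau> k \<omega>"] k unfolding n_def by simp
  then have "mode_indicator \<tau> \<iota> T \<omega> = \<iota> k \<omega>"
    using n k by (intro mode_indicator_Ioc[of \<tau> \<omega> k T, OF \<tau>_Suc]) auto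
  then show ?thesis using \<iota>_range[OF \<omega>] by simp
qed

text \<open>Added up over the half-open intervals on which the mode is constant; the value of the
  integrand at the single point \<open>t\<close> does not affect the integral.\<close>

lemma running_profit_integral:
  assumes r: "regular \<omega>"
  shows "set_integrable lborel {t..\<tau> n \<omega>} (\<lambda>s. \<psi> (mode_indicator \<tau> \<iota> s \<omega>) s \<omega>) \<and>
    (LINT s:{t..\<tau> n \<omega>}|lborel. \<psi> (mode_indicator \<tau> \<iota> s \<omega>) s \<omega>) = running_profit n \<omega>"
proof (induction n)
  case 0
  have "set_integrable lborel {t<..t} (\<lambda>s. \<psi> (mode_indicator \<tau> \<iota> s \<omega>) s \<omega>)"
    by (simp add: set_integrable_def)
  from set_integral_Icc_Ioc[OF order_refl this] show ?case
    unfolding \<tau>_0 by (simp add: running_profit_def set_lebesgue_integral_def)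
next
  case (Suc n)
  let ?f = "\<lambda>s. \<psi> (mode_indicator \<tau> \<iota> s \<omega>) s \<omega>"
  note \<omega> = regularD(1)[OF r]
  note d = integral_process_diff[where \<psi>="\<psi> (\<iota> n \<omega>)" and \<omega>=\<omega>, OF regularD(6)[OF r \<iota>_range[OF \<omega>]] \<tau>_range(1)[of n \<omega>] \<tau>_Suc \<tau>_range(2)]
  have eq: "?f s = \<psi> (\<iota> n \<omega>) s \<omega>" if "s \<in> {\<tau> n \<omega><..\<tau> (Suc n) \<omega>}" for s
    using mode_indicator_Ioc[of \<tau> \<omega> n s, OF \<tau>_Suc] that by simp
  have ind: "indicator {\<tau> n \<omega><..\<tau> (Suc n) \<omega>} s *\<^sub>R ?f s = indicator {\<tau> n \<omega><..\<tau> (Suc n) \<omega>} s *\<^sub>R \<psi> (\<iota> n \<omega>) s \<omega>" for s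
    using eq[of s] by (cases "s \<in> {\<tau> n \<omega><..\<tau> (Suc n) \<omega>}") simp_all
  have int: "set_integrable lborel {\<tau> n \<omega><..\<tau> (Suc n) \<omega>} ?f"
    using d(1) unfolding set_integrable_def ind .
  have val: "(LINT s:{\<tau> n \<omega><..\<tau> (Suc n) \<omega>}|lborel. ?f s) = \<Psi> (\<iota> n \<omega>) (\<tau> (Suc n) \<omega>) \<omega> - \<Psi> (\<iota> n \<omega>) (\<tau> n \<omega>) \<omega>"
    unfolding d(2) set_lebesgue_integral_def ind ..
  have un: "{t..\<tau> (Suc n) \<omega>} = {t..\<tau> n \<omega>} \<union> {\<tau> n \<omega><..\<tau> (Suc n) \<omega>}"
    using \<tau>_le[of 0 n \<omega>] \<tau>_Suc[of n \<omega>] unfolding \<tau>_0 by auto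
  have "set_integrable lborel {t..\<tau> (Suc n) \<omega>} ?f"
    unfolding un by (rule set_integrable_Un[OF _ int]) (use Suc in simp_all)
  moreover have "(LINT s:{t..\<tau> (Suc n) \<omega>}|lborel. ?f s) = running_profit n \<omega> + (LINT s:{\<tau> n \<omega><..\<tau> (Suc n) \<omega>}|lborel. ?f s)"
    unfolding un using Suc int by (subst set_integral_Un) auto
  ultimately show ?case unfolding val by (simp add: running_profit_def)
qed

lemma payoff_eq:
  assumes r: "regular \<omega>" and K: "T \<le> \<tau> K \<omega>" and n: "K \<le> n"
  shows "payoff \<omega> = value_process n \<omega>"
proof -
  have T: "\<tau> n \<omega> = T" using \<tau>_le[OF n, of \<omega>] K \<tau>_range(2)[of n \<omega>] by linarith
  have "(\<Sum>k. \<gamma> (\<iota> k \<omega>) (\<iota> (Suc k) \<omega>) (\<tau> (Suc k) \<omega>) \<omega> * of_bool (\<tau> (Suc k) \<omega> < T)) = cost n \<omega>"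
    unfolding cost_eq
  proof (rule suminf_finite)
    fix k assume "k \<notin> {..<n}"
    then have "\<tau> n \<omega> \<le> \<tau> (Suc k) \<omega>" by (intro \<tau>_le) simp
    then show "\<gamma> (\<iota> k \<omega>) (\<iota> (Suc k) \<omega>) (\<tau> (Suc k) \<omega>) \<omega> * of_bool (\<tau> (Suc k) \<omega> < T) = 0" using T by simp
  qed simp
  moreover have "(LINT s:{t..T}|lborel. \<psi> (mode_indicator \<tau> \<iota> s \<omega>) s \<omega>) = running_profit n \<omega>"
    using running_profit_integral[OF r, of n] unfolding T by simp
  moreover have "Y (mode_indicator \<tau> \<iota> T \<omega>) T \<omega> = \<Gamma> (mode_indicator \<tau> \<iota> T \<omega>) \<omega>"
    by (rule regularD(5)[OF r mode_at_end_range[OF regularD(1)[OF r] K]])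
  ultimately show ?thesis unfolding payoff_def value_process_eq[OF r] using T by simp
qed

text \<open>Each increment is dominated by that of \<open>total_variation\<close>, and these
  telescope, so the bound depends neither on \<open>n\<close> nor on the plan.\<close>

lemma running_profit_bound:
  assumes r: "regular \<omega>"
  shows "\<bar>running_profit n \<omega>\<bar> \<le> \<xi> \<omega>"
proof -
  note \<omega> = regularD(1)[OF r]
  let ?\<theta> = "\<lambda>j s. integral_process (\<lambda>s \<omega>. \<bar>\<psi> j s \<omega>\<bar>) s \<omega>"
  have inc: "\<bar>\<Psi> j b \<omega> - \<Psi> j a \<omega>\<bar> \<le> ?\<theta> j b - ?\<theta> j a" if "j \<in> {1..m}" "0 \<le> a" "a \<le> b" "b \<le> T" for j a b
    by (rule integral_process_diff(3)[where \<psi>="\<psi> j" and \<omega>=\<omega>, OF regularD(6)[OF r that(1)] that(2-4)])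
  have tv_mono: "total_variation a \<omega> \<le> total_variation b \<omega>" if "0 \<le> a" "a \<le> b" "b \<le> T" for a b
    unfolding total_variation_def
  proof (rule sum_mono)
    fix j assume "j \<in> {1..m}"
    from inc[OF this that] show "?\<theta> j a \<le> ?\<theta> j b" by linarith
  qed
  have *: "\<bar>running_profit n \<omega>\<bar> \<le> total_variation (\<tau> n \<omega>) \<omega> - total_variation (\<tau> 0 \<omega>) \<omega>"
  proof (induction n)
    case (Suc n)
    note rng = \<tau>_range(1)[of n \<omega>] \<tau>_Suc[of n \<omega>] \<tau>_range(2)[of "Suc n" \<omega>]
    have "\<bar>\<Psi> (\<iota> n \<omega>) (\<tau> (Suc n) \<omega>) \<omega> - \<Psi> (\<iota> n \<omega>) (\<tau> n \<omega>) \<omega>\<bar> \<le> ?\<theta> (\<iota> n \<omega>) (\<tau> (Suc n) \<omega>) - ?\<theta> (\<iota> n \<omega>) (\<tau> n \<omega>)"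
      by (rule inc[OF \<iota>_range[OF \<omega>] rng])
    also have "\<dots> \<le> (\<Sum>j\<in>{1..m}. ?\<theta> j (\<tau> (Suc n) \<omega>) - ?\<theta> j (\<tau> n \<omega>))"
    proof (rule member_le_sum[of "\<iota> n \<omega>" "{1..m}" "\<lambda>j. ?\<theta> j (\<tau> (Suc n) \<omega>) - ?\<theta> j (\<tau> n \<omega>)"])
      fix j assume "j \<in> {1..m} - {\<iota> n \<omega>}"
      then have "j \<in> {1..m}" by simp
      from inc[OF this rng] show "0 \<le> ?\<theta> j (\<tau> (Suc n) \<omega>) - ?\<theta> j (\<tau> n \<omega>)" by linarith
    qed (use \<iota>_range[OF \<omega>] in simp_all)
    also have "\<dots> = total_variation (\<tau> (Suc n) \<omega>) \<omega> - total_variation (\<tau> n \<omega>) \<omega>"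
      by (simp add: total_variation_def sum_subtractf)
    finally show ?case using Suc by (simp add: running_profit_def)
  qed (simp add: running_profit_def)
  have "total_variation 0 \<omega> = 0"
    using set_integral_Icc_Ioc(2)[of 0 0 "\<lambda>u. \<bar>\<psi> _ u \<omega>\<bar>"]
    by (simp add: total_variation_def integral_process_def set_integrable_def set_lebesgue_integral_def)
  moreover have "total_variation 0 \<omega> \<le> total_variation (\<tau> 0 \<omega>) \<omega>"
    by (rule tv_mono) (use \<tau>_range in auto)
  moreover have "total_variation (\<tau> n \<omega>) \<omega> \<le> total_variation T \<omega>"
    by (rule tv_mono) (use \<tau>_range in auto)
  moreover have "total_variation T \<omega> \<le> \<xi> \<omega>" by (rule total_variation_le)
  ultimately show ?thesis using * by linarith
qed

lemma gain_abs_le: "regular \<omega> \<Longrightarrow> \<bar>gain k \<omega>\<bar> \<le> 2 * \<xi> \<omega>"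
proof -
  assume r: "regular \<omega>"
  have "\<bar>X (\<iota> k \<omega>) (\<tau> n \<omega>) \<omega>\<bar> \<le> \<xi> \<omega>" for n
    by (rule regularD(2)[OF r \<iota>_range[OF regularD(1)[OF r]]]) (use \<tau>_range in simp)
  from this[of k] this[of "Suc k"] show ?thesis unfolding gain_def by linarith
qed

lemma gain_measurable_M: "gain k \<in> borel_measurable M"
  by (rule measurable_G_M[OF gain_measurable])

lemma gain_integrable: "integrable M (gain k)"
proof (rule Bochner_Integration.integrable_bound[OF _ gain_measurable_M])
  show "integrable M (\<lambda>\<omega>. 2 * \<xi> \<omega>)" using \<xi>_integrable by simp
  show "AE \<omega> in M. norm (gain k \<omega>) \<le> norm (2 * \<xi> \<omega>)"
    using AE_regular by eventually_elim (use gain_abs_le \<xi>_nonneg in simp)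
qed

text \<open>The current mode is known at \<open>\<tau> k\<close>, so intersecting \<open>A\<close>
  with the events on which it is constant reduces random modes to the processes
  \<open>X j\<close>.\<close>

lemma gain_indicator_sum:
  assumes A: "A \<in> sets (pre_sigma (\<tau> k))"
  shows "expectation (\<lambda>\<omega>. indicator A \<omega> * gain k \<omega>) =
    (\<Sum>j\<in>{1..m}. expectation (\<lambda>\<omega>. indicator (A \<inter> {\<omega> \<in> space M. \<iota> k \<omega> = j}) \<omega> * (X j (\<tau> (Suc k) \<omega>) \<omega> - X j (\<tau> k \<omega>) \<omega>)))"
proof -
  let ?E = "\<lambda>j. A \<inter> {\<omega> \<in> space M. \<iota> k \<omega> = j}"
  have E: "?E j \<in> sets M" for j
    using A mode_event[of k j] subalgebra_G[of k] by (auto simp: subalgebra_def)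
  have "expectation (\<lambda>\<omega>. indicator A \<omega> * gain k \<omega>)
      = expectation (\<lambda>\<omega>. \<Sum>j\<in>{1..m}. indicator (?E j) \<omega> * (X j (\<tau> (Suc k) \<omega>) \<omega> - X j (\<tau> k \<omega>) \<omega>))"
  proof (rule Bochner_Integration.integral_cong[OF refl])
    fix \<omega> assume \<omega>: "\<omega> \<in> space M"
    have "(\<Sum>j\<in>{1..m}. indicator (?E j) \<omega> * (X j (\<tau> (Suc k) \<omega>) \<omega> - X j (\<tau> k \<omega>) \<omega>))
        = (\<Sum>j\<in>{1..m}. if j = \<iota> k \<omega> then indicator A \<omega> * gain k \<omega> else 0)"
      by (intro sum.cong refl) (use \<omega> in \<open>auto simp: indicator_def gain_def\<close>)
    also have "\<dots> = indicator A \<omega> * gain k \<omega>"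
      using \<iota>_range[OF \<omega>, of k] by (subst sum.delta) auto
    finally show "indicator A \<omega> * gain k \<omega> = (\<Sum>j\<in>{1..m}. indicator (?E j) \<omega> * (X j (\<tau> (Suc k) \<omega>) \<omega> - X j (\<tau> k \<omega>) \<omega>))" ..
  qed
  also have "\<dots> = (\<Sum>j\<in>{1..m}. expectation (\<lambda>\<omega>. indicator (?E j) \<omega> * (X j (\<tau> (Suc k) \<omega>) \<omega> - X j (\<tau> k \<omega>) \<omega>)))"
    by (rule Bochner_Integration.integral_sum)
      (intro integrable_indicator_times E Bochner_Integration.integrable_diff integrable_X_stopped \<tau>_bt)
  finally show ?thesis .
qed

lemma gain_supermartingale:
  assumes A: "A \<in> sets (pre_sigma (\<tau> k))"
  shows "expectation (\<lambda>\<omega>. indicator A \<omega> * gain k \<omega>) \<le> 0"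
  unfolding gain_indicator_sum[OF A]
  by (intro sum_nonpos X_supermartingale \<tau>_bt \<tau>_Suc sets.Int A mode_event)

lemma start_event: "A \<in> sets (F t) \<Longrightarrow> A \<in> sets (pre_sigma (\<tau> k))"
  by (rule sets_F_pre_sigma[OF bounded_timesD(1)[OF \<tau>_bt]]) (use \<tau>_le[of 0 k] \<tau>_0 in auto)

lemma gain_sup_finite:
  assumes mart: "\<And>k A. A \<in> sets (pre_sigma (\<tau> k)) \<Longrightarrow> expectation (\<lambda>\<omega>. indicator A \<omega> * gain k \<omega>) = 0"
  shows "(\<integral>\<^sup>+\<omega>. (SUP n. ennreal \<bar>\<Sum>k<n. gain k \<omega>\<bar>) \<partial>M) < \<infinity>"
proof (rule martingale_sup_finite[OF gain_measurable _ mart])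
  note [measurable] = gain_measurable_M
  show gain2: "integrable M (\<lambda>\<omega>. (gain k \<omega>)\<^sup>2)" for k
  proof (rule Bochner_Integration.integrable_bound)
    show "integrable M (\<lambda>\<omega>. 4 * (\<xi> \<omega>)\<^sup>2)" using \<xi>_square by simp
    show "AE \<omega> in M. norm ((gain k \<omega>)\<^sup>2) \<le> norm (4 * (\<xi> \<omega>)\<^sup>2)"
      using AE_regular
    proof eventually_elim
      case (elim \<omega>)
      have "\<bar>gain k \<omega>\<bar> \<le> \<bar>2 * \<xi> \<omega>\<bar>" using gain_abs_le[OF elim] \<xi>_nonneg[of \<omega>] by simp
      then have "(gain k \<omega>)\<^sup>2 \<le> (2 * \<xi> \<omega>)\<^sup>2" by (simp only: abs_le_square_iff)
      then show ?case by (simp add: power_mult_distrib)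
    qed
  qed measurable
  define D where "D j k \<omega> = X j (\<tau> (Suc k) \<omega>) \<omega> - X j (\<tau> k \<omega>) \<omega>" for j k \<omega>
  have Xm: "(\<lambda>\<omega>. X j (\<tau> k \<omega>) \<omega>) \<in> borel_measurable M" if "j \<in> {1..m}" for j k
    by (rule borel_measurable_integrable[OF integrable_X_stopped[OF that \<tau>_bt]])
  have D2: "integrable M (\<lambda>\<omega>. (D j k \<omega>)\<^sup>2)" if j: "j \<in> {1..m}" for j k
  proof -
    have "integrable M (\<lambda>\<omega>. (X j (\<tau> n \<omega>) \<omega>)\<^sup>2)" for n
    proof (rule Bochner_Integration.integrable_bound[OF \<xi>_square])
      show "(\<lambda>\<omega>. (X j (\<tau> n \<omega>) \<omega>)\<^sup>2) \<in> borel_measurable M" using Xm[OF j, of n] by measurable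
      show "AE \<omega> in M. norm ((X j (\<tau> n \<omega>) \<omega>)\<^sup>2) \<le> norm ((\<xi> \<omega>)\<^sup>2)"
        using dominated_stopped[OF dominated_X[OF j] \<tau>_bt[of n]]
        by eventually_elim (auto simp: abs_le_square_iff[symmetric])
    qed
    then show ?thesis unfolding D_def by (intro integrable_square_diff Xm j)
  qed
  show "expectation (\<lambda>\<omega>. \<Sum>k<n. (gain k \<omega>)\<^sup>2) \<le> (\<Sum>j\<in>{1..m}. 18 * expectation (\<lambda>\<omega>. (\<xi> \<omega>)\<^sup>2))" for n
  proof -
    have "expectation (\<lambda>\<omega>. \<Sum>k<n. (gain k \<omega>)\<^sup>2) \<le> expectation (\<lambda>\<omega>. \<Sum>j\<in>{1..m}. \<Sum>k<n. (D j k \<omega>)\<^sup>2)"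
    proof (rule integral_mono)
      show "integrable M (\<lambda>\<omega>. \<Sum>k<n. (gain k \<omega>)\<^sup>2)" using gain2 by simp
      show "integrable M (\<lambda>\<omega>. \<Sum>j\<in>{1..m}. \<Sum>k<n. (D j k \<omega>)\<^sup>2)"
        by (intro Bochner_Integration.integrable_sum D2)
      fix \<omega> assume \<omega>: "\<omega> \<in> space M"
      have "(gain k \<omega>)\<^sup>2 \<le> (\<Sum>j\<in>{1..m}. (D j k \<omega>)\<^sup>2)" for k
        using member_le_sum[of "\<iota> k \<omega>" "{1..m}" "\<lambda>j. (D j k \<omega>)\<^sup>2"] \<iota>_range[OF \<omega>, of k]
        by (simp add: gain_def D_def)
      then have "(\<Sum>k<n. (gain k \<omega>)\<^sup>2) \<le> (\<Sum>k<n. \<Sum>j\<in>{1..m}. (D j k \<omega>)\<^sup>2)" by (rule sum_mono)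
      also have "\<dots> = (\<Sum>j\<in>{1..m}. \<Sum>k<n. (D j k \<omega>)\<^sup>2)" by (rule sum.swap)
      finally show "(\<Sum>k<n. (gain k \<omega>)\<^sup>2) \<le> (\<Sum>j\<in>{1..m}. \<Sum>k<n. (D j k \<omega>)\<^sup>2)" .
    qed
    also have "\<dots> = (\<Sum>j\<in>{1..m}. expectation (\<lambda>\<omega>. \<Sum>k<n. (D j k \<omega>)\<^sup>2))"
      by (intro Bochner_Integration.integral_sum Bochner_Integration.integrable_sum D2)
    also have "\<dots> \<le> (\<Sum>j\<in>{1..m}. 18 * expectation (\<lambda>\<omega>. (\<xi> \<omega>)\<^sup>2))"
    proof (rule sum_mono)
      fix j assume j: "j \<in> {1..m}"
      show "expectation (\<lambda>\<omega>. \<Sum>k<n. (D j k \<omega>)\<^sup>2) \<le> 18 * expectation (\<lambda>\<omega>. (\<xi> \<omega>)\<^sup>2)"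
        unfolding D_def
      proof (rule supermartingale_quadratic_variation[OF _ \<xi>_measurable \<xi>_square])
        show "(\<lambda>\<omega>. X j (\<tau> k \<omega>) \<omega>) \<in> borel_measurable (pre_sigma (\<tau> k))" for k
          by (rule borel_measurable_stopped[OF space_Q_adapted[OF X_space_Q[OF j]] \<tau>_bt])
        show "AE \<omega> in M. \<bar>X j (\<tau> k \<omega>) \<omega>\<bar> \<le> \<xi> \<omega>" for k
          by (rule dominated_stopped[OF dominated_X[OF j] \<tau>_bt])
        show "expectation (\<lambda>\<omega>. indicator A \<omega> * (X j (\<tau> (Suc k) \<omega>) \<omega> - X j (\<tau> k \<omega>) \<omega>)) \<le> 0"
          if "A \<in> sets (pre_sigma (\<tau> k))" for k A
          by (rule X_supermartingale[OF j \<tau>_bt \<tau>_bt \<tau>_Suc that])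
      qed
    qed
    finally show ?thesis .
  qed
qed

end

section \<open>Verification\<close>

text \<open>Takes the place of extracting a subsequence along which the values vanish.\<close>

lemma tendsto_zero_of_infinite:
  fixes u :: "nat \<Rightarrow> real"
  assumes "u \<longlonglongrightarrow> l" "infinite {n. u n = 0}"
  shows "l = 0"
proof (rule ccontr)
  assume "l \<noteq> 0"
  then have "\<forall>\<^sub>F n in sequentially. u n \<noteq> 0" using tendsto_imp_eventually_ne[OF assms(1)] by simp
  then have "\<forall>\<^sub>F n in cofinite. u n \<noteq> 0" by (simp add: cofinite_eq_sequentially)
  then show False using assms(2) by (simp add: eventually_cofinite)
qed

text \<open>Tested on the event of \<open>G\<close> where the claimed inequality fails, which must
  then be null.\<close>

lemma (in prob_space) cond_exp_le_of_expectation: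
  fixes f g :: "'a \<Rightarrow> real"
  assumes G: "subalgebra M G" and f: "integrable M f" and g: "integrable M g" "g \<in> borel_measurable G"
    and le: "\<And>A. A \<in> sets G \<Longrightarrow> expectation (\<lambda>\<omega>. indicator A \<omega> * f \<omega>) \<le> expectation (\<lambda>\<omega>. indicator A \<omega> * g \<omega>)"
  shows "AE \<omega> in M. real_cond_exp M G f \<omega> \<le> g \<omega>"
proof -
  interpret G: finite_measure_subalgebra M G by unfold_locales (rule G)
  let ?C = "real_cond_exp M G f"
  define A where "A = {\<omega> \<in> space G. g \<omega> < ?C \<omega>}"
  have A: "A \<in> sets G" unfolding A_def using g(2) by measurable
  then have AM: "A \<in> sets M" using G by (auto simp: subalgebra_def)
  have C: "integrable M ?C" by (rule G.real_cond_exp_int(1)[OF f])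
  have int: "integrable M (\<lambda>\<omega>. indicator A \<omega> * (?C \<omega> - g \<omega>))"
    by (intro integrable_indicator_times AM Bochner_Integration.integrable_diff C g)
  have "expectation (\<lambda>\<omega>. indicator A \<omega> * (?C \<omega> - g \<omega>))
      = expectation (\<lambda>\<omega>. indicator A \<omega> * ?C \<omega>) - expectation (\<lambda>\<omega>. indicator A \<omega> * g \<omega>)"
    using integrable_indicator_times[OF AM C] integrable_indicator_times[OF AM g(1)]
    by (simp add: right_diff_distrib)
  also have "expectation (\<lambda>\<omega>. indicator A \<omega> * ?C \<omega>) = expectation (\<lambda>\<omega>. indicator A \<omega> * f \<omega>)"
    using G.real_cond_exp_intA[OF f A] by (simp add: set_lebesgue_integral_def)
  finally have "expectation (\<lambda>\<omega>. indicator A \<omega> * (?C \<omega> - g \<omega>)) \<le> 0" using le[OF A] by simp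
  moreover have nn: "0 \<le> indicator A \<omega> * (?C \<omega> - g \<omega>)" for \<omega> by (simp add: A_def indicator_def)
  ultimately have "expectation (\<lambda>\<omega>. indicator A \<omega> * (?C \<omega> - g \<omega>)) = 0"
    by (intro antisym integral_nonneg_AE AE_I2) simp_all
  then have "AE \<omega> in M. indicator A \<omega> * (?C \<omega> - g \<omega>) = 0"
    using integral_nonneg_eq_0_iff_AE[OF int] nn by simp
  then show ?thesis
    using AE_space
  proof eventually_elim
    case (elim \<omega>)
    show ?case
    proof (rule ccontr)
      assume *: "\<not> ?C \<omega> \<le> g \<omega>"
      then have "\<omega> \<in> A" using elim(2) G by (simp add: A_def subalgebra_def)
      then show False using elim(1) * by simp
    qed
  qed
qed

section \<open>The payoff of a plan and its conditional expectation\<close>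

context switching_plan
begin

lemma Y_start_integrable: "integrable M (Y i t)"
  using integrable_stopped[OF space_Q_adapted[OF Y_spaces(1)[OF i]] bounded_times_const[OF t] dominated_Y[OF i] \<xi>_integrable] by simp

lemma Y_start_measurable: "Y i t \<in> borel_measurable (F t)"
  by (rule adapted_cadlagD(1)[OF space_Q_adapted[OF Y_spaces(1)[OF i]] t])

lemma value_process_measurable: "value_process n \<in> borel_measurable M"
proof -
  note [measurable] = gain_measurable_M defect_measurable borel_measurable_integrable[OF Y_start_integrable]
  show ?thesis unfolding value_process_def[abs_def] by measurable
qed

lemma end_value_bound:
  assumes r: "regular \<omega>"
  shows "\<bar>if \<tau> n \<omega> < T then Y (\<iota> n \<omega>) (\<tau> n \<omega>) \<omega> else Y (mode_indicator \<tau> \<iota> T \<omega>) T \<omega>\<bar> \<le> \<xi> \<omega>"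
proof (cases "\<tau> n \<omega> < T")
  case True
  have "\<bar>Y (\<iota> n \<omega>) (\<tau> n \<omega>) \<omega>\<bar> \<le> \<xi> \<omega>"
    by (rule regularD(3)[OF r \<iota>_range[OF regularD(1)[OF r]]]) (use \<tau>_range in simp)
  then show ?thesis using True by simp
next
  case False
  have "\<bar>Y (mode_indicator \<tau> \<iota> T \<omega>) T \<omega>\<bar> \<le> \<xi> \<omega>"
    by (rule regularD(3)[OF r mode_at_end_range[OF regularD(1)[OF r], of n]]) (use False T_pos in auto)
  then show ?thesis using False by simp
qed

lemma value_process_limit:
  assumes "AE \<omega> in M. \<exists>n. T \<le> \<tau> n \<omega>"
  shows "AE \<omega> in M. (\<lambda>n. value_process n \<omega>) \<longlonglongrightarrow> payoff \<omega>"
  using assms AE_regular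
proof eventually_elim
  case (elim \<omega>)
  then obtain K where K: "T \<le> \<tau> K \<omega>" by blast
  have "\<forall>\<^sub>F n in sequentially. payoff \<omega> = value_process n \<omega>"
    by (rule eventually_sequentiallyI[of K]) (rule payoff_eq[OF elim(2) K])
  then show ?case by (rule Lim_transform_eventually[OF tendsto_const])
qed

lemma cost_bound:
  assumes "(\<integral>\<^sup>+\<omega>. (SUP n. ennreal \<bar>cost n \<omega>\<bar>) \<partial>M) < \<infinity>"
  obtains \<eta> where "integrable M \<eta>" "AE \<omega> in M. \<forall>n. \<bar>cost n \<omega>\<bar> \<le> \<eta> \<omega>"
proof
  define r where "r \<omega> = (SUP n. ennreal \<bar>cost n \<omega>\<bar>)" for \<omega>
  note [measurable] = cost_measurable
  have [measurable]: "r \<in> borel_measurable M" unfolding r_def[abs_def] by measurable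
  have fin: "(\<integral>\<^sup>+\<omega>. r \<omega> \<partial>M) < \<infinity>" using assms by (simp add: r_def)
  then have ae: "AE \<omega> in M. r \<omega> \<noteq> \<infinity>" by (intro nn_integral_PInf_AE) auto
  have "(\<integral>\<^sup>+\<omega>. ennreal (enn2real (r \<omega>)) \<partial>M) = (\<integral>\<^sup>+\<omega>. r \<omega> \<partial>M)"
  proof (rule nn_integral_cong_AE)
    show "AE \<omega> in M. ennreal (enn2real (r \<omega>)) = r \<omega>"
      using ae by eventually_elim (simp add: ennreal_enn2real less_top)
  qed
  then show "integrable M (\<lambda>\<omega>. enn2real (r \<omega>))" using fin by (intro integrableI_nonneg) auto
  show "AE \<omega> in M. \<forall>n. \<bar>cost n \<omega>\<bar> \<le> enn2real (r \<omega>)"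
    using ae
  proof (eventually_elim, intro allI)
    fix \<omega> n assume "r \<omega> \<noteq> \<infinity>"
    moreover have "ennreal \<bar>cost n \<omega>\<bar> \<le> r \<omega>" unfolding r_def by (rule SUP_upper) simp
    ultimately show "\<bar>cost n \<omega>\<bar> \<le> enn2real (r \<omega>)"
      using enn2real_mono[of "ennreal \<bar>cost n \<omega>\<bar>" "r \<omega>"] by (simp add: less_top)
  qed
qed

lemma payoff_approx:
  assumes fin: "AE \<omega> in M. \<exists>n. T \<le> \<tau> n \<omega>"
    and cost: "(\<integral>\<^sup>+\<omega>. (SUP n. ennreal \<bar>cost n \<omega>\<bar>) \<partial>M) < \<infinity>"
  shows "integrable M payoff" "integrable M (value_process n)"
    and "A \<in> sets M \<Longrightarrow> (\<lambda>n. expectation (\<lambda>\<omega>. indicator A \<omega> * value_process n \<omega>))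
      \<longlonglongrightarrow> expectation (\<lambda>\<omega>. indicator A \<omega> * payoff \<omega>)"
proof -
  obtain \<eta> where \<eta>: "integrable M \<eta>" "AE \<omega> in M. \<forall>n. \<bar>cost n \<omega>\<bar> \<le> \<eta> \<omega>"
    using cost_bound[OF cost] by blast
  \<comment> \<open>One \<open>\<xi>\<close> for the accumulated profit, one for the value at the
    end, and \<open>\<eta>\<close> for the costs.\<close>
  define \<zeta> where "\<zeta> \<omega> = 2 * \<xi> \<omega> + \<eta> \<omega>" for \<omega>
  have \<zeta>: "integrable M \<zeta>" unfolding \<zeta>_def using \<eta>(1) \<xi>_integrable by simp
  have bound: "AE \<omega> in M. norm (value_process n \<omega>) \<le> \<zeta> \<omega>" for n
    using \<eta>(2) AE_regular
  proof eventually_elim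
    case (elim \<omega>)
    have "\<bar>cost n \<omega>\<bar> \<le> \<eta> \<omega>" using elim(1) by blast
    then show ?case
      using running_profit_bound[OF elim(2), of n] end_value_bound[OF elim(2), of n]
      unfolding value_process_eq[OF elim(2)] \<zeta>_def real_norm_def by linarith
  qed
  note lim = value_process_limit[OF fin]
  have payoff_meas: "payoff \<in> borel_measurable M"
    by (rule borel_measurable_AE_LIMSEQ[OF value_process_measurable _ refl lim]) auto
  show "integrable M payoff"
    by (rule integrable_dominated_convergence[OF payoff_meas value_process_measurable \<zeta> lim bound])
  show "integrable M (value_process n)"
    by (rule Bochner_Integration.integrable_bound[OF \<zeta> value_process_measurable])
      (use bound[of n] in \<open>eventually_elim, simp\<close>)
  assume A: "A \<in> sets M"
  show "(\<lambda>n. expectation (\<lambda>\<omega>. indicator A \<omega> * value_process n \<omega>))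
      \<longlonglongrightarrow> expectation (\<lambda>\<omega>. indicator A \<omega> * payoff \<omega>)"
  proof (rule integral_dominated_convergence[OF _ _ \<zeta>])
    show "(\<lambda>\<omega>. indicator A \<omega> * payoff \<omega>) \<in> borel_measurable M"
      "(\<lambda>\<omega>. indicator A \<omega> * value_process n \<omega>) \<in> borel_measurable M" for n
      using A payoff_meas value_process_measurable[of n] by measurable
    show "AE \<omega> in M. (\<lambda>n. indicator A \<omega> * value_process n \<omega>) \<longlonglongrightarrow> indicator A \<omega> * payoff \<omega>"
      using lim by eventually_elim (intro tendsto_intros)
    show "AE \<omega> in M. norm (indicator A \<omega> * value_process n \<omega>) \<le> \<zeta> \<omega>" for n
      using bound[of n] by eventually_elim (auto simp: indicator_def)
  qed
qed

lemma start_gain_expectation: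
  assumes A: "A \<in> sets (F t)"
  shows "integrable M (\<lambda>\<omega>. Y i t \<omega> + (\<Sum>k<n. gain k \<omega>))"
    and "expectation (\<lambda>\<omega>. indicator A \<omega> * (Y i t \<omega> + (\<Sum>k<n. gain k \<omega>)))
      = expectation (\<lambda>\<omega>. indicator A \<omega> * Y i t \<omega>) + (\<Sum>k<n. expectation (\<lambda>\<omega>. indicator A \<omega> * gain k \<omega>))"
proof -
  have AM: "A \<in> sets M" using A F_subset by blast
  show "integrable M (\<lambda>\<omega>. Y i t \<omega> + (\<Sum>k<n. gain k \<omega>))"
    using Y_start_integrable gain_integrable by simp
  have "expectation (\<lambda>\<omega>. indicator A \<omega> * (Y i t \<omega> + (\<Sum>k<n. gain k \<omega>)))
      = expectation (\<lambda>\<omega>. indicator A \<omega> * Y i t \<omega> + (\<Sum>k<n. indicator A \<omega> * gain k \<omega>))"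
    by (simp only: distrib_left sum_distrib_left)
  also have "\<dots> = expectation (\<lambda>\<omega>. indicator A \<omega> * Y i t \<omega>) + (\<Sum>k<n. expectation (\<lambda>\<omega>. indicator A \<omega> * gain k \<omega>))"
    unfolding Bochner_Integration.integral_sum[OF integrable_indicator_times[OF AM gain_integrable], symmetric]
    by (intro Bochner_Integration.integral_add Bochner_Integration.integrable_sum
        integrable_indicator_times[OF AM Y_start_integrable] integrable_indicator_times[OF AM gain_integrable])
  finally show "expectation (\<lambda>\<omega>. indicator A \<omega> * (Y i t \<omega> + (\<Sum>k<n. gain k \<omega>)))
      = expectation (\<lambda>\<omega>. indicator A \<omega> * Y i t \<omega>) + (\<Sum>k<n. expectation (\<lambda>\<omega>. indicator A \<omega> * gain k \<omega>))" .
qed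

text \<open>Events of \<open>F t\<close> belong to the past of every switching time, so each gain
  has nonpositive expectation over them, while the defects only lower the value. The limit rests on
  the bound for the costs being uniform in \<open>n\<close>.\<close>

lemma cond_exp_payoff_le:
  assumes fin: "AE \<omega> in M. \<exists>n. T \<le> \<tau> n \<omega>"
    and cost: "(\<integral>\<^sup>+\<omega>. (SUP n. ennreal \<bar>cost n \<omega>\<bar>) \<partial>M) < \<infinity>"
  shows "AE \<omega> in M. real_cond_exp M (F t) payoff \<omega> \<le> Y i t \<omega>"
proof (rule cond_exp_le_of_expectation[OF subalgebra_F payoff_approx(1)[OF assms] Y_start_integrable Y_start_measurable])
  fix A assume A: "A \<in> sets (F t)"
  then have AM: "A \<in> sets M" using F_subset by blast
  have "expectation (\<lambda>\<omega>. indicator A \<omega> * value_process n \<omega>) \<le> expectation (\<lambda>\<omega>. indicator A \<omega> * Y i t \<omega>)" for n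
  proof -
    have "expectation (\<lambda>\<omega>. indicator A \<omega> * value_process n \<omega>)
        \<le> expectation (\<lambda>\<omega>. indicator A \<omega> * (Y i t \<omega> + (\<Sum>k<n. gain k \<omega>)))"
    proof (rule integral_mono_AE)
      show "AE \<omega> in M. indicator A \<omega> * value_process n \<omega> \<le> indicator A \<omega> * (Y i t \<omega> + (\<Sum>k<n. gain k \<omega>))"
        using AE_regular
      proof eventually_elim
        case (elim \<omega>)
        have "0 \<le> (\<Sum>k<n. defect k \<omega>)" by (intro sum_nonneg defect_nonneg elim)
        then show ?case by (intro mult_left_mono) (simp_all add: value_process_def)
      qed
    qed (intro integrable_indicator_times AM payoff_approx(2)[OF assms] start_gain_expectation(1)[OF A])+
    also have "\<dots> \<le> expectation (\<lambda>\<omega>. indicator A \<omega> * Y i t \<omega>)"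
      unfolding start_gain_expectation(2)[OF A]
      using sum_nonpos[of "{..<n}" "\<lambda>k. expectation (\<lambda>\<omega>. indicator A \<omega> * gain k \<omega>)", OF gain_supermartingale[OF start_event[OF A]]]
      by simp
    finally show ?thesis .
  qed
  then show "expectation (\<lambda>\<omega>. indicator A \<omega> * payoff \<omega>) \<le> expectation (\<lambda>\<omega>. indicator A \<omega> * Y i t \<omega>)"
    by (intro LIMSEQ_le_const2[OF payoff_approx(3)[OF assms AM]]) blast
qed

lemma cond_exp_payoff_eq:
  assumes fin: "AE \<omega> in M. \<exists>n. T \<le> \<tau> n \<omega>"
    and cost: "(\<integral>\<^sup>+\<omega>. (SUP n. ennreal \<bar>cost n \<omega>\<bar>) \<partial>M) < \<infinity>"
    and defect: "AE \<omega> in M. \<forall>k. defect k \<omega> = 0"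
    and mart: "\<And>k A. A \<in> sets (pre_sigma (\<tau> k)) \<Longrightarrow> expectation (\<lambda>\<omega>. indicator A \<omega> * gain k \<omega>) = 0"
  shows "AE \<omega> in M. real_cond_exp M (F t) payoff \<omega> = Y i t \<omega>"
proof -
  interpret G: finite_measure_subalgebra M "F t" by unfold_locales (rule subalgebra_F)
  show ?thesis
  proof (rule G.real_cond_exp_charact[OF _ payoff_approx(1)[OF fin cost] Y_start_integrable Y_start_measurable])
    fix A assume A: "A \<in> sets (F t)"
    then have AM: "A \<in> sets M" using F_subset by blast
    have "expectation (\<lambda>\<omega>. indicator A \<omega> * value_process n \<omega>) = expectation (\<lambda>\<omega>. indicator A \<omega> * Y i t \<omega>)" for n
    proof -
      have "expectation (\<lambda>\<omega>. indicator A \<omega> * value_process n \<omega>)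
          = expectation (\<lambda>\<omega>. indicator A \<omega> * (Y i t \<omega> + (\<Sum>k<n. gain k \<omega>)))"
      proof (rule integral_cong_AE)
        show "AE \<omega> in M. indicator A \<omega> * value_process n \<omega> = indicator A \<omega> * (Y i t \<omega> + (\<Sum>k<n. gain k \<omega>))"
          using defect by eventually_elim (simp add: value_process_def)
      qed (intro borel_measurable_integrable integrable_indicator_times AM payoff_approx(2)[OF fin cost] start_gain_expectation(1)[OF A])+
      then show ?thesis unfolding start_gain_expectation(2)[OF A] using mart[OF start_event[OF A]] by simp
    qed
    then have "expectation (\<lambda>\<omega>. indicator A \<omega> * payoff \<omega>) = expectation (\<lambda>\<omega>. indicator A \<omega> * Y i t \<omega>)"
      using payoff_approx(3)[OF fin cost AM] LIMSEQ_unique[OF _ tendsto_const] by simp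
    then show "(\<integral>\<omega>\<in>A. payoff \<omega> \<partial>M) = (\<integral>\<omega>\<in>A. Y i t \<omega> \<partial>M)" by (simp add: set_lebesgue_integral_def)
  qed
qed

text \<open>If there were infinitely many switches before \<open>T\<close>, two consecutive switches \<open>a \<rightarrow> b \<rightarrow> c\<close>
  would occur infinitely often; passing to the limit of the switching times, both would be optimal
  there, so that the direct switch \<open>a \<rightarrow> c\<close> would be strictly better.\<close>

lemma finitely_many_switches:
  assumes defect: "AE \<omega> in M. \<forall>k. defect k \<omega> = 0"
  shows "AE \<omega> in M. \<exists>n. T \<le> \<tau> n \<omega>"
proof -
  define D where "D \<omega> = lim (\<lambda>n. \<tau> n \<omega>)" for \<omega>
  have D: "(\<lambda>n. \<tau> n \<omega>) \<longlonglongrightarrow> D \<omega>" for \<omega>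
  proof -
    obtain l where "(\<lambda>n. \<tau> n \<omega>) \<longlonglongrightarrow> l"
      using incseq_convergent[of "\<lambda>n. \<tau> n \<omega>" T] incseq_SucI[of "\<lambda>n. \<tau> n \<omega>", OF \<tau>_Suc] \<tau>_range(2) by metis
    then show ?thesis by (simp add: D_def limI)
  qed
  note D_bt = bounded_times_limit(1)[of \<tau>, OF \<tau>_bt \<tau>_Suc D]
  have Y_lim: "AE \<omega> in M. \<forall>a\<in>{1..m}. (\<lambda>n. Y a (\<tau> n \<omega>) \<omega>) \<longlonglongrightarrow> Y a (D \<omega>) \<omega>"
    by (rule AE_finite_allI) (simp, rule space_Q_tendsto[OF Y_spaces(1) \<tau>_bt \<tau>_Suc D])
  have \<gamma>_lim: "AE \<omega> in M. \<forall>a\<in>{1..m}. \<forall>b\<in>{1..m}. (\<lambda>n. \<gamma> a b (\<tau> n \<omega>) \<omega>) \<longlonglongrightarrow> \<gamma> a b (D \<omega>) \<omega>"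
  proof (intro AE_finite_allI)
    fix a b assume "a \<in> {1..m}" "b \<in> {1..m}"
    then have "\<gamma> a b \<in> space_Q M F T" using gamma_Q_S2[of a b] by simp
    then show "AE \<omega> in M. (\<lambda>n. \<gamma> a b (\<tau> n \<omega>) \<omega>) \<longlonglongrightarrow> \<gamma> a b (D \<omega>) \<omega>"
      by (rule space_Q_tendsto[OF _ \<tau>_bt \<tau>_Suc D])
  qed simp_all
  have diag: "AE \<omega> in M. \<forall>a\<in>{1..m}. \<forall>s\<in>{0..T}. \<gamma> a a s \<omega> = 0"
    by (rule AE_finite_allI) (simp, rule gamma_diag)
  have tri: "AE \<omega> in M. \<forall>a\<in>{1..m}. \<forall>b\<in>{1..m}. \<forall>c\<in>{1..m}. a \<noteq> b \<longrightarrow> b \<noteq> c \<longrightarrow>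
      (\<forall>s\<in>{0..T}. \<gamma> a c s \<omega> < \<gamma> a b s \<omega> + \<gamma> b c s \<omega>)"
  proof (rule AE_finite_allI, simp, rule AE_finite_allI, simp, rule AE_finite_allI, simp)
    fix a b c assume abc: "a \<in> {1..m}" "b \<in> {1..m}" "c \<in> {1..m}"
    show "AE \<omega> in M. a \<noteq> b \<longrightarrow> b \<noteq> c \<longrightarrow> (\<forall>s\<in>{0..T}. \<gamma> a c s \<omega> < \<gamma> a b s \<omega> + \<gamma> b c s \<omega>)"
    proof (cases "a \<noteq> b \<and> b \<noteq> c")
      case True
      then have "AE \<omega> in M. \<forall>s\<in>{0..T}. \<gamma> a c s \<omega> < \<gamma> a b s \<omega> + \<gamma> b c s \<omega>"
        by (intro gamma_triangle abc) auto
      then show ?thesis by eventually_elim blast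
    next
      case False
      then show ?thesis by (cases "a = b") simp_all
    qed
  qed
  show ?thesis
    using Y_lim \<gamma>_lim diag tri AE_regular defect
  proof eventually_elim
    case (elim \<omega>)
    note r = elim(5)
    note \<omega> = regularD(1)[OF r]
    show ?case
    proof (rule ccontr)
      assume "\<not> (\<exists>n. T \<le> \<tau> n \<omega>)"
      then have less: "\<tau> n \<omega> < T" for n by (simp add: not_le)
      \<comment> \<open>Triples of consecutive modes take finitely many values, so some pattern
        \<open>a, b, c\<close> recurs infinitely often. Triples instead of pairs make both switches
        recur together.\<close>
      define p where "p n = (\<iota> n \<omega>, \<iota> (Suc n) \<omega>, \<iota> (Suc (Suc n)) \<omega>)" for n
      have "finite (range p)"
        by (rule finite_subset[of _ "{1..m} \<times> {1..m} \<times> {1..m}"]) (use \<iota>_range[OF \<omega>] in \<open>auto simp: p_def simp del: atLeastAtMost_iff\<close>)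
      then obtain n0 where n0: "infinite {n. p n = p n0}"
        using pigeonhole_infinite[of "UNIV :: nat set" p] by auto
      obtain a b c where abc: "a = \<iota> n0 \<omega>" "b = \<iota> (Suc n0) \<omega>" "c = \<iota> (Suc (Suc n0)) \<omega>" by blast
      have I: "a \<in> {1..m}" "b \<in> {1..m}" "c \<in> {1..m}" unfolding abc by (rule \<iota>_range[OF \<omega>])+
      have ne: "a \<noteq> b" "b \<noteq> c" unfolding abc by (rule \<iota>_Suc[OF \<omega>])+
      define e where "e a b s = Y a s \<omega> - Y b s \<omega> + \<gamma> a b s \<omega>" for a b s
      have e_lim: "(\<lambda>n. e a b (\<tau> n \<omega>)) \<longlonglongrightarrow> e a b (D \<omega>)" if "a \<in> {1..m}" "b \<in> {1..m}" for a b
        unfolding e_def using elim(1,2) that by (intro tendsto_intros) blast+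
      have e_zero: "e (\<iota> n \<omega>) (\<iota> (Suc n) \<omega>) (\<tau> (Suc n) \<omega>) = 0" for n
        using spec[OF elim(6), of n] less[of "Suc n"] by (simp add: defect_def e_def)
      \<comment> \<open>The defect of step \<open>n\<close> is evaluated at
        \<open>\<tau> (Suc n)\<close>, hence the shift of the limit by one for the first switch and
        by two for the second.\<close>
      have "e a b (D \<omega>) = 0"
      proof (rule tendsto_zero_of_infinite[OF LIMSEQ_Suc[OF e_lim[OF I(1,2)]]])
        have "{n. p n = p n0} \<subseteq> {n. e a b (\<tau> (Suc n) \<omega>) = 0}"
          using e_zero unfolding p_def abc by (auto simp: prod_eq_iff) metis
        then show "infinite {n. e a b (\<tau> (Suc n) \<omega>) = 0}" using n0 infinite_super by blast
      qed
      moreover have "e b c (D \<omega>) = 0"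
      proof (rule tendsto_zero_of_infinite[OF LIMSEQ_Suc[OF LIMSEQ_Suc[OF e_lim[OF I(2,3)]]]])
        have "{n. p n = p n0} \<subseteq> {n. e b c (\<tau> (Suc (Suc n)) \<omega>) = 0}"
          using e_zero unfolding p_def abc by (auto simp: prod_eq_iff) metis
        then show "infinite {n. e b c (\<tau> (Suc (Suc n)) \<omega>) = 0}" using n0 infinite_super by blast
      qed
      \<comment> \<open>The limit may be \<open>T\<close> itself; the lower bound for
        \<open>Y\<close> by the switching value is available there as well, through the terminal
        condition.\<close>
      moreover have DT: "D \<omega> \<in> {0..T}" using bounded_timesD(2,3)[OF D_bt] by simp
      moreover have "\<gamma> a c (D \<omega>) \<omega> < \<gamma> a b (D \<omega>) \<omega> + \<gamma> b c (D \<omega>) \<omega>"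
        using elim(4) I ne DT by blast
      ultimately have *: "\<gamma> a c (D \<omega>) \<omega> < Y c (D \<omega>) \<omega> - Y a (D \<omega>) \<omega>"
        unfolding e_def by linarith
      show False
      proof (cases "a = c")
        \<comment> \<open>The two switches form a round trip, whose direct counterpart is not a
          switch; the vanishing diagonal cost gives the contradiction instead.\<close>
        case True
        moreover have "\<gamma> a a (D \<omega>) \<omega> = 0" using elim(3) I(1) DT by blast
        ultimately show False using * by simp
      next
        case False
        then have "Y c (D \<omega>) \<omega> - \<gamma> a c (D \<omega>) \<omega> \<le> L a (D \<omega>) \<omega>" by (intro L_ge I) simp
        also have "\<dots> \<le> Y a (D \<omega>) \<omega>" by (rule regularD(4)[OF r I(1) DT])
        finally show False using * by linarith
      qed
    qed
  qed
qed

text \<open>Without defects the accumulated cost equals profit plus end value minus initial value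
  minus accumulated gain. The first three are bounded by \<open>\<xi>\<close> each, so only the
  supremum of the gain martingale is left.\<close>

lemma cost_finite_of_martingale:
  assumes defect: "AE \<omega> in M. \<forall>k. defect k \<omega> = 0"
    and mart: "\<And>k A. A \<in> sets (pre_sigma (\<tau> k)) \<Longrightarrow> expectation (\<lambda>\<omega>. indicator A \<omega> * gain k \<omega>) = 0"
  shows "(\<integral>\<^sup>+\<omega>. (SUP n. ennreal \<bar>cost n \<omega>\<bar>) \<partial>M) < \<infinity>"
proof -
  note [measurable] = gain_measurable_M \<xi>_measurable
  have "(\<integral>\<^sup>+\<omega>. (SUP n. ennreal \<bar>cost n \<omega>\<bar>) \<partial>M)
      \<le> (\<integral>\<^sup>+\<omega>. ennreal (3 * \<xi> \<omega>) + (SUP n. ennreal \<bar>\<Sum>k<n. gain k \<omega>\<bar>) \<partial>M)"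
  proof (rule nn_integral_mono_AE)
    show "AE \<omega> in M. (SUP n. ennreal \<bar>cost n \<omega>\<bar>) \<le> ennreal (3 * \<xi> \<omega>) + (SUP n. ennreal \<bar>\<Sum>k<n. gain k \<omega>\<bar>)"
      using defect AE_regular
    proof eventually_elim
      case (elim \<omega>)
      show ?case
      proof (rule SUP_least)
        fix n
        have "value_process n \<omega> = Y i t \<omega> + (\<Sum>k<n. gain k \<omega>)" using elim(1) by (simp add: value_process_def)
        moreover have "\<bar>Y i t \<omega>\<bar> \<le> \<xi> \<omega>" by (rule regularD(3)[OF elim(2) i t])
        ultimately have "\<bar>cost n \<omega>\<bar> \<le> 3 * \<xi> \<omega> + \<bar>\<Sum>k<n. gain k \<omega>\<bar>"
          using running_profit_bound[OF elim(2), of n] end_value_bound[OF elim(2), of n] value_process_eq[OF elim(2), of n]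
          by linarith
        then have "ennreal \<bar>cost n \<omega>\<bar> \<le> ennreal (3 * \<xi> \<omega> + \<bar>\<Sum>k<n. gain k \<omega>\<bar>)" by (rule ennreal_leI)
        also have "\<dots> = ennreal (3 * \<xi> \<omega>) + ennreal \<bar>\<Sum>k<n. gain k \<omega>\<bar>"
          by (rule ennreal_plus) (use \<xi>_nonneg[of \<omega>] in simp_all)
        also have "\<dots> \<le> ennreal (3 * \<xi> \<omega>) + (SUP n. ennreal \<bar>\<Sum>k<n. gain k \<omega>\<bar>)"
          by (intro add_left_mono SUP_upper) simp
        finally show "ennreal \<bar>cost n \<omega>\<bar> \<le> ennreal (3 * \<xi> \<omega>) + (SUP n. ennreal \<bar>\<Sum>k<n. gain k \<omega>\<bar>)" .
      qed
    qed
  qed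
  also have "\<dots> = (\<integral>\<^sup>+\<omega>. ennreal (3 * \<xi> \<omega>) \<partial>M) + (\<integral>\<^sup>+\<omega>. (SUP n. ennreal \<bar>\<Sum>k<n. gain k \<omega>\<bar>) \<partial>M)"
    by (rule nn_integral_add) measurable
  also have "\<dots> < \<infinity>"
  proof -
    have "(\<integral>\<^sup>+\<omega>. ennreal (3 * \<xi> \<omega>) \<partial>M) = ennreal (expectation (\<lambda>\<omega>. 3 * \<xi> \<omega>))"
      using \<xi>_integrable \<xi>_nonneg by (intro nn_integral_eq_integral) auto
    then show ?thesis using gain_sup_finite[OF mart] by (simp add: ennreal_add_less_top)
  qed
  finally show ?thesis .
qed

end

section \<open>Upper bound for all strategies, and optimality of the candidate\<close>

context switching_system
begin

text \<open>A strategy satisfies the bounds on its times almost surely only. Clipping produces a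
  plan with almost surely the same times, hence with the same costs and the same payoff, to which
  the pathwise analysis applies.\<close>

lemma strategy_performance_le:
  assumes t: "t \<in> {0..T}" and i: "i \<in> {1..m}" and strat: "(\<tau>, \<iota>) \<in> strategies M F T m \<gamma> t i"
  shows "AE \<omega> in M. performance M F T \<psi> \<gamma> \<Gamma> t \<tau> \<iota> \<omega> \<le> Y i t \<omega>"
proof -
  \<comment> \<open>Outside \<open>space M\<close> nothing is known about the times; the constant
    \<open>t\<close> supplies bounds and monotonicity there too.\<close>
  define \<tau>' where "\<tau>' n \<omega> = (if \<omega> \<in> space M then max t (min T (\<tau> n \<omega>)) else t)" for n \<omega>
  have \<tau>: "\<tau> n \<in> stopping_times_from M F T (\<lambda>_. t)" for n using strat by (simp add: strategies_def)
  have path: "\<tau> 0 \<omega> = t" "\<tau> n \<omega> \<le> \<tau> (Suc n) \<omega>" "\<iota> 0 \<omega> = i" "\<iota> n \<omega> \<noteq> \<iota> (Suc n) \<omega>" if "\<omega> \<in> space M" for \<omega> n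
    using strat that by (auto simp: strategies_def)
  have st: "stopping_time F (\<tau> n)" for n
    using \<tau>[of n] by (simp add: stopping_times_from_def stopping_times_def)
  have ae: "AE \<omega> in M. \<tau> n \<omega> = \<tau>' n \<omega>" for n
    using later_times_clip(2)[OF t \<tau>[of n]] AE_space by eventually_elim (simp add: \<tau>'_def)
  have st': "stopping_time F (\<tau>' n)" for n by (rule stopping_time_AE_cong[OF st ae])
  have plan: "switching_plan M F T m \<psi> \<gamma> \<Gamma> Y t i \<tau>' \<iota>"
  proof
    show "t \<in> {0..T}" "i \<in> {1..m}" using t i .
    show "\<tau>' n \<in> bounded_times" for n
      by (rule bounded_timesI[OF st']) (use t in \<open>auto simp: \<tau>'_def\<close>)
    show "\<tau>' n \<omega> \<le> \<tau>' (Suc n) \<omega>" for n \<omega>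
    proof (cases "\<omega> \<in> space M")
      case True
      show ?thesis using path(2)[OF True, of n] True by (auto simp: \<tau>'_def)
    qed (simp add: \<tau>'_def)
    show "\<tau>' 0 \<omega> = t" for \<omega> using path(1)[of \<omega>] t by (simp add: \<tau>'_def)
    have "\<iota> n \<in> measurable (pre_sigma (\<tau> n)) (count_space {1..m})" for n
      using strat by (simp add: strategies_def)
    then show "\<iota> n \<in> measurable (pre_sigma (\<tau>' n)) (count_space {1..m})" for n
      using measurable_cong_sets[OF sets_pre_sigma_AE_cong[OF st st' ae] refl] by blast
    show "\<iota> 0 \<omega> = i" "\<iota> n \<omega> \<noteq> \<iota> (Suc n) \<omega>" if "\<omega> \<in> space M" for \<omega> n using path that by auto
  qed
  then interpret P: switching_plan M F T m \<psi> \<gamma> \<Gamma> Y t i \<tau>' \<iota> .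
  have all: "AE \<omega> in M. \<forall>n. \<tau> n \<omega> = \<tau>' n \<omega>" using ae by (simp add: AE_all_countable)
  have fin: "AE \<omega> in M. \<exists>n. T \<le> \<tau>' n \<omega>"
  proof -
    have [measurable]: "\<tau> n \<in> borel_measurable M" for n
      by (rule measurable_stopping_time[OF st F_subset space_F])
    have "{\<omega> \<in> space M. \<forall>n. \<tau> n \<omega> < T} \<in> sets M" by measurable
    moreover have "measure M {\<omega> \<in> space M. \<forall>n. \<tau> n \<omega> < T} = 0" using strat by (simp add: strategies_def)
    ultimately have "AE \<omega> in M. \<not> (\<forall>n. \<tau> n \<omega> < T)"
      by (subst AE_iff_measurable[OF _ refl]) (simp_all add: emeasure_eq_measure)
    then show ?thesis using all by eventually_elim (auto simp: not_less)
  qed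
  have cost: "(\<integral>\<^sup>+\<omega>. (SUP n. ennreal \<bar>cumulative_cost T \<gamma> \<tau>' \<iota> n \<omega>\<bar>) \<partial>M) < \<infinity>"
  proof -
    have "(\<integral>\<^sup>+\<omega>. (SUP n. ennreal \<bar>cumulative_cost T \<gamma> \<tau>' \<iota> n \<omega>\<bar>) \<partial>M)
        = (\<integral>\<^sup>+\<omega>. (SUP n. ennreal \<bar>cumulative_cost T \<gamma> \<tau> \<iota> n \<omega>\<bar>) \<partial>M)"
    proof (rule nn_integral_cong_AE)
      show "AE \<omega> in M. (SUP n. ennreal \<bar>cumulative_cost T \<gamma> \<tau>' \<iota> n \<omega>\<bar>) = (SUP n. ennreal \<bar>cumulative_cost T \<gamma> \<tau> \<iota> n \<omega>\<bar>)"
        using all by eventually_elim (simp add: cumulative_cost_def)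
    qed
    then show ?thesis using strat by (simp add: strategies_def)
  qed
  interpret G: finite_measure_subalgebra M "F t" by unfold_locales (rule subalgebra_F)
  define f where "f \<omega> = (LINT s:{t..T}|lborel. \<psi> (mode_indicator \<tau> \<iota> s \<omega>) s \<omega>)
       + \<Gamma> (mode_indicator \<tau> \<iota> T \<omega>) \<omega>
       - (\<Sum>n. \<gamma> (\<iota> n \<omega>) (\<iota> (Suc n) \<omega>) (\<tau> (Suc n) \<omega>) \<omega> * of_bool (\<tau> (Suc n) \<omega> < T))" for \<omega>
  have f: "AE \<omega> in M. P.payoff \<omega> = f \<omega>"
    using all
  proof eventually_elim
    case (elim \<omega>)
    have "mode_indicator \<tau> \<iota> s \<omega> = mode_indicator \<tau>' \<iota> s \<omega>" for s
      unfolding mode_indicator_def using elim by simp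
    then show ?case unfolding P.payoff_def f_def using elim by simp
  qed
  note meas = borel_measurable_integrable[OF P.payoff_approx(1)[OF fin cost]]
  have "AE \<omega> in M. real_cond_exp M (F t) P.payoff \<omega> = real_cond_exp M (F t) f \<omega>"
    by (rule G.real_cond_exp_cong[OF f meas borel_measurable_AE_cong[OF meas f]])
  then show ?thesis
    using P.cond_exp_payoff_le[OF fin cost] unfolding performance_def f_def[symmetric]
    by eventually_elim simp
qed

lemma next_mode:
  shows "next_mode m \<gamma> Y s k \<omega> \<in> {1..m}" "next_mode m \<gamma> Y s k \<omega> \<noteq> k"
    and "Y (next_mode m \<gamma> Y s k \<omega>) s \<omega> - \<gamma> k (next_mode m \<gamma> Y s k \<omega>) s \<omega> = L k s \<omega>"
proof -
  obtain j where "j \<in> {1..m}" "j \<noteq> k" "L k s \<omega> = Y j s \<omega> - \<gamma> k j s \<omega>" by (rule L_attained)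
  then have "j \<in> {1..m} \<and> j \<noteq> k \<and> Y j s \<omega> - \<gamma> k j s \<omega> = L k s \<omega>" by simp
  note * = LeastI[of "\<lambda>j. j \<in> {1..m} \<and> j \<noteq> k \<and> Y j s \<omega> - \<gamma> k j s \<omega> = L k s \<omega>", OF this, folded next_mode_def]
  show "next_mode m \<gamma> Y s k \<omega> \<in> {1..m}" "next_mode m \<gamma> Y s k \<omega> \<noteq> k"
    "Y (next_mode m \<gamma> Y s k \<omega>) s \<omega> - \<gamma> k (next_mode m \<gamma> Y s k \<omega>) s \<omega> = L k s \<omega>"
    using * by blast+
qed

lemma next_mode_measurable:
  assumes \<sigma>: "\<sigma> \<in> bounded_times" and k: "k \<in> {1..m}"
  shows "(\<lambda>\<omega>. next_mode m \<gamma> Y (\<sigma> \<omega>) k \<omega>) \<in> measurable (pre_sigma \<sigma>) (count_space {1..m})"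
proof -
  have stopped: "(\<lambda>\<omega>. Z (\<sigma> \<omega>) \<omega>) \<in> borel_measurable (pre_sigma \<sigma>)" if "Z \<in> space_Q M F T" for Z
    by (rule borel_measurable_stopped[OF space_Q_adapted[OF that] \<sigma>])
  have "Measurable.pred (pre_sigma \<sigma>) (\<lambda>\<omega>. j \<in> {1..m} \<and> j \<noteq> k \<and> Y j (\<sigma> \<omega>) \<omega> - \<gamma> k j (\<sigma> \<omega>) \<omega> = L k (\<sigma> \<omega>) \<omega>)" for j
  proof (cases "j \<in> {1..m} \<and> j \<noteq> k")
    case True
    then have "\<gamma> k j \<in> space_Q M F T" using gamma_Q_S2[of k j] k by simp
    from borel_measurable_diff[OF stopped[OF Y_spaces(1)[OF conjunct1[OF True]]] stopped[OF this]]
    have "{\<omega> \<in> space (pre_sigma \<sigma>). Y j (\<sigma> \<omega>) \<omega> - \<gamma> k j (\<sigma> \<omega>) \<omega> = L k (\<sigma> \<omega>) \<omega>} \<in> sets (pre_sigma \<sigma>)"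
      by (rule borel_measurable_eq[OF _ stopped[OF L_space_Q[OF k]]])
    then show ?thesis using True by (simp add: pred_def)
  next
    case False
    then have "(\<lambda>\<omega>. j \<in> {1..m} \<and> j \<noteq> k \<and> Y j (\<sigma> \<omega>) \<omega> - \<gamma> k j (\<sigma> \<omega>) \<omega> = L k (\<sigma> \<omega>) \<omega>) = (\<lambda>_. False)" by auto
    then show ?thesis by simp
  qed
  then have m: "(\<lambda>\<omega>. next_mode m \<gamma> Y (\<sigma> \<omega>) k \<omega>) \<in> measurable (pre_sigma \<sigma>) (count_space UNIV)"
    unfolding next_mode_def by (rule measurable_Least)
  show ?thesis
  proof (rule measurableI)
    show "next_mode m \<gamma> Y (\<sigma> \<omega>) k \<omega> \<in> space (count_space {1..m})" for \<omega>
      using next_mode(1) by simp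
    show "(\<lambda>\<omega>. next_mode m \<gamma> Y (\<sigma> \<omega>) k \<omega>) -` A \<inter> space (pre_sigma \<sigma>) \<in> sets (pre_sigma \<sigma>)" for A
      by (rule measurable_sets[OF m]) simp
  qed
qed


lemma candidate_0: "candidate_time T m \<gamma> Y t i 0 \<omega> = t" "candidate_mode T m \<gamma> Y t i 0 \<omega> = i"
  by (simp_all add: candidate_time_def candidate_mode_def)

lemma candidate_Suc:
  "candidate_time T m \<gamma> Y t i (Suc n) \<omega> = hit (candidate_mode T m \<gamma> Y t i n \<omega>) (candidate_time T m \<gamma> Y t i n \<omega>) \<omega>"
  "candidate_mode T m \<gamma> Y t i (Suc n) \<omega> =
    next_mode m \<gamma> Y (candidate_time T m \<gamma> Y t i (Suc n) \<omega>) (candidate_mode T m \<gamma> Y t i n \<omega>) \<omega>"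
  by (simp_all add: candidate_time_def candidate_mode_def split_def Let_def)

text \<open>The mode is known at \<open>\<sigma>\<close>, thus also at the hitting time for each
  fixed mode; the event \<open>hit \<le> s\<close> is a finite union over the modes.\<close>

lemma hit_random_mode_bounded_times:
  assumes \<sigma>: "\<sigma> \<in> bounded_times" and \<kappa>: "\<kappa> \<in> measurable (pre_sigma \<sigma>) (count_space {1..m})"
  shows "(\<lambda>\<omega>. hit (\<kappa> \<omega>) (\<sigma> \<omega>) \<omega>) \<in> bounded_times"
proof (rule bounded_timesI)
  have \<sigma>T: "\<sigma> \<omega> \<le> T" for \<omega> by (rule bounded_timesD(3)[OF \<sigma>])
  show "hit (\<kappa> \<omega>) (\<sigma> \<omega>) \<omega> \<le> T" for \<omega> by (rule hit_bounds(2)[OF \<sigma>T])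
  show "0 \<le> hit (\<kappa> \<omega>) (\<sigma> \<omega>) \<omega>" for \<omega>
    by (rule order_trans[OF bounded_timesD(2)[OF \<sigma>] hit_bounds(1)[OF \<sigma>T]])
  show "stopping_time F (\<lambda>\<omega>. hit (\<kappa> \<omega>) (\<sigma> \<omega>) \<omega>)"
    unfolding stopping_time_iff
  proof
    fix s
    have *: "{\<omega> \<in> {\<omega> \<in> space M. \<kappa> \<omega> = j}. hit j (\<sigma> \<omega>) \<omega> \<le> s} \<in> sets (F s)" if j: "j \<in> {1..m}" for j
    proof -
      note hj = hit_bounded_times[OF j \<sigma>]
      have "\<kappa> -` {j} \<inter> space (pre_sigma \<sigma>) \<in> sets (pre_sigma \<sigma>)"
        by (rule measurable_sets[OF \<kappa>]) (use j in simp)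
      also have "\<kappa> -` {j} \<inter> space (pre_sigma \<sigma>) = {\<omega> \<in> space M. \<kappa> \<omega> = j}" by (auto simp: space_pre_sigma)
      finally have "{\<omega> \<in> space M. \<kappa> \<omega> = j} \<in> sets (pre_sigma (\<lambda>\<omega>. hit j (\<sigma> \<omega>) \<omega>))"
        using mono_pre_sigma[OF bounded_timesD(1)[OF \<sigma>] bounded_timesD(1)[OF hj] hit_bounds(1)[OF \<sigma>T]] by blast
      then show ?thesis by (rule sets_pre_sigmaD[OF bounded_timesD(1)[OF hj]])
    qed
    have "(\<Union>j\<in>{1..m}. {\<omega> \<in> {\<omega> \<in> space M. \<kappa> \<omega> = j}. hit j (\<sigma> \<omega>) \<omega> \<le> s}) \<in> sets (F s)"
      by (intro sets.finite_UN *) auto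
    also have "(\<Union>j\<in>{1..m}. {\<omega> \<in> {\<omega> \<in> space M. \<kappa> \<omega> = j}. hit j (\<sigma> \<omega>) \<omega> \<le> s}) = {\<omega> \<in> space M. hit (\<kappa> \<omega>) (\<sigma> \<omega>) \<omega> \<le> s}"
      using measurable_space[OF \<kappa>] by (auto simp: space_pre_sigma)
    finally show "{\<omega> \<in> space M. hit (\<kappa> \<omega>) (\<sigma> \<omega>) \<omega> \<le> s} \<in> sets (F s)" .
  qed
qed

text \<open>Times and modes are treated in one induction: the next time is a stopping time because
  the current mode is known at the current time, and the next mode is measurable because the next
  time is a stopping time.\<close>

lemma candidate_plan:
  assumes t: "t \<in> {0..T}" and i: "i \<in> {1..m}"
  shows "switching_plan M F T m \<psi> \<gamma> \<Gamma> Y t i (candidate_time T m \<gamma> Y t i) (candidate_mode T m \<gamma> Y t i)"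
proof -
  let ?\<tau> = "candidate_time T m \<gamma> Y t i" and ?\<iota> = "candidate_mode T m \<gamma> Y t i"
  have main: "?\<tau> n \<in> bounded_times \<and> ?\<iota> n \<in> measurable (pre_sigma (?\<tau> n)) (count_space {1..m})" for n
  proof (induction n)
    case 0
    have "?\<tau> 0 = (\<lambda>_. t)" "?\<iota> 0 = (\<lambda>_. i)" by (simp_all add: candidate_0 fun_eq_iff)
    then show ?case using bounded_times_const[OF t] i by simp
  next
    case (Suc n)
    then have \<tau>n: "?\<tau> n \<in> bounded_times" and \<iota>n: "?\<iota> n \<in> measurable (pre_sigma (?\<tau> n)) (count_space {1..m})" by auto
    have \<tau>S: "?\<tau> (Suc n) \<in> bounded_times"
      using hit_random_mode_bounded_times[OF \<tau>n \<iota>n] unfolding candidate_Suc(1)[abs_def] .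
    have le: "?\<tau> n \<omega> \<le> ?\<tau> (Suc n) \<omega>" for \<omega>
      unfolding candidate_Suc(1) by (rule hit_bounds(1)[OF bounded_timesD(3)[OF \<tau>n]])
    have sub: "subalgebra (pre_sigma (?\<tau> (Suc n))) (pre_sigma (?\<tau> n))"
      using mono_pre_sigma[OF bounded_timesD(1)[OF \<tau>n] bounded_timesD(1)[OF \<tau>S] le]
      by (simp add: subalgebra_def space_pre_sigma)
    have "?\<iota> (Suc n) = (\<lambda>\<omega>. next_mode m \<gamma> Y (?\<tau> (Suc n) \<omega>) (?\<iota> n \<omega>) \<omega>)"
      by (rule ext) (rule candidate_Suc(2))
    moreover have "(\<lambda>\<omega>. next_mode m \<gamma> Y (?\<tau> (Suc n) \<omega>) (?\<iota> n \<omega>) \<omega>) \<in> measurable (pre_sigma (?\<tau> (Suc n))) (count_space {1..m})"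
      by (rule measurable_compose_countable'[where f="\<lambda>k \<omega>. next_mode m \<gamma> Y (?\<tau> (Suc n) \<omega>) k \<omega>",
            OF next_mode_measurable[OF \<tau>S] measurable_from_subalg[OF sub \<iota>n]]) simp_all
    ultimately show ?case using \<tau>S by simp
  qed
  show ?thesis
  proof
    show "t \<in> {0..T}" "i \<in> {1..m}" using t i .
    show "?\<tau> n \<in> bounded_times" "?\<iota> n \<in> measurable (pre_sigma (?\<tau> n)) (count_space {1..m})" for n using main by auto
    show "?\<tau> n \<omega> \<le> ?\<tau> (Suc n) \<omega>" for n \<omega>
      unfolding candidate_Suc(1) by (rule hit_bounds(1)[OF bounded_timesD(3)]) (use main in blast)
    show "?\<iota> n \<omega> \<noteq> ?\<iota> (Suc n) \<omega>" for n \<omega>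
      unfolding candidate_Suc(2) by (rule next_mode(2)[symmetric])
  qed (rule candidate_0)+
qed

lemma candidate_optimal:
  assumes t: "t \<in> {0..T}" and i: "i \<in> {1..m}"
  defines "\<tau> \<equiv> candidate_time T m \<gamma> Y t i" and "\<iota> \<equiv> candidate_mode T m \<gamma> Y t i"
  shows "(\<tau>, \<iota>) \<in> strategies M F T m \<gamma> t i"
    and "AE \<omega> in M. performance M F T \<psi> \<gamma> \<Gamma> t \<tau> \<iota> \<omega> = Y i t \<omega>"
proof -
  interpret P: switching_plan M F T m \<psi> \<gamma> \<Gamma> Y t i \<tau> \<iota>
    unfolding \<tau>_def \<iota>_def by (rule candidate_plan[OF t i])
  have hit: "\<tau> (Suc k) \<omega> = hit (\<iota> k \<omega>) (\<tau> k \<omega>) \<omega>" for k \<omega>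
    unfolding \<tau>_def \<iota>_def by (rule candidate_Suc(1))
  have mode: "Y (\<iota> (Suc k) \<omega>) (\<tau> (Suc k) \<omega>) \<omega> - \<gamma> (\<iota> k \<omega>) (\<iota> (Suc k) \<omega>) (\<tau> (Suc k) \<omega>) \<omega> = L (\<iota> k \<omega>) (\<tau> (Suc k) \<omega>) \<omega>" for k \<omega>
    unfolding \<tau>_def \<iota>_def candidate_Suc(2)[of t i k] by (rule next_mode(3))
  have defect: "AE \<omega> in M. \<forall>k. P.defect k \<omega> = 0"
    unfolding AE_all_countable
  proof
    fix k
    \<comment> \<open>One null set for all modes, since the mode in force at step \<open>k\<close>
      is random.\<close>
    have "AE \<omega> in M. \<forall>j\<in>{1..m}. hit j (\<tau> k \<omega>) \<omega> < T \<longrightarrow> Y j (hit j (\<tau> k \<omega>) \<omega>) \<omega> = L j (hit j (\<tau> k \<omega>) \<omega>) \<omega>"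
      by (rule AE_finite_allI) (simp, rule hit_value[OF _ P.\<tau>_bt])
    then show "AE \<omega> in M. P.defect k \<omega> = 0"
      using AE_space
    proof eventually_elim
      case (elim \<omega>)
      have "\<tau> (Suc k) \<omega> < T \<longrightarrow> Y (\<iota> k \<omega>) (\<tau> (Suc k) \<omega>) \<omega> = L (\<iota> k \<omega>) (\<tau> (Suc k) \<omega>) \<omega>"
        using bspec[OF elim(1) P.\<iota>_range[OF elim(2), of k]] unfolding hit[symmetric] .
      then show ?case using mode[of k \<omega>] by (auto simp: P.defect_def)
    qed
  qed
  have mart: "expectation (\<lambda>\<omega>. indicator A \<omega> * P.gain k \<omega>) = 0" if A: "A \<in> sets (pre_sigma (\<tau> k))" for k A
    unfolding P.gain_indicator_sum[OF A]
  proof (intro sum.neutral ballI)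
    fix j assume j: "j \<in> {1..m}"
    let ?E = "A \<inter> {\<omega> \<in> space M. \<iota> k \<omega> = j}"
    have "expectation (\<lambda>\<omega>. indicator ?E \<omega> * (X j (\<tau> (Suc k) \<omega>) \<omega> - X j (\<tau> k \<omega>) \<omega>))
        = expectation (\<lambda>\<omega>. indicator ?E \<omega> * (X j (hit j (\<tau> k \<omega>) \<omega>) \<omega> - X j (\<tau> k \<omega>) \<omega>))"
      by (rule Bochner_Integration.integral_cong[OF refl]) (simp add: indicator_def hit)
    also have "\<dots> = 0"
      by (rule X_hit_martingale[OF j P.\<tau>_bt]) (intro sets.Int A P.mode_event)
    finally show "expectation (\<lambda>\<omega>. indicator ?E \<omega> * (X j (\<tau> (Suc k) \<omega>) \<omega> - X j (\<tau> k \<omega>) \<omega>)) = 0" .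
  qed
  \<comment> \<open>Both admissibility conditions follow from vanishing defects, the second with the
    martingale property of the gains. They are thus available before the strategy is known to be
    admissible, which avoids circularity.\<close>
  have fin: "AE \<omega> in M. \<exists>n. T \<le> \<tau> n \<omega>" by (rule P.finitely_many_switches[OF defect])
  have cost: "(\<integral>\<^sup>+\<omega>. (SUP n. ennreal \<bar>cumulative_cost T \<gamma> \<tau> \<iota> n \<omega>\<bar>) \<partial>M) < \<infinity>"
    by (rule P.cost_finite_of_martingale[OF defect mart])
  have "\<tau> n \<in> stopping_times_from M F T (\<lambda>_. t)" for n
    using P.\<tau>_bt[of n] P.\<tau>_le[of 0 n] P.\<tau>_0 by (intro later_times_stopping_times_from) (simp add: later_times_def)
  moreover have "measure M {\<omega> \<in> space M. \<forall>n. \<tau> n \<omega> < T} = 0"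
  proof -
    have "AE \<omega> in M. \<omega> \<notin> {\<omega> \<in> space M. \<forall>n. \<tau> n \<omega> < T}"
      using fin by eventually_elim (auto simp: not_less)
    moreover have "{\<omega> \<in> space M. \<forall>n. \<tau> n \<omega> < T} \<in> sets M"
      using P.\<tau>_measurable by measurable
    ultimately show ?thesis by (simp add: AE_iff_measurable[OF _ refl] measure_def AE_not_in null_sets_def)
  qed
  ultimately show "(\<tau>, \<iota>) \<in> strategies M F T m \<gamma> t i"
    unfolding strategies_def using P.\<tau>_0 P.\<tau>_Suc P.\<iota>_measurable P.\<iota>_0 P.\<iota>_Suc cost by simp
  show "AE \<omega> in M. performance M F T \<psi> \<gamma> \<Gamma> t \<tau> \<iota> \<omega> = Y i t \<omega>"
    using P.cond_exp_payoff_eq[OF fin cost defect mart] unfolding performance_def P.payoff_def[abs_def] .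
qed

end

theorem theorem5p2:
  fixes M :: "'a measure" and F :: "real \<Rightarrow> 'a measure" and T :: real and m :: nat
    and \<psi> :: "nat \<Rightarrow> real \<Rightarrow> 'a \<Rightarrow> real"
    and \<gamma> :: "nat \<Rightarrow> nat \<Rightarrow> real \<Rightarrow> 'a \<Rightarrow> real"
    and \<Gamma> :: "nat \<Rightarrow> 'a \<Rightarrow> real"
    and Y :: "nat \<Rightarrow> real \<Rightarrow> 'a \<Rightarrow> real"
    and t :: real and i :: nat
  assumes problem: "switching_problem M F T m \<psi> \<gamma> \<Gamma>"
    and system: "optimal_stopping_system M F T m \<psi> \<gamma> \<Gamma> Y"
    and unique: "\<And>Y'. optimal_stopping_system M F T m \<psi> \<gamma> \<Gamma> Y' \<Longrightarrow>
           \<forall>j\<in>{1..m}. indistinguishable M T (Y' j) (Y j)"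
    and t: "t \<in> {0..T}"
    and i: "i \<in> {1..m}"
  defines "\<tau>star \<equiv> candidate_time T m \<gamma> Y t i"
    and "\<iota>star \<equiv> candidate_mode T m \<gamma> Y t i"
  shows "(\<tau>star, \<iota>star) \<in> strategies M F T m \<gamma> t i \<and>
         (AE \<omega> in M. Y i t \<omega> = performance M F T \<psi> \<gamma> \<Gamma> t \<tau>star \<iota>star \<omega>) \<and>
         is_ess_sup M
           {performance M F T \<psi> \<gamma> \<Gamma> t \<tau> \<iota> | \<tau> \<iota>. (\<tau>, \<iota>) \<in> strategies M F T m \<gamma> t i}
           (performance M F T \<psi> \<gamma> \<Gamma> t \<tau>star \<iota>star)"
proof -
  interpret switching_system M F T m \<psi> \<gamma> \<Gamma> Y
    by (intro switching_system.intro problem switching_system_axioms.intro system)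
  have strat: "(\<tau>star, \<iota>star) \<in> strategies M F T m \<gamma> t i"
    and opt: "AE \<omega> in M. performance M F T \<psi> \<gamma> \<Gamma> t \<tau>star \<iota>star \<omega> = Y i t \<omega>"
    unfolding \<tau>star_def \<iota>star_def using candidate_optimal[OF t i] by auto
  \<comment> \<open>The candidate belongs to the family, so dominating every other member makes its
    performance the least upper bound.\<close>
  have le: "AE \<omega> in M. performance M F T \<psi> \<gamma> \<Gamma> t \<tau> \<iota> \<omega> \<le> performance M F T \<psi> \<gamma> \<Gamma> t \<tau>star \<iota>star \<omega>"
    if "(\<tau>, \<iota>) \<in> strategies M F T m \<gamma> t i" for \<tau> \<iota>
    using strategy_performance_le[OF t i that] opt by eventually_elim simp
  have "performance M F T \<psi> \<gamma> \<Gamma> t \<tau>star \<iota>star \<in> borel_measurable M"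
    unfolding performance_def by (rule borel_measurable_cond_exp2)
  then have "is_ess_sup M
      {performance M F T \<psi> \<gamma> \<Gamma> t \<tau> \<iota> | \<tau> \<iota>. (\<tau>, \<iota>) \<in> strategies M F T m \<gamma> t i}
      (performance M F T \<psi> \<gamma> \<Gamma> t \<tau>star \<iota>star)"
    unfolding is_ess_sup_def using le strat by blast
  moreover have "AE \<omega> in M. Y i t \<omega> = performance M F T \<psi> \<gamma> \<Gamma> t \<tau>star \<iota>star \<omega>"
    using opt by eventually_elim simp
  ultimately show ?thesis using strat by blast
qed

end
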